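(* Let $\sum_{i=1}^nh_i^2\,du_i^2$ be a flat Egoroff metric on $\Omega$, $\beta$ its rotation coefficient matrix, and $F=\begin{pmatrix}E&X\\0&1\end{pmatrix}$ its extended frame. Let $\pi$ be a Hermitian projection of $\mathbb{C}^n$, $z\in\mathbb{C}\setminus(\mathbb{R}\cup\mathrm{i}\mathbb{R})$, and $f_{z,\pi}=g_{-\bar z,\rho}g_{z,\pi}$, where $\rho$ is the Hermitian projection onto $g_{z,\pi}(-\bar z)(\mathrm{Im}\,\bar\pi)$. Then $$f_{z,\pi}\ast F:=g_{-\bar z,\rho}\ast(g_{z,\pi}\ast F)=\begin{pmatrix}\hat E&\hat X\\0&1\end{pmatrix}$$ is the extended frame of a new flat Egoroff metric $\sum_{i=1}^n\hat h_i^2\,du_i^2$ (on a neighbourhood of $0$ where all $\hat h_i\neq0$). Here $$\hat X=g_{-z,\rho^\perp}g_{\bar z,\pi^\perp}\Big(X-\frac{\bar z-z}{\lambda-z}E\tilde\pi\eta_1-\frac{\bar z-z}{\lambda+\bar z}E\,g_{z,\tilde\pi^\perp}\,\tilde\rho\,\eta_{12}\Big),$$ $$\hat h=f_{z,\pi}\ast h=h+\mathrm{i}(z-\bar z)(\tilde\pi\eta_1+\tilde\rho\,\eta_{12}),\qquad \hat\beta=f_{z,\pi}\ast\beta=\beta+\mathrm{i}(z-\bar z)(\tilde\pi+\tilde\rho)_\ast,$$ where $\hat\beta$ is the rotation coefficient matrix of the new metric, $\tilde\pi(u)$ is the Hermitian projection of $\mathbb{C}^n$ onto $E(u,z)^{-1}(\mathrm{Im}\,\pi)$,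 $\tilde\rho(u)$ is the Hermitian projection of $\mathbb{C}^n$ onto $g_{z,\tilde\pi}(-\bar z)E(u,-\bar z)^{-1}(\mathrm{Im}\,\bar\pi)$, $\eta_1(u)=E(u,\bar z)^{-1}X(u,\bar z)$, and $$\eta_{12}=g_{\bar z,\tilde\pi^\perp}(-z)\,E(u,-z)^{-1}X(u,-z)+\frac{\bar z-z}{\bar z+z}\,\tilde\pi\,\eta_1 .$$
   Context: $\Omega\subset\mathbb{R}^n$ is a connected, simply connected open neighbourhood of $0$ with coordinates $u$. $\delta=\mathrm{diag}(du_1,\dots,du_n)$, $[\delta,\beta]=\delta\beta-\beta\delta$. For a matrix $\xi$, $\xi_\ast$ is $\xi$ with diagonal entries replaced by $0$. A flat Egoroff metric is a flat Riemannian metric $\sum_i h_i^2\,du_i^2$, with $h_i$ smooth, real-valued and nowhere zero, for which there is a function $\phi$ with $\partial\phi/\partial u_i=h_i^2$; $h=(h_1,\dots,h_n)^t$. Its rotation coefficient matrix is $\beta_{ij}=(h_i)_{u_j}/h_j$ for $i\ne j$, $\beta_{ii}=0$ (symmetric). Its extended frame is the unique $F(u,\lambda)=\begin{pmatrix}E&X\\0&1\end{pmatrix}$, holomorphic in $\lambda\in\mathbb{C}$, with $F^{-1}dF=\begin{pmatrix}\mathrm{i}\lambda\delta+[\delta,\beta]&\delta h\\0&0\end{pmatrix}$, $F(0,\lambda)=\mathrm{I}$. A Hermitian projection is a matrix $\pi$ with $\pi^2=\pi=\pi^*$; $\pi^\perp=\mathrm{I}-\pi$; $\bar\pi$ is the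 entrywise conjugate. For $w\in\mathbb{C}\setminus\mathbb{R}$, $g_{w,\pi}(\lambda)=\pi+\frac{\lambda-\bar w}{\lambda-w}\pi^\perp$. Dressing: $\Lambda_+(m)$ is the group of holomorphic maps $\mathbb{C}\to GL(m,\mathbb{C})$, $\Lambda_-(m)$ the group of holomorphic maps from an open disk about $\infty$ (small enough to avoid all poles in question) to $GL(m,\mathbb{C})$ with value $\mathrm{I}$ at $\infty$. For $g\in\Lambda_-(n+1)$ and $G\in\Lambda_+(n+1)$, $g\ast G:=\tilde G$ where $gG=\tilde G\tilde g$ with $\tilde G\in\Lambda_+(n+1)$, $\tilde g\in\Lambda_-(n+1)$ (unique if it exists). Here $g_{w,\pi}\ast G$ abbreviates the action of $\begin{pmatrix}g_{w,\pi}&0\\0&\frac{\lambda-\bar w}{\lambda-w}\end{pmatrix}$, and the action is applied to $F(u,\cdot)$ for each $u$; $f_{z,\pi}\ast h$ and $f_{z,\pi}\ast\beta$ denote the $h$- and $\beta$-data of $f_{z,\pi}\ast F$. *)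

theory Defs
  imports "HOL-Analysis.Analysis" "HOL-Complex_Analysis.Complex_Analysis"
begin

section \<open>Flat Egoroff metrics\<close>

definition frame_domain :: "(real^'n) set \<Rightarrow> bool" where
  "frame_domain \<Omega> \<longleftrightarrow> open \<Omega> \<and> connected \<Omega> \<and> simply_connected \<Omega> \<and> 0 \<in> \<Omega>"

definition partial :: "'n \<Rightarrow> (real^'n \<Rightarrow> real) \<Rightarrow> real^'n \<Rightarrow> real" where
  "partial i f u = frechet_derivative f (at u) (axis i 1)"

text \<open>C-infinity on an open set: every iterated partial derivative is (totally) differentiable.\<close>

definition smooth_fun :: "(real^'n) set \<Rightarrow> (real^'n \<Rightarrow> real) \<Rightarrow> bool" where
  "smooth_fun \<Omega> f \<longleftrightarrow> (\<forall>js. \<forall>u\<in>\<Omega>. foldr partial js f differentiable (at u))"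

definition christoffel ::
  "(real^'n \<Rightarrow> real^'n^'n) \<Rightarrow> 'n \<Rightarrow> 'n \<Rightarrow> 'n \<Rightarrow> real^'n \<Rightarrow> real" where
  "christoffel g k i j u = (1/2) * (\<Sum>l\<in>UNIV. matrix_inv (g u) $ k $ l *
     (partial i (\<lambda>v. g v $ j $ l) u + partial j (\<lambda>v. g v $ i $ l) u
       - partial l (\<lambda>v. g v $ i $ j) u))"

text \<open>The component \<open>R\<^sup>l\<^sub>k\<^sub>i\<^sub>j\<close>, i.e. the \<open>l\<close>-th coordinate of
  \<open>R(\<partial>\<^sub>i,\<partial>\<^sub>j)\<partial>\<^sub>k\<close>.\<close>

definition riemann_curvature ::
  "(real^'n \<Rightarrow> real^'n^'n) \<Rightarrow> 'n \<Rightarrow> 'n \<Rightarrow> 'n \<Rightarrow> 'n \<Rightarrow> real^'n \<Rightarrow> real" where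
  "riemann_curvature g l k i j u =
     partial i (christoffel g l j k) u - partial j (christoffel g l i k) u
     + (\<Sum>m\<in>UNIV. christoffel g l i m u * christoffel g m j k u
                 - christoffel g l j m u * christoffel g m i k u)"

definition flat_on :: "(real^'n) set \<Rightarrow> (real^'n \<Rightarrow> real^'n^'n) \<Rightarrow> bool" where
  "flat_on \<Omega> g \<longleftrightarrow> (\<forall>u\<in>\<Omega>. \<forall>l k i j. riemann_curvature g l k i j u = 0)"

definition diag_metric :: "(real^'n \<Rightarrow> real^'n) \<Rightarrow> real^'n \<Rightarrow> real^'n^'n" where
  "diag_metric h u = (\<chi> i j. if i = j then (h u $ i)\<^sup>2 else 0)"

definition flat_egoroff :: "(real^'n) set \<Rightarrow> (real^'n \<Rightarrow> real^'n) \<Rightarrow> bool" where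
  "flat_egoroff \<Omega> h \<longleftrightarrow>
     (\<forall>i. smooth_fun \<Omega> (\<lambda>u. h u $ i)) \<and>
     (\<forall>u\<in>\<Omega>. \<forall>i. h u $ i \<noteq> 0) \<and>
     flat_on \<Omega> (diag_metric h) \<and>
     (\<exists>\<phi>. \<forall>u\<in>\<Omega>. \<phi> differentiable (at u) \<and> (\<forall>i. partial i \<phi> u = (h u $ i)\<^sup>2))"

definition rotation_coeff :: "(real^'n \<Rightarrow> real^'n) \<Rightarrow> real^'n \<Rightarrow> real^'n^'n" where
  "rotation_coeff h u =
     (\<chi> i j. if i = j then 0 else partial j (\<lambda>v. h v $ i) u / h u $ j)"


section \<open>Matrices and extended frames\<close>

text \<open>The spectral parameter is called \<open>\<mu>\<close> throughout.\<close>

definition cvec :: "real^'n \<Rightarrow> complex^'n" where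
  "cvec x = (\<chi> i. of_real (x $ i))"

definition cmat :: "real^'n^'n \<Rightarrow> complex^'n^'n" where
  "cmat A = map_matrix of_real A"

definition smult_mat :: "complex \<Rightarrow> complex^'n^'n \<Rightarrow> complex^'n^'n" where
  "smult_mat c A = map_matrix (\<lambda>x. c * x) A"

definition conj_mat :: "complex^'n^'n \<Rightarrow> complex^'n^'n" where
  "conj_mat A = map_matrix cnj A"

definition off_diag :: "complex^'n^'n \<Rightarrow> complex^'n^'n" where
  "off_diag A = (\<chi> i j. if i = j then 0 else A $ i $ j)"

text \<open>The block matrix with rows \<open>(A, b)\<close> and \<open>(0, d)\<close>.\<close>

definition block :: "complex^'n^'n \<Rightarrow> complex^'n \<Rightarrow> complex \<Rightarrow> complex^('n + 1)^('n + 1)" where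
  "block A b d = (\<chi> p q. case p of
       Inl i \<Rightarrow> (case q of Inl j \<Rightarrow> A $ i $ j | Inr _ \<Rightarrow> b $ i)
     | Inr _ \<Rightarrow> (case q of Inl j \<Rightarrow> 0 | Inr _ \<Rightarrow> d))"

text \<open>The matrix-valued one-form \<open>\<delta> = diag(du\<^sub>1, \<dots>, du\<^sub>n)\<close> evaluated at a tangent vector.
  One-forms are represented below by their dependence on the tangent vector \<open>v\<close>.\<close>

definition delta :: "real^'n \<Rightarrow> complex^'n^'n" where
  "delta v = (\<chi> i j. if i = j then of_real (v $ i) else 0)"

definition frame_form ::
  "real^'n^'n \<Rightarrow> real^'n \<Rightarrow> complex \<Rightarrow> real^'n \<Rightarrow> complex^('n + 1)^('n + 1)" where
  "frame_form \<beta> h \<mu> v =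
     block (smult_mat (\<i> * \<mu>) (delta v) + (delta v ** cmat \<beta> - cmat \<beta> ** delta v))
           (delta v *v cvec h) 0"

definition holomorphic_mat :: "(complex \<Rightarrow> complex^'m^'m) \<Rightarrow> complex set \<Rightarrow> bool" where
  "holomorphic_mat G S \<longleftrightarrow> (\<forall>i j. (\<lambda>\<mu>. G \<mu> $ i $ j) holomorphic_on S)"

text \<open>The equation \<open>F\<^sup>-\<^sup>1 dF = \<theta>\<close> is stated as: \<open>F\<close> is invertible and \<open>dF = F \<theta>\<close>.\<close>

definition frame_with_data ::
  "(real^'n) set \<Rightarrow> (real^'n \<Rightarrow> real^'n^'n) \<Rightarrow> (real^'n \<Rightarrow> real^'n)
    \<Rightarrow> (real^'n \<Rightarrow> complex \<Rightarrow> complex^('n + 1)^('n + 1)) \<Rightarrow> bool" where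
  "frame_with_data \<Omega> \<beta> h F \<longleftrightarrow>
     (\<forall>u\<in>\<Omega>. \<forall>\<mu>. \<exists>E X. F u \<mu> = block E X 1) \<and>
     (\<forall>u\<in>\<Omega>. holomorphic_mat (F u) UNIV) \<and>
     (\<forall>u\<in>\<Omega>. \<forall>\<mu>. invertible (F u \<mu>) \<and>
        ((\<lambda>w. F w \<mu>) has_derivative (\<lambda>v. F u \<mu> ** frame_form (\<beta> u) (h u) \<mu> v)) (at u)) \<and>
     (\<forall>\<mu>. F 0 \<mu> = mat 1)"

definition extended_frame ::
  "(real^'n) set \<Rightarrow> (real^'n \<Rightarrow> real^'n)
    \<Rightarrow> (real^'n \<Rightarrow> complex \<Rightarrow> complex^('n + 1)^('n + 1)) \<Rightarrow> bool" where
  "extended_frame \<Omega> h F \<longleftrightarrow> frame_with_data \<Omega> (rotation_coeff h) h F"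


section \<open>Projections and simple elements\<close>

definition hermitian_projection :: "complex^'n^'n \<Rightarrow> bool" where
  "hermitian_projection P \<longleftrightarrow> P ** P = P \<and> transpose (conj_mat P) = P"

definition image_mat :: "complex^'n^'n \<Rightarrow> (complex^'n) set" where
  "image_mat A = range (\<lambda>x. A *v x)"

definition projection_onto :: "(complex^'n) set \<Rightarrow> complex^'n^'n" where
  "projection_onto V = (THE P. hermitian_projection P \<and> image_mat P = V)"

definition perp :: "complex^'n^'n \<Rightarrow> complex^'n^'n" where
  "perp P = mat 1 - P"

text \<open>\<open>g\<^bsub>w,\<pi>\<^esub>(\<mu>)\<close>; the value at the pole \<open>\<mu> = w\<close> is a dummy value.\<close>

definition simple_element :: "complex \<Rightarrow> complex^'n^'n \<Rightarrow> complex \<Rightarrow> complex^'n^'n" where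
  "simple_element w P \<mu> = P + smult_mat ((\<mu> - cnj w) / (\<mu> - w)) (perp P)"


section \<open>The dressing action\<close>

definition loops_plus :: "(complex \<Rightarrow> complex^'m^'m) set" where
  "loops_plus = {G. holomorphic_mat G UNIV \<and> (\<forall>\<mu>. invertible (G \<mu>))}"

text \<open>Loops on the disk of radius \<open>r\<close> about \<open>\<infinity>\<close>, described in the coordinate
  \<open>\<zeta> = 1/\<mu>\<close>. Only values on \<open>1/r < |\<mu>|\<close> are constrained.\<close>

definition loops_minus :: "real \<Rightarrow> (complex \<Rightarrow> complex^'m^'m) set" where
  "loops_minus r = {g.
     holomorphic_mat (\<lambda>\<zeta>. if \<zeta> = 0 then mat 1 else g (1 / \<zeta>)) (ball 0 r) \<and>
     (\<forall>\<zeta>\<in>ball 0 r - {0}. invertible (g (1 / \<zeta>)))}"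

definition is_dressing ::
  "(complex \<Rightarrow> complex^'m^'m) \<Rightarrow> (complex \<Rightarrow> complex^'m^'m) \<Rightarrow> (complex \<Rightarrow> complex^'m^'m) \<Rightarrow> bool"
  where
  "is_dressing g G G' \<longleftrightarrow> G' \<in> loops_plus \<and>
     (\<exists>r>0. g \<in> loops_minus r \<and> (\<exists>g'\<in>loops_minus r.
        \<forall>\<mu>. 1 / r < cmod \<mu> \<longrightarrow> g \<mu> ** G \<mu> = G' \<mu> ** g' \<mu>))"

definition dressable ::
  "(complex \<Rightarrow> complex^'m^'m) \<Rightarrow> (complex \<Rightarrow> complex^'m^'m) \<Rightarrow> bool" where
  "dressable g G \<longleftrightarrow> G \<in> loops_plus \<and> (\<exists>!G'. is_dressing g G G')"

definition dress ::
  "(complex \<Rightarrow> complex^'m^'m) \<Rightarrow> (complex \<Rightarrow> complex^'m^'m) \<Rightarrow> complex \<Rightarrow> complex^'m^'m" where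
  "dress g G = (THE G'. is_dressing g G G')"

definition simple_element_ext ::
  "complex \<Rightarrow> complex^'n^'n \<Rightarrow> complex \<Rightarrow> complex^('n + 1)^('n + 1)" where
  "simple_element_ext w P \<mu> = block (simple_element w P \<mu>) 0 ((\<mu> - cnj w) / (\<mu> - w))"

text \<open>The projection \<open>\<rho>\<close> occurring in \<open>f\<^bsub>z,\<pi>\<^esub> = g\<^bsub>-z\<^sup>*,\<rho>\<^esub> g\<^bsub>z,\<pi>\<^esub>\<close>
  (\<open>z\<^sup>*\<close> the complex conjugate), and the action of \<open>f\<^bsub>z,\<pi>\<^esub>\<close>, by definition the
  successive action of its two factors.\<close>

definition rho_proj :: "complex \<Rightarrow> complex^'n^'n \<Rightarrow> complex^'n^'n" where
  "rho_proj z P =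
     projection_onto ((\<lambda>x. simple_element z P (- cnj z) *v x) ` image_mat (conj_mat P))"

definition f_dressable ::
  "complex \<Rightarrow> complex^'n^'n \<Rightarrow> (complex \<Rightarrow> complex^('n + 1)^('n + 1)) \<Rightarrow> bool" where
  "f_dressable z P G \<longleftrightarrow>
     dressable (simple_element_ext z P) G \<and>
     dressable (simple_element_ext (- cnj z) (rho_proj z P)) (dress (simple_element_ext z P) G)"

definition f_dress ::
  "complex \<Rightarrow> complex^'n^'n \<Rightarrow> (complex \<Rightarrow> complex^('n + 1)^('n + 1))
    \<Rightarrow> complex \<Rightarrow> complex^('n + 1)^('n + 1)" where
  "f_dress z P G =
     dress (simple_element_ext (- cnj z) (rho_proj z P)) (dress (simple_element_ext z P) G)"

end

theory Submission
  imports Defs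
begin

text \<open>The metric is recovered from its frame, so it is enough to understand how a frame changes when it is
multiplied by one simple element. The first factor \<open>g\<^bsub>z,\<pi>\<^esub>\<close> destroys reality of the data, so the single
step is carried out in a larger class: \<^emph>\<open>Hermitian frames\<close>, solutions
\<open>dE = E (i \<mu> \<delta> + [\<delta>, B])\<close>, \<open>dX = E \<delta> H\<close> with \<open>B\<close> Hermitian and \<open>H\<close> complex. For these \<open>E\<close> is
still unitary in the sense \<open>E(\<mu>\<^sup>*)\<^sup>* E(\<mu>) = I\<close> (lemma \<open>unitary\<close>; the star is the conjugate of a
scalar and the adjoint of a matrix), and this is all that the classical
argument uses: with \<open>\<pi>'\<close> the projection onto \<open>E(w)\<^sup>-\<^sup>1(Im \<pi>)\<close> the residues of
\<open>g\<^bsub>w,\<pi>\<^esub> E g\<^bsub>w,\<pi>'\<^esub>\<^sup>-\<^sup>1\<close> at \<open>w\<close> and \<open>w\<^sup>*\<close> vanish, so this product is entire, and together with the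
translation part it is the dressed frame (lemma \<open>simple_element_dressing\<close>). Uniqueness of the factorisation
is Liouville's theorem (lemma \<open>is_dressing_unique\<close>).

That the dressed frame solves a system of the same kind is read off from an ordinary differential
equation for the projection: differentiating the incidence \<open>\<pi>\<^sup>\<bottom> E(w) \<pi>' = 0\<close> determines \<open>d\<pi>'\<close>
(lemma \<open>pt_der\<close>), and with that formula the equation for the dressed frame, away from the poles, is an
identity of noncommutative polynomials (lemmas \<open>intertwine_matrix\<close>, \<open>intertwine_vector\<close>). At a pole the
dressed frame is only known as an analytic continuation. There the equation is obtained as a limit
\<open>\<mu> \<rightarrow> w\<close>, the convergence being locally uniform in \<open>u\<close> by a Gronwall estimate
(lemma \<open>frame_derivative_at_puncture\<close>). The new data are \<open>B + s \<pi>'\<close> and \<open>H + s \<pi>' \<eta>\<close> with the real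
number \<open>s = i (w - w\<^sup>*)\<close>. The Egoroff potential is carried along explicitly, the new one being
\<open>\<phi> + s \<eta>\<^sup>* \<pi>' \<eta>\<close>.

Two steps, with \<open>w = z\<close> and then \<open>w = -z\<^sup>*\<close>, produce the frame of the theorem. It is real because of
permutability: \<open>f(\<mu>) = g\<^bsub>-z\<^sup>*,\<rho>\<^esub>(\<mu>) g\<^bsub>z,\<pi>\<^esub>(\<mu>)\<close> equals the entrywise conjugate of
\<open>f(-\<mu>\<^sup>*)\<close> (lemma \<open>reflect_simple_product\<close>). The original frame has the same symmetry, hence by uniqueness
so has the dressed one, and comparing derivatives shows that its data are real (lemma \<open>real_data\<close>).

Finally, for a real frame, symmetry of the second derivatives of \<open>X\<close> says \<open>\<partial>\<^sub>j h\<^sub>i = \<beta>\<^sub>i\<^sub>j h\<^sub>j\<close>, so off its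
diagonal \<open>B\<close> is the rotation coefficient matrix, and the columns of \<open>J = E diag(h)\<close> at \<open>\<mu> = 0\<close> are the coordinate
vector fields expressed in the flat coordinates \<open>X\<close>, so that \<open>\<partial>\<^sub>i J = J \<Gamma>\<^sub>i\<close> with the Christoffel
matrices \<open>\<Gamma>\<^sub>i\<close>. Symmetry of the second derivatives of \<open>J\<close>
is then the vanishing of the curvature (lemma \<open>flat\<close>).\<close>

section \<open>Matrix algebra\<close>

definition adj :: "complex^'n^'n \<Rightarrow> complex^'n^'n" where
  "adj A = transpose (conj_mat A)"

definition cinner :: "complex^'n \<Rightarrow> complex^'n \<Rightarrow> complex" where
  "cinner x y = (\<Sum>i\<in>UNIV. cnj (x $ i) * y $ i)"

definition cnj_vec :: "complex^'n \<Rightarrow> complex^'n" where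
  "cnj_vec x = (\<chi> i. cnj (x $ i))"

lemma smult_mat_nth [simp]: "smult_mat c A $ i $ j = c * A $ i $ j"
  by (simp add: smult_mat_def map_matrix_def)

lemma conj_mat_nth [simp]: "conj_mat A $ i $ j = cnj (A $ i $ j)"
  by (simp add: conj_mat_def map_matrix_def)

lemma adj_nth [simp]: "adj A $ i $ j = cnj (A $ j $ i)"
  by (simp add: adj_def transpose_def)

lemma delta_nth [simp]: "delta v $ i $ j = (if i = j then of_real (v $ i) else 0)"
  by (simp add: delta_def)

lemma cmat_nth [simp]: "cmat A $ i $ j = of_real (A $ i $ j)"
  by (simp add: cmat_def map_matrix_def)

lemma cvec_nth [simp]: "cvec x $ i = of_real (x $ i)"
  by (simp add: cvec_def)

lemma cnj_vec_nth [simp]: "cnj_vec x $ i = cnj (x $ i)"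
  by (simp add: cnj_vec_def)

lemma mat_mul_assoc_right: "(A ** B) ** C = A ** (B ** C)"
  by (simp add: matrix_mul_assoc)

lemma mat_vec_assoc_right: "(A ** B) *v x = A *v (B *v x)"
  by (simp add: matrix_vector_mul_assoc)

lemma mat_algebra_ring:
  fixes A B C :: "complex^'n^'n" and x y :: "complex^'n"
  shows "A ** (B + C) = A ** B + A ** C" "(A + B) ** C = A ** C + B ** C"
    "A ** (B - C) = A ** B - A ** C" "(A - B) ** C = A ** C - B ** C"
    "A ** (- B) = - (A ** B)" "(- A) ** B = - (A ** B)"
    "A ** 0 = 0" "0 ** A = 0"
    "smult_mat c A ** B = smult_mat c (A ** B)" "A ** smult_mat c B = smult_mat c (A ** B)"
    "A *v (x + y) = A *v x + A *v y" "(A + B) *v x = A *v x + B *v x"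
    "A *v (x - y) = A *v x - A *v y" "(A - B) *v x = A *v x - B *v x"
    "A *v (- x) = - (A *v x)" "(- A) *v x = - (A *v x)"
    "A *v 0 = 0" "0 *v x = 0"
    "smult_mat c A *v x = c *s (A *v x)" "A *v (c *s x) = c *s (A *v x)"
  by (simp_all add: vec_eq_iff matrix_matrix_mult_def matrix_vector_mult_def
      algebra_simps sum.distrib sum_subtractf sum_negf sum_distrib_left)

text \<open>The ring operations of the vector type are componentwise, so the laws of the matrix product are
  collected here. Used as rewrite rules, they expand every product into a sum of scaled words, associated
  to the right.\<close>

lemmas mat_algebra = mat_algebra_ring mat_mul_assoc_right mat_vec_assoc_right

lemma mat_vec_axis_nth: "(A *v axis j c) $ k = A $ k $ j * (c :: complex)"
  by (simp add: matrix_vector_mult_def axis_def if_distrib cong: if_cong)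

lemma smult_mat_algebra:
  "smult_mat c (A + B) = smult_mat c A + smult_mat c B"
  "smult_mat c (A - B) = smult_mat c A - smult_mat c B"
  "smult_mat c (- A) = - smult_mat c A"
  "smult_mat c (smult_mat d A) = smult_mat (c * d) A"
  "smult_mat (c + d) A = smult_mat c A + smult_mat d A"
  "smult_mat (c - d) A = smult_mat c A - smult_mat d A"
  "smult_mat 1 A = A" "smult_mat 0 A = 0" "smult_mat c 0 = 0"
  by (simp_all add: vec_eq_iff algebra_simps)

lemma adj_algebra:
  "adj (A + B) = adj A + adj B" "adj (A - B) = adj A - adj B" "adj (- A) = - adj A"
  "adj (A ** B) = adj B ** adj A" "adj (smult_mat c A) = smult_mat (cnj c) (adj A)"
  "adj (mat 1) = mat 1" "adj (adj A) = A" "adj 0 = 0" "adj (delta v) = delta v"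
  by (auto simp: vec_eq_iff matrix_matrix_mult_def mat_def mult.commute)

lemma conj_mat_algebra:
  "conj_mat (A + B) = conj_mat A + conj_mat B" "conj_mat (A - B) = conj_mat A - conj_mat B"
  "conj_mat (A ** B) = conj_mat A ** conj_mat B"
  "conj_mat (smult_mat c A) = smult_mat (cnj c) (conj_mat A)"
  "conj_mat (mat 1) = mat 1" "conj_mat (conj_mat A) = A" "conj_mat (delta v) = delta v"
  "conj_mat (adj A) = adj (conj_mat A)"
  "cnj_vec (A *v x) = conj_mat A *v cnj_vec x"
  by (auto simp: vec_eq_iff matrix_matrix_mult_def matrix_vector_mult_def mat_def)

lemma cinner_adj: "cinner x (A *v y) = cinner (adj A *v x) y"
proof -
  have "cinner x (A *v y) = (\<Sum>i\<in>UNIV. \<Sum>j\<in>UNIV. cnj (x $ i) * (A $ i $ j * y $ j))"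
    by (simp add: cinner_def matrix_vector_mult_def sum_distrib_left)
  also have "\<dots> = (\<Sum>j\<in>UNIV. \<Sum>i\<in>UNIV. cnj (x $ i) * (A $ i $ j * y $ j))"
    by (rule sum.swap)
  also have "\<dots> = cinner (adj A *v x) y"
    by (simp add: cinner_def matrix_vector_mult_def sum_distrib_left sum_distrib_right mult_ac)
  finally show ?thesis .
qed

lemma cinner_self: "cinner x x = of_real ((norm x)\<^sup>2)"
proof -
  have "cinner x x = (\<Sum>i\<in>UNIV. of_real ((norm (x $ i))\<^sup>2))"
    unfolding cinner_def by (intro sum.cong refl) (metis complex_norm_square mult.commute)
  also have "\<dots> = of_real ((norm x)\<^sup>2)"
    by (simp add: norm_vec_def L2_set_def sum_nonneg)
  finally show ?thesis .
qed

lemma cinner_self_eq_0: "cinner x x = 0 \<longleftrightarrow> x = 0"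
  by (simp add: cinner_self)

lemma cinner_algebra:
  "cinner (x + y) w = cinner x w + cinner y w" "cinner x (y + w) = cinner x y + cinner x w"
  "cinner (x - y) w = cinner x w - cinner y w" "cinner x (y - w) = cinner x y - cinner x w"
  "cinner (- x) w = - cinner x w" "cinner x (- w) = - cinner x w"
  "cinner (c *s x) y = cnj c * cinner x y" "cinner x (c *s y) = c * cinner x y"
  "cinner 0 y = 0" "cinner x 0 = 0"
  by (simp_all add: cinner_def algebra_simps sum.distrib sum_subtractf sum_negf sum_distrib_left)

lemma invertible_iff_ker:
  fixes A :: "complex^'n^'n"
  shows "invertible A \<longleftrightarrow> (\<forall>x. A *v x = 0 \<longrightarrow> x = 0)"
  by (metis invertible_left_inverse matrix_left_invertible_ker)

lemma matrix_inv_cancel: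
  fixes A :: "'a::field^'n^'n"
  assumes "invertible A"
  shows "matrix_inv A ** A = mat 1" "A ** matrix_inv A = mat 1"
  using assms unfolding invertible_def matrix_inv_def by (metis (mono_tags, lifting) someI_ex)+

lemma matrix_inv_unique_right:
  fixes A :: "'a::field^'n^'n"
  assumes "A ** B = mat 1"
  shows "matrix_inv A = B" "invertible A" "B ** A = mat 1"
proof -
  show 1: "B ** A = mat 1" using assms matrix_left_right_inverse by blast
  then show 2: "invertible A" using assms invertible_def by blast
  have "matrix_inv A ** A = mat 1" using 2 by (simp add: matrix_inv_cancel)
  then show "matrix_inv A = B"
    by (metis assms matrix_mul_assoc matrix_mul_lid matrix_mul_rid)
qed

subsection \<open>Hermitian projections\<close>

lemma hermitian_projectionD:
  assumes "hermitian_projection P"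
  shows "P ** P = P" "adj P = P" "P ** (P ** A) = P ** A" "P *v (P *v x) = P *v x"
  using assms unfolding hermitian_projection_def adj_def
  by (auto simp: matrix_mul_assoc matrix_vector_mul_assoc)

lemma hermitian_projection_adj: "hermitian_projection P \<longleftrightarrow> P ** P = P \<and> adj P = P"
  by (simp add: hermitian_projection_def adj_def)

lemma hermitian_projection_perp:
  assumes "hermitian_projection P" shows "hermitian_projection (perp P)"
  using hermitian_projectionD[OF assms]
  by (simp add: hermitian_projection_adj perp_def mat_algebra adj_algebra)

lemma hermitian_projection_conj:
  assumes "hermitian_projection P" shows "hermitian_projection (conj_mat P)"
  using hermitian_projectionD[OF assms]
  by (metis hermitian_projection_adj conj_mat_algebra(3,8))

text \<open>Equal images give \<open>Q P = P\<close> and \<open>P Q = Q\<close>; the adjoint of the first is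
  \<open>P Q = P\<close>.\<close>

lemma hermitian_projection_unique:
  assumes P: "hermitian_projection P" and Q: "hermitian_projection Q"
    and eq: "image_mat P = image_mat Q"
  shows "P = Q"
proof -
  have *: "S ** R = R" if "hermitian_projection S" "image_mat R = image_mat S" for R S
  proof -
    have "S *v (R *v x) = R *v x" for x
    proof -
      have "R *v x \<in> image_mat S" using that(2) by (auto simp: image_mat_def)
      then obtain y where "R *v x = S *v y" by (auto simp: image_mat_def)
      then show ?thesis using hermitian_projectionD(4)[OF that(1)] by metis
    qed
    then show ?thesis by (simp add: matrix_eq mat_vec_assoc_right)
  qed
  have "P = adj (Q ** P)" using *[OF Q eq] hermitian_projectionD(2)[OF P] by simp
  also have "\<dots> = P ** Q"
    using hermitian_projectionD(2)[OF P] hermitian_projectionD(2)[OF Q] by (simp add: adj_algebra)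
  also have "\<dots> = Q" using *[OF P eq[symmetric]] .
  finally show ?thesis .
qed

lemma projection_onto_eq:
  assumes "hermitian_projection Q" "image_mat Q = V"
  shows "projection_onto V = Q"
  unfolding projection_onto_def
  by (rule the_equality) (use assms hermitian_projection_unique in auto)

text \<open>The Gram operator of \<open>A\<close> restricted to the image of \<open>P\<close>, made invertible by
  the identity on the orthogonal complement.\<close>

definition gram :: "complex^'n^'n \<Rightarrow> complex^'n^'n \<Rightarrow> complex^'n^'n" where
  "gram A P = P ** adj A ** A ** P + perp P"

text \<open>The familiar expression \<open>A (A\<^sup>* A)\<^sup>-\<^sup>1 A\<^sup>*\<close> for the orthogonal
  projection onto a column space, applied to \<open>A\<close> on the image of \<open>P\<close>. A formula,
  in contrast to a definite description, shows that the projection onto \<open>A (Im P)\<close> depends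
  differentiably on \<open>A\<close>.\<close>

definition proj_formula :: "complex^'n^'n \<Rightarrow> complex^'n^'n \<Rightarrow> complex^'n^'n" where
  "proj_formula A P = A ** P ** matrix_inv (gram A P) ** P ** adj A"

lemma invertible_gram:
  assumes P: "hermitian_projection P" and A: "invertible A"
  shows "invertible (gram A P)"
  unfolding invertible_iff_ker
proof (intro allI impI)
  note PD = hermitian_projectionD[OF P]
  fix x assume x: "gram A P *v x = 0"
  have eq: "P *v (adj A *v (A *v (P *v x))) + (x - P *v x) = 0"
    using x by (simp add: gram_def perp_def mat_algebra)
  then have "P *v (P *v (adj A *v (A *v (P *v x))) + (x - P *v x)) = 0"
    by (simp add: mat_algebra)
  then have 1: "P *v (adj A *v (A *v (P *v x))) = 0"
    by (simp add: mat_algebra PD)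
  have "cinner (A *v (P *v x)) (A *v (P *v x)) = cinner x (P *v (adj A *v (A *v (P *v x))))"
    by (simp add: cinner_adj PD mat_algebra adj_algebra)
  then have "A *v (P *v x) = 0" using 1 by (simp add: cinner_algebra cinner_self_eq_0)
  then have "P *v x = 0" using A by (simp add: invertible_iff_ker)
  then show "x = 0" using eq by (simp add: mat_algebra)
qed

lemma proj_formula:
  assumes P: "hermitian_projection P" and A: "invertible A"
  shows hermitian_projection_formula: "hermitian_projection (proj_formula A P)"
    and proj_formula_fix: "proj_formula A P ** A ** P = A ** P"
    and image_proj_formula: "image_mat (proj_formula A P) = (\<lambda>x. A *v x) ` image_mat P"
proof -
  note PD = hermitian_projectionD[OF P]
  define M where "M = gram A P"
  define N where "N = matrix_inv M"
  have "invertible M" using invertible_gram[OF P A] by (simp add: M_def)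
  then have NM: "N ** M = mat 1" and MN: "M ** N = mat 1"
    by (simp_all add: N_def matrix_inv_cancel)
  have MP: "M ** P = P ** adj A ** A ** P" and PM: "P ** M = P ** adj A ** A ** P"
    by (simp_all add: M_def gram_def perp_def mat_algebra PD)
  have "adj M = M" by (simp add: M_def gram_def perp_def adj_algebra PD mat_algebra)
  then have "adj N ** M = mat 1" using arg_cong[OF MN, of adj] by (simp add: adj_algebra)
  then have adjN: "adj N = N"
    by (metis MN matrix_mul_assoc matrix_mul_lid matrix_mul_rid)
  have NP: "N ** P = P ** N"
  proof -
    have "N ** P = N ** (P ** M) ** N" using MN by (simp add: mat_mul_assoc_right)
    also have "\<dots> = N ** (M ** P) ** N" by (simp add: MP PM)
    also have "\<dots> = (N ** M) ** P ** N" by (simp add: mat_mul_assoc_right)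
    finally show ?thesis by (simp add: NM)
  qed
  define Q where "Q = A ** P ** N ** P ** adj A"
  have Qf: "proj_formula A P = Q" by (simp add: proj_formula_def Q_def N_def M_def)
  have QAP: "Q ** A ** P = A ** P"
  proof -
    have "Q ** A ** P = A ** P ** N ** (P ** adj A ** A ** P)"
      by (simp add: Q_def mat_mul_assoc_right)
    also have "\<dots> = A ** P ** (N ** M) ** P" by (simp add: MP mat_mul_assoc_right)
    also have "\<dots> = A ** P" by (simp add: NM mat_mul_assoc_right PD)
    finally show ?thesis .
  qed
  have "Q ** Q = (Q ** A ** P) ** (N ** P ** adj A)" by (simp add: Q_def mat_mul_assoc_right)
  also have "\<dots> = Q" by (simp only: QAP) (simp add: Q_def mat_mul_assoc_right)
  finally have "Q ** Q = Q" .
  moreover have "adj Q = Q" by (simp add: Q_def adj_algebra adjN PD mat_mul_assoc_right)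
  ultimately show "hermitian_projection (proj_formula A P)"
    by (simp add: Qf hermitian_projection_adj)
  show "proj_formula A P ** A ** P = A ** P" using QAP Qf by simp
  show "image_mat (proj_formula A P) = (\<lambda>x. A *v x) ` image_mat P"
  proof
    show "image_mat (proj_formula A P) \<subseteq> (\<lambda>x. A *v x) ` image_mat P"
      by (auto simp: image_mat_def Qf Q_def mat_vec_assoc_right)
    have "A *v (P *v x) = Q *v (A *v (P *v x))" for x
      using QAP by (metis mat_vec_assoc_right)
    then show "(\<lambda>x. A *v x) ` image_mat P \<subseteq> image_mat (proj_formula A P)"
      unfolding image_mat_def Qf by (metis (mono_tags, lifting) image_iff image_subsetI rangeI)
  qed
qed

lemma projection_onto_image:
  assumes "hermitian_projection P" "invertible A"
  shows "projection_onto ((\<lambda>x. A *v x) ` image_mat P) = proj_formula A P"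
  using proj_formula[OF assms] by (intro projection_onto_eq)

text \<open>These are the vanishing residues of the dressed frame: the first two express that \<open>A\<close> maps
  \<open>Im P\<close> into the new image and \<open>B = A\<^sup>-\<^sup>1\<close> maps it back; the third
  is the adjoint of the first, which is the condition at the conjugate pole.\<close>

lemma proj_formula_annihilates:
  assumes P: "hermitian_projection P" and AB: "A ** B = mat 1"
  shows "perp (proj_formula A P) ** A ** P = 0"
    and "perp P ** B ** proj_formula A P = 0"
    and "P ** adj A ** perp (proj_formula A P) = 0"
proof -
  note BA = matrix_inv_unique_right[OF AB]
  have A: "invertible A" using BA by simp
  show 1: "perp (proj_formula A P) ** A ** P = 0"
    using proj_formula_fix[OF P A] by (simp add: perp_def mat_algebra)
  have "adj (perp (proj_formula A P) ** A ** P) = P ** adj A ** perp (proj_formula A P)"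
    using hermitian_projectionD(2)[OF P] hermitian_projectionD(2)[OF hermitian_projection_formula[OF P A]]
    by (simp add: perp_def adj_algebra mat_algebra)
  with 1 show "P ** adj A ** perp (proj_formula A P) = 0" by (simp add: adj_algebra)
  have "B ** proj_formula A P = P ** matrix_inv (gram A P) ** P ** adj A"
    unfolding proj_formula_def using BA(3) by (simp add: matrix_mul_assoc)
  then have "perp P ** (B ** proj_formula A P) = 0"
    by (simp add: perp_def mat_algebra hermitian_projectionD[OF P])
  then show "perp P ** B ** proj_formula A P = 0" by (simp add: mat_mul_assoc_right)
qed

subsection \<open>Inverse of a matrix by Cramer's rule\<close>

definition cofactor_det :: "complex^'n^'n \<Rightarrow> 'n \<Rightarrow> 'n \<Rightarrow> complex" where
  "cofactor_det A k j = det (\<chi> i l. if l = k then (if i = j then 1 else 0) else A $ i $ l)"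

text \<open>Cramer's rule makes the inverse a quotient of polynomials in the entries, so it inherits both holomorphy
  in the spectral parameter and differentiability in the coordinates.\<close>

lemma matrix_inv_cramer:
  fixes A :: "complex^'n^'n"
  assumes "invertible A"
  shows "matrix_inv A $ k $ j = cofactor_det A k j / det A"
proof -
  have d: "det A \<noteq> 0" using assms invertible_det_nz by blast
  let ?x = "matrix_inv A *v axis j 1"
  have "A *v ?x = axis j 1"
    by (simp add: matrix_vector_mul_assoc matrix_inv_cancel assms)
  then have "?x = (\<chi> k. det (\<chi> i l. if l = k then (axis j 1 :: complex^'n) $ i else A $ i $ l) / det A)"
    using cramer[OF d] by blast
  then have "?x $ k = det (\<chi> i l. if l = k then (axis j 1 :: complex^'n) $ i else A $ i $ l) / det A"
    by (metis (no_types, lifting) vec_lambda_beta)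
  moreover have "?x $ k = matrix_inv A $ k $ j"
    by (simp add: mat_vec_axis_nth)
  moreover have "(\<chi> i l. if l = k then (axis j 1 :: complex^'n) $ i else A $ i $ l)
      = (\<chi> i l. if l = k then (if i = j then 1 else 0) else A $ i $ l)"
    by (auto simp: vec_eq_iff axis_def)
  ultimately show ?thesis by (simp add: cofactor_det_def)
qed

lemma holomorphic_on_det:
  assumes "holomorphic_mat G S"
  shows "(\<lambda>\<mu>. det (G \<mu>)) holomorphic_on S"
  using assms unfolding det_def holomorphic_mat_def
  by (intro holomorphic_intros) auto

lemma holomorphic_mat_inv:
  assumes G: "holomorphic_mat G S" and inv: "\<And>\<mu>. \<mu> \<in> S \<Longrightarrow> invertible (G \<mu>)"
  shows "holomorphic_mat (\<lambda>\<mu>. matrix_inv (G \<mu>)) S"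
  unfolding holomorphic_mat_def
proof (intro allI)
  fix i j
  have "(\<lambda>\<mu>. cofactor_det (G \<mu>) i j) holomorphic_on S"
    unfolding cofactor_det_def
  proof (rule holomorphic_on_det, unfold holomorphic_mat_def, intro allI)
    fix a b
    show "(\<lambda>\<mu>. (\<chi> k l. if l = i then (if k = j then 1 else 0) else G \<mu> $ k $ l) $ a $ b)
        holomorphic_on S"
      using G by (cases "b = i") (auto simp: holomorphic_mat_def)
  qed
  moreover have "(\<lambda>\<mu>. det (G \<mu>)) holomorphic_on S" using G by (rule holomorphic_on_det)
  ultimately have "(\<lambda>\<mu>. cofactor_det (G \<mu>) i j / det (G \<mu>)) holomorphic_on S"
    using inv invertible_det_nz by (intro holomorphic_intros) blast+
  then show "(\<lambda>\<mu>. matrix_inv (G \<mu>) $ i $ j) holomorphic_on S"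
    by (rule holomorphic_transform) (simp add: matrix_inv_cramer inv)
qed

lemma holomorphic_mat_mult:
  assumes "holomorphic_mat G S" "holomorphic_mat H S"
  shows "holomorphic_mat (\<lambda>\<mu>. G \<mu> ** H \<mu>) S"
  using assms unfolding holomorphic_mat_def matrix_matrix_mult_def
  by (auto intro!: holomorphic_intros)

lemma differentiable_prod:
  fixes f :: "'i \<Rightarrow> 'a::real_normed_vector \<Rightarrow> complex"
  assumes "\<And>i. i \<in> I \<Longrightarrow> f i differentiable (at u)"
  shows "(\<lambda>x. \<Prod>i\<in>I. f i x) differentiable (at u)"
  using assms by (induction I rule: infinite_finite_induct) auto

lemma differentiable_det:
  fixes M :: "'a::real_normed_vector \<Rightarrow> complex^'n^'n"
  assumes "\<And>i j. (\<lambda>x. M x $ i $ j) differentiable (at u)"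
  shows "(\<lambda>x. det (M x)) differentiable (at u)"
  unfolding det_def using assms
  by (intro differentiable_sum ballI differentiable_mult differentiable_const differentiable_prod) auto

lemma differentiable_vec_iff:
  fixes f :: "'a::real_normed_vector \<Rightarrow> 'b::euclidean_space^'m"
  shows "f differentiable (at u) \<longleftrightarrow> (\<forall>i. (\<lambda>x. f x $ i) differentiable (at u))"
proof
  assume "f differentiable (at u)"
  then show "\<forall>i. (\<lambda>x. f x $ i) differentiable (at u)"
    using bounded_linear.has_derivative[OF bounded_linear_vec_nth] unfolding differentiable_def by blast
next
  assume *: "\<forall>i. (\<lambda>x. f x $ i) differentiable (at u)"
  then obtain D where D: "((\<lambda>x. f x $ i) has_derivative D i) (at u)" for i
    unfolding differentiable_def by metis
  have "(f has_derivative (\<lambda>v. \<chi> i. D i v)) (at u)"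
  proof (subst has_derivative_componentwise_within, intro ballI)
    fix b :: "'b^'m" assume "b \<in> Basis"
    then obtain i c where b: "b = axis i c" "c \<in> Basis" by (auto simp: Basis_vec_def)
    have "((\<lambda>x. f x $ i \<bullet> c) has_derivative (\<lambda>v. D i v \<bullet> c)) (at u)"
      using D[of i] by (auto intro!: derivative_eq_intros)
    then show "((\<lambda>x. f x \<bullet> b) has_derivative (\<lambda>v. (\<chi> i. D i v) \<bullet> b)) (at u)"
      by (simp add: b inner_axis)
  qed
  then show "f differentiable (at u)" unfolding differentiable_def by blast
qed

lemma differentiable_matrix_inv:
  fixes M :: "'a::real_normed_vector \<Rightarrow> complex^'n^'n"
  assumes M: "M differentiable (at u)" and S: "open S" "u \<in> S"
    and inv: "\<And>x. x \<in> S \<Longrightarrow> invertible (M x)"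
  shows "(\<lambda>x. matrix_inv (M x)) differentiable (at u)"
  unfolding differentiable_vec_iff
proof (intro allI)
  fix k j
  have ent: "(\<lambda>x. M x $ a $ b) differentiable (at u)" for a b
    using M by (simp add: differentiable_vec_iff)
  have "(\<lambda>x. cofactor_det (M x) k j) differentiable (at u)"
    unfolding cofactor_det_def
  proof (rule differentiable_det)
    fix a b
    show "(\<lambda>x. (\<chi> i l. if l = k then (if i = j then 1 else 0) else M x $ i $ l) $ a $ b)
        differentiable (at u)"
      using ent[of a b] by (cases "b = k") auto
  qed
  moreover have "(\<lambda>x. det (M x)) differentiable (at u)"
    using ent by (rule differentiable_det)
  ultimately have "(\<lambda>x. cofactor_det (M x) k j / det (M x)) differentiable (at u)"
    using inv S invertible_det_nz by (intro differentiable_divide) blast+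
  then show "(\<lambda>x. matrix_inv (M x) $ k $ j) differentiable (at u)"
    unfolding differentiable_def
    by (metis (no_types, lifting) S has_derivative_transform_within_open inv matrix_inv_cramer)
qed

subsection \<open>Bounded bilinear maps\<close>

lemma bounded_bilinear_matrix_mult:
  "bounded_bilinear ((**) :: complex^'n^'n \<Rightarrow> complex^'n^'n \<Rightarrow> complex^'n^'n)"
  unfolding bilinear_conv_bounded_bilinear[symmetric] bilinear_def
  by (auto intro!: linearI simp: mat_algebra_ring)
     (simp_all add: vec_eq_iff matrix_matrix_mult_def scaleR_sum_right)

lemma bounded_bilinear_matrix_vector_mult:
  "bounded_bilinear ((*v) :: complex^'n^'n \<Rightarrow> complex^'n \<Rightarrow> complex^'n)"
  unfolding bilinear_conv_bounded_bilinear[symmetric] bilinear_def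
  by (auto intro!: linearI simp: mat_algebra_ring)
     (simp_all add: vec_eq_iff matrix_vector_mult_def scaleR_sum_right)

lemma bounded_bilinear_cinner:
  "bounded_bilinear (cinner :: complex^'n \<Rightarrow> complex^'n \<Rightarrow> complex)"
  unfolding bilinear_conv_bounded_bilinear[symmetric] bilinear_def
  by (auto intro!: linearI simp: cinner_algebra)
     (simp_all add: cinner_def scaleR_sum_right)

text \<open>Conjugation is among these maps, so linearity means real linearity.\<close>

lemma bounded_linear_finite_dim_maps:
  "bounded_linear (adj :: complex^'n^'n \<Rightarrow> _)" "bounded_linear (conj_mat :: complex^'n^'n \<Rightarrow> _)"
  "bounded_linear (cnj_vec :: complex^'n \<Rightarrow> _)" "bounded_linear (smult_mat c :: complex^'n^'n \<Rightarrow> _)"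
  "bounded_linear ((*s) c :: complex^'n \<Rightarrow> _)"
  "bounded_linear (delta :: real^'n \<Rightarrow> _)"
  "bounded_linear (cmat :: real^'n^'n \<Rightarrow> _)" "bounded_linear (cvec :: real^'n \<Rightarrow> _)"
  unfolding linear_conv_bounded_linear[symmetric]
  by (auto intro!: linearI simp: vec_eq_iff algebra_simps) (simp_all add: scaleR_conv_of_real)

subsection \<open>Block matrices\<close>

lemma sum_UNIV_plus_one:
  fixes f :: "'n::finite + 1 \<Rightarrow> 'a::comm_monoid_add"
  shows "(\<Sum>p\<in>UNIV. f p) = (\<Sum>i\<in>UNIV. f (Inl i)) + f (Inr 1)"
proof -
  have "(UNIV :: 1 set) = {1}" by (auto simp: num1_eq_iff)
  moreover have "(\<Sum>p\<in>UNIV. f p) = sum (f \<circ> Inl) UNIV + sum (f \<circ> Inr) UNIV"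
    unfolding UNIV_Plus_UNIV[symmetric] by (subst sum.Plus) (auto simp: o_def)
  ultimately show ?thesis by simp
qed

lemma all_plus_one: "(\<forall>p::'n::finite + 1. Q p) \<longleftrightarrow> (\<forall>i. Q (Inl i)) \<and> Q (Inr 1)"
  by (metis num1_eq_iff old.sum.exhaust)

lemma block_nth [simp]:
  "block A b d $ Inl i $ Inl j = A $ i $ j" "block A b d $ Inl i $ Inr k = b $ i"
  "block A b d $ Inr k $ Inl j = 0" "block A b d $ Inr k $ Inr l = d"
  by (simp_all add: block_def)

lemma block_eq_iff: "block A b d = block A' b' d' \<longleftrightarrow> A = A' \<and> b = b' \<and> d = d'"
  by (auto simp: vec_eq_iff all_plus_one)

lemma block_mult:
  "block A b d ** block A' b' d' = block (A ** A') (A *v b' + d' *s b) (d * d')"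
  by (simp add: vec_eq_iff all_plus_one matrix_matrix_mult_def matrix_vector_mult_def
      sum_UNIV_plus_one mult.commute)

lemma block_one: "block (mat 1) 0 1 = mat 1"
  by (simp add: vec_eq_iff all_plus_one mat_def)

lemma block_diff: "block A b d - block A' b' d' = block (A - A') (b - b') (d - d')"
  by (simp add: vec_eq_iff all_plus_one)

lemma conj_mat_block: "conj_mat (block A b d) = block (conj_mat A) (cnj_vec b) (cnj d)"
  by (simp add: vec_eq_iff all_plus_one)

lemma invertible_block:
  assumes "A ** B = mat 1" "d \<noteq> 0"
  shows "invertible (block A b d)"
proof -
  have "block A b d ** block B (- (1 / d) *s (B *v b)) (1 / d) = mat 1"
    unfolding block_mult using assms
    by (simp add: mat_algebra_ring matrix_vector_mul_assoc block_one[symmetric] block_eq_iff)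
  then show ?thesis by (rule matrix_inv_unique_right)
qed

lemma bounded_linear_block:
  "bounded_linear (\<lambda>(A, b, d). block A b d :: complex^('n::finite + 1)^('n + 1))"
  unfolding linear_conv_bounded_linear[symmetric]
  by (auto intro!: linearI simp: vec_eq_iff all_plus_one)

section \<open>Calculus\<close>

subsection \<open>Finite and infinite order of differentiability\<close>

text \<open>Differentiability of order \<open>k\<close>, where order \<open>0\<close> demands nothing, not even
  continuity. A function that satisfies a differential equation whose right-hand side is built from itself
  and smooth coefficients then gains one order at a time, which is how smoothness of frames and
  projections is proved.\<close>

primrec diffk :: "nat \<Rightarrow> 'a::real_normed_vector set \<Rightarrow> ('a \<Rightarrow> 'b::real_normed_vector) \<Rightarrow> bool" where
  "diffk 0 S f \<longleftrightarrow> True"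
| "diffk (Suc k) S f \<longleftrightarrow>
    (\<exists>f'. (\<forall>u\<in>S. (f has_derivative f' u) (at u)) \<and> (\<forall>v. diffk k S (\<lambda>u. f' u v)))"

lemma diffk_cong:
  assumes "diffk k S f" "open S" "\<And>u. u \<in> S \<Longrightarrow> f u = g u"
  shows "diffk k S g"
proof (cases k)
  case (Suc m)
  then obtain f' where f': "\<And>u. u \<in> S \<Longrightarrow> (f has_derivative f' u) (at u)" "\<And>v. diffk m S (\<lambda>u. f' u v)"
    using assms by auto
  have "(g has_derivative f' u) (at u)" if "u \<in> S" for u
    using f'(1)[OF that] assms that by (metis has_derivative_transform_within_open)
  then show ?thesis using f'(2) Suc by auto
qed auto

lemma diffk_Suc_imp: "diffk (Suc k) S f \<Longrightarrow> diffk k S f"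
proof (induction k arbitrary: f)
  case (Suc k)
  then obtain f' where f': "\<forall>u\<in>S. (f has_derivative f' u) (at u)" "\<And>v. diffk (Suc k) S (\<lambda>u. f' u v)"
    by (subst (asm) diffk.simps) blast
  then show ?case using Suc.IH by (subst diffk.simps) blast
qed auto

lemma diffk_subset: "diffk k S f \<Longrightarrow> T \<subseteq> S \<Longrightarrow> diffk k T f"
  by (induction k arbitrary: f) (auto, blast)

lemma diffk_const: "diffk k S (\<lambda>_. c)"
proof (induction k arbitrary: c)
  case (Suc k)
  then show ?case by (auto intro!: exI[of _ "\<lambda>_ _. 0"])
qed auto

lemma diffk_bounded_linear:
  assumes L: "bounded_linear L" and "diffk k S f"
  shows "diffk k S (\<lambda>u. L (f u))"
  using assms(2)
proof (induction k arbitrary: f)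
  case (Suc k)
  then obtain f' where f': "\<forall>u\<in>S. (f has_derivative f' u) (at u)" "\<And>v. diffk k S (\<lambda>u. f' u v)"
    by auto
  then show ?case using Suc.IH
    by (auto intro!: exI[of _ "\<lambda>u v. L (f' u v)"] bounded_linear.has_derivative[OF L])
qed auto

lemma diffk_add:
  assumes "diffk k S f" "diffk k S g"
  shows "diffk k S (\<lambda>u. f u + g u)"
  using assms
proof (induction k arbitrary: f g)
  case (Suc k)
  then obtain f' g' where "\<forall>u\<in>S. (f has_derivative f' u) (at u)" "\<And>v. diffk k S (\<lambda>u. f' u v)"
    "\<forall>u\<in>S. (g has_derivative g' u) (at u)" "\<And>v. diffk k S (\<lambda>u. g' u v)"
    by auto
  then show ?case using Suc.IH
    by (auto intro!: exI[of _ "\<lambda>u v. f' u v + g' u v"] has_derivative_add)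
qed auto

lemma diffk_sum:
  assumes "\<And>i. i \<in> I \<Longrightarrow> diffk k S (f i)"
  shows "diffk k S (\<lambda>u. \<Sum>i\<in>I. f i u)"
  using assms by (induction I rule: infinite_finite_induct) (auto intro: diffk_const diffk_add)

lemma diffk_minus: "diffk k S f \<Longrightarrow> diffk k S (\<lambda>u. - f u)"
  by (rule diffk_bounded_linear[OF bounded_linear_minus[OF bounded_linear_ident]])

lemma diffk_diff:
  "diffk k S f \<Longrightarrow> diffk k S g \<Longrightarrow> diffk k S (\<lambda>u. f u - g u)"
  using diffk_add[of k S f "\<lambda>u. - g u"] diffk_minus by auto

lemma diffk_bilinear:
  assumes P: "bounded_bilinear P" and "diffk k S f" "diffk k S g"
  shows "diffk k S (\<lambda>u. P (f u) (g u))"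
  using assms(2,3)
proof (induction k arbitrary: f g)
  case (Suc k)
  then obtain f' g' where f': "\<forall>u\<in>S. (f has_derivative f' u) (at u)" "\<And>v. diffk k S (\<lambda>u. f' u v)"
    and g': "\<forall>u\<in>S. (g has_derivative g' u) (at u)" "\<And>v. diffk k S (\<lambda>u. g' u v)"
    by auto
  have "diffk k S (\<lambda>u. P (f u) (g' u v) + P (f' u v) (g u))" for v
    using Suc f' g' by (intro diffk_add Suc.IH) (auto dest: diffk_Suc_imp simp del: diffk.simps)
  then show ?case using f'(1) g'(1)
    by (auto intro!: exI[of _ "\<lambda>u v. P (f u) (g' u v) + P (f' u v) (g u)"] bounded_bilinear.FDERIV[OF P])
qed auto

lemma diffk_vec:
  fixes f :: "'a::real_normed_vector \<Rightarrow> 'b::euclidean_space^'m"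
  assumes "\<And>i. diffk k S (\<lambda>u. f u $ i)"
  shows "diffk k S f"
proof -
  have "bounded_linear (axis i :: 'b \<Rightarrow> 'b^'m)" for i
    unfolding linear_conv_bounded_linear[symmetric]
    by (auto intro!: linearI simp: vec_eq_iff axis_def)
  then have "diffk k S (\<lambda>u. \<Sum>i\<in>UNIV. axis i (f u $ i))"
    using assms by (intro diffk_sum diffk_bounded_linear[of "axis _"]) auto
  moreover have "(\<Sum>i\<in>UNIV. axis i (f u $ i)) = f u" for u
    by (simp add: vec_eq_iff axis_def if_distrib cong: if_cong)
  ultimately show ?thesis by simp
qed

lemma diffk_divide:
  fixes f g :: "'a::real_normed_vector \<Rightarrow> real"
  assumes "diffk k S f" "diffk k S g" "\<And>u. u \<in> S \<Longrightarrow> g u \<noteq> 0"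
  shows "diffk k S (\<lambda>u. f u / g u)"
proof -
  have "diffk k S (\<lambda>u. inverse (g u))"
    using assms(2)
  proof (induction k)
    case (Suc k)
    then obtain g' where g': "\<forall>u\<in>S. (g has_derivative g' u) (at u)" "\<And>v. diffk k S (\<lambda>u. g' u v)"
      by auto
    have "diffk k S (\<lambda>u. inverse (g u))" using Suc diffk_Suc_imp by blast
    then have "diffk k S (\<lambda>u. - (inverse (g u) * g' u v * inverse (g u)))" for v
      using g' by (intro diffk_minus diffk_bilinear[OF bounded_bilinear_mult])
    moreover have "((\<lambda>u. inverse (g u)) has_derivative (\<lambda>v. - (inverse (g u) * g' u v * inverse (g u)))) (at u)"
      if "u \<in> S" for u using g' assms(3) that by (auto intro!: has_derivative_inverse)
    ultimately show ?case by (auto intro!: exI[of _ "\<lambda>u v. - (inverse (g u) * g' u v * inverse (g u))"])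
  qed auto
  with assms(1) have "diffk k S (\<lambda>u. f u * inverse (g u))"
    by (intro diffk_bilinear[OF bounded_bilinear_mult])
  then show ?thesis by (simp add: divide_inverse)
qed

lemma diffk_imp_differentiable: "diffk (Suc k) S f \<Longrightarrow> u \<in> S \<Longrightarrow> f differentiable (at u)"
  by (auto simp: differentiable_def)

lemma has_derivative_partial_sum:
  fixes f :: "real^'n \<Rightarrow> real"
  assumes "f differentiable (at u)"
  shows "frechet_derivative f (at u) v = (\<Sum>i\<in>UNIV. v $ i * partial i f u)"
proof -
  have lin: "linear (frechet_derivative f (at u))"
    using assms linear_frechet_derivative by blast
  have "v = (\<Sum>i\<in>UNIV. v $ i *\<^sub>R axis i 1)"
    by (simp add: vec_eq_iff axis_def if_distrib cong: if_cong)
  then have "frechet_derivative f (at u) v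
      = frechet_derivative f (at u) (\<Sum>i\<in>UNIV. v $ i *\<^sub>R axis i 1)" by simp
  also have "\<dots> = (\<Sum>i\<in>UNIV. v $ i * partial i f u)"
    by (simp add: linear_sum[OF lin] linear_cmul[OF lin] partial_def)
  finally show ?thesis .
qed

lemma partial_eq:
  assumes "(f has_derivative f') (at u)"
  shows "partial i f u = f' (axis i 1)"
  using frechet_derivative_at[OF assms] by (simp add: partial_def)

lemma smooth_fun_imp_diffk:
  assumes "smooth_fun S f" and S: "open S"
  shows "diffk k S f"
  using assms(1)
proof (induction k arbitrary: f)
  case (Suc k)
  have d: "\<forall>u\<in>S. f differentiable (at u)"
    using Suc.prems unfolding smooth_fun_def by (metis foldr.simps(1) id_apply)
  have "smooth_fun S (partial i f)" for i
    unfolding smooth_fun_def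
  proof
    fix js
    show "\<forall>u\<in>S. foldr partial js (partial i f) differentiable (at u)"
      using Suc.prems[unfolded smooth_fun_def, rule_format, of _ "js @ [i]"] by simp
  qed
  then have p: "diffk k S (\<lambda>u. partial i f u)" for i using Suc.IH by blast
  have "diffk k S (\<lambda>u. frechet_derivative f (at u) v)" for v
  proof (rule diffk_cong[OF _ S])
    show "diffk k S (\<lambda>u. \<Sum>i\<in>UNIV. v $ i * partial i f u)"
      by (intro diffk_sum diffk_bilinear[OF bounded_bilinear_mult] diffk_const p)
    show "(\<Sum>i\<in>UNIV. v $ i * partial i f u) = frechet_derivative f (at u) v" if "u \<in> S" for u
      using has_derivative_partial_sum[of f u v] d that by simp
  qed
  moreover have "\<forall>u\<in>S. (f has_derivative frechet_derivative f (at u)) (at u)"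
    using d frechet_derivative_works by blast
  ultimately show ?case
    unfolding diffk.simps by (intro exI[of _ "\<lambda>u. frechet_derivative f (at u)"]) simp
qed auto

lemma diffk_partial:
  assumes "diffk (Suc k) S g" "open S" shows "diffk k S (partial i g)"
proof -
  obtain f' where f': "\<And>u. u \<in> S \<Longrightarrow> (g has_derivative f' u) (at u)" "\<And>v. diffk k S (\<lambda>u. f' u v)"
    using assms by auto
  show ?thesis using diffk_cong[OF f'(2)[of "axis i 1"] assms(2), of "partial i g"] partial_eq f'(1) by metis
qed

lemma diffk_imp_smooth_fun:
  assumes "\<And>k. diffk k S f" and S: "open S"
  shows "smooth_fun S f"
proof -
  have "\<forall>k. diffk k S (foldr partial js f)" for js
  proof (induction js)
    case (Cons i js)
    then show ?case by (auto intro!: diffk_partial[OF _ S] simp del: diffk.simps)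
  qed (use assms in auto)
  then show ?thesis unfolding smooth_fun_def using diffk_imp_differentiable by blast
qed

subsection \<open>Symmetry of second derivatives\<close>

text \<open>The mean value theorem in direction \<open>i\<close> reduces the second difference to two values of the
  first derivative, to which the linear approximation at \<open>u\<close> applies. The second difference
  is symmetric in \<open>i\<close> and \<open>j\<close>, so comparing the two resulting approximations
  gives the symmetry of second derivatives.\<close>

lemma second_difference:
  fixes f :: "'a::real_normed_vector \<Rightarrow> real"
  assumes S: "open S" "u \<in> S" and f': "\<And>x. x \<in> S \<Longrightarrow> (f has_derivative f' x) (at x)"
    and Di: "((\<lambda>x. f' x i) has_derivative Di) (at u)" and e: "e > 0"
  shows "\<exists>d>0. \<forall>s. 0 < s \<and> s < d \<longrightarrow>
    \<bar>f (u + s *\<^sub>R i + s *\<^sub>R j) - f (u + s *\<^sub>R i) - f (u + s *\<^sub>R j) + f u - s\<^sup>2 * Di j\<bar>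
      \<le> 2 * e * (norm i + norm j) * s\<^sup>2"
proof -
  obtain d1 where d1: "d1 > 0" "ball u d1 \<subseteq> S" using S openE by blast
  obtain d2 where d2: "d2 > 0"
    "\<And>y. norm (y - u) < d2 \<Longrightarrow> norm (f' y i - f' u i - Di (y - u)) \<le> e * norm (y - u)"
    using Di e unfolding has_derivative_at_alt by metis
  have linD: "linear Di" using Di has_derivative_linear by blast
  define C where "C = norm i + norm j"
  have C0: "C \<ge> 0" by (simp add: C_def)
  \<comment> \<open>small enough that the whole parallelogram stays where both the derivative and its linear
    approximation are controlled\<close>
  define d where "d = min d1 d2 / (C + 1)"
  have "d > 0" using d1 d2 C0 by (simp add: d_def)
  moreover have "\<bar>f (u + s *\<^sub>R i + s *\<^sub>R j) - f (u + s *\<^sub>R i) - f (u + s *\<^sub>R j) + f u - s\<^sup>2 * Di j\<bar>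
      \<le> 2 * e * C * s\<^sup>2" if s: "0 < s" "s < d" for s
  proof -
    have "s * (C + 1) < min d1 d2" using s C0 by (simp add: d_def field_simps)
    moreover have "s * C < s * (C + 1)" using s by simp
    ultimately have sC: "s * C < min d1 d2" by simp
    have nrm: "norm (a *\<^sub>R i + b *\<^sub>R j) \<le> s * C" if "0 \<le> a" "a \<le> s" "0 \<le> b" "b \<le> s" for a b
    proof -
      have "norm (a *\<^sub>R i + b *\<^sub>R j) \<le> a * norm i + b * norm j"
        using that by (metis abs_of_nonneg norm_scaleR norm_triangle_ineq)
      also have "\<dots> \<le> s * norm i + s * norm j"
        using that by (intro add_mono mult_right_mono) auto
      finally show ?thesis by (simp add: C_def algebra_simps)
    qed
    have inS: "u + a *\<^sub>R i + b *\<^sub>R j \<in> S" if "0 \<le> a" "a \<le> s" "0 \<le> b" "b \<le> s" for a b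
    proof -
      have "dist u (u + (a *\<^sub>R i + b *\<^sub>R j)) = norm (a *\<^sub>R i + b *\<^sub>R j)"
        unfolding dist_commute[of u] by (simp add: dist_norm)
      then show ?thesis using nrm[OF that] sC d1(2) by (force simp: add.assoc)
    qed
    have app: "\<bar>f' (u + a *\<^sub>R i + b *\<^sub>R j) i - f' u i - Di (a *\<^sub>R i + b *\<^sub>R j)\<bar> \<le> e * (s * C)"
      if "0 \<le> a" "a \<le> s" "0 \<le> b" "b \<le> s" for a b
    proof -
      have "u + a *\<^sub>R i + b *\<^sub>R j - u = a *\<^sub>R i + b *\<^sub>R j" by simp
      then have "\<bar>f' (u + a *\<^sub>R i + b *\<^sub>R j) i - f' u i - Di (a *\<^sub>R i + b *\<^sub>R j)\<bar>
          \<le> e * norm (a *\<^sub>R i + b *\<^sub>R j)"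
        using d2(2)[of "u + a *\<^sub>R i + b *\<^sub>R j"] nrm[OF that] sC by (simp add: real_norm_def)
      also have "\<dots> \<le> e * (s * C)" using nrm[OF that] e by (simp add: mult_left_mono)
      finally show ?thesis .
    qed
    define \<phi> where "\<phi> = (\<lambda>a. f (u + a *\<^sub>R i + s *\<^sub>R j) - f (u + a *\<^sub>R i + 0 *\<^sub>R j))"
    have der: "(\<phi> has_derivative (\<lambda>t. f' (u + a *\<^sub>R i + s *\<^sub>R j) (t *\<^sub>R i) - f' (u + a *\<^sub>R i + 0 *\<^sub>R j) (t *\<^sub>R i)))
        (at a within {0..s})" if "0 \<le> a" "a \<le> s" for a
      unfolding \<phi>_def
      by (intro has_derivative_diff has_derivative_compose[where g = f and f = "\<lambda>a. u + a *\<^sub>R i + _"]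
          f' inS that) (use s in \<open>auto intro!: derivative_eq_intros\<close>)
    obtain a where a: "a \<in> {0<..<s}"
      "\<phi> s - \<phi> 0 = f' (u + a *\<^sub>R i + s *\<^sub>R j) ((s - 0) *\<^sub>R i) - f' (u + a *\<^sub>R i + 0 *\<^sub>R j) ((s - 0) *\<^sub>R i)"
      using mvt_simple[OF s(1) der] by blast
    have lin: "f' x (s *\<^sub>R i) = s * f' x i" if "x \<in> S" for x
      using has_derivative_linear[OF f'[OF that]] by (simp add: linear_cmul)
    let ?p = "f' (u + a *\<^sub>R i + s *\<^sub>R j) i" and ?q = "f' (u + a *\<^sub>R i + 0 *\<^sub>R j) i"
    have eq: "\<phi> s - \<phi> 0 = s * (?p - ?q)"
      using a s lin inS[of a s] inS[of a 0] by (simp add: algebra_simps)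
    have "Di (a *\<^sub>R i + s *\<^sub>R j) - Di (a *\<^sub>R i + 0 *\<^sub>R j) = s * Di j"
      using linD by (simp add: linear_add linear_cmul)
    then have "\<bar>?p - ?q - s * Di j\<bar> \<le> 2 * (e * (s * C))"
      using app[of a s] app[of a 0] a s by simp
    then have "s * \<bar>?p - ?q - s * Di j\<bar> \<le> s * (2 * (e * (s * C)))"
      using s by (intro mult_left_mono) auto
    moreover have "s * \<bar>?p - ?q - s * Di j\<bar> = \<bar>\<phi> s - \<phi> 0 - s\<^sup>2 * Di j\<bar>"
    proof -
      have "\<phi> s - \<phi> 0 - s\<^sup>2 * Di j = s * (?p - ?q - s * Di j)"
        unfolding eq by (simp add: power2_eq_square algebra_simps)
      then show ?thesis using s by (simp add: abs_mult)
    qed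
    ultimately show ?thesis by (simp add: \<phi>_def power2_eq_square algebra_simps)
  qed
  ultimately show ?thesis unfolding C_def by blast
qed

lemma second_derivative_symmetric_real:
  fixes f :: "'a::real_normed_vector \<Rightarrow> real"
  assumes S: "open S" "u \<in> S" and f': "\<And>x. x \<in> S \<Longrightarrow> (f has_derivative f' x) (at x)"
    and Di: "((\<lambda>x. f' x i) has_derivative Di) (at u)"
    and Dj: "((\<lambda>x. f' x j) has_derivative Dj) (at u)"
  shows "Di j = Dj i"
proof (rule ccontr)
  assume ne: "Di j \<noteq> Dj i"
  define C where "C = norm i + norm j + 1"
  have C: "C > 0" by (simp add: C_def add_nonneg_pos)
  \<comment> \<open>chosen such that the two error terms together reach at most half of the discrepancy\<close>
  define e where "e = \<bar>Di j - Dj i\<bar> / (8 * C)"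
  have e: "e > 0" using ne C by (simp add: e_def)
  obtain d1 where d1: "d1 > 0" "\<And>s. 0 < s \<and> s < d1 \<Longrightarrow>
    \<bar>f (u + s *\<^sub>R i + s *\<^sub>R j) - f (u + s *\<^sub>R i) - f (u + s *\<^sub>R j) + f u - s\<^sup>2 * Di j\<bar>
      \<le> 2 * e * (norm i + norm j) * s\<^sup>2"
    using second_difference[OF S f' Di e, of j] by auto
  obtain d2 where d2: "d2 > 0" "\<And>s. 0 < s \<and> s < d2 \<Longrightarrow>
    \<bar>f (u + s *\<^sub>R j + s *\<^sub>R i) - f (u + s *\<^sub>R j) - f (u + s *\<^sub>R i) + f u - s\<^sup>2 * Dj i\<bar>
      \<le> 2 * e * (norm j + norm i) * s\<^sup>2"
    using second_difference[OF S f' Dj e, of i] by auto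
  define s where "s = min d1 d2 / 2"
  have s: "0 < s" "s < d1" "s < d2" using d1 d2 by (auto simp: s_def)
  define X where "X = f (u + s *\<^sub>R i + s *\<^sub>R j) - f (u + s *\<^sub>R i) - f (u + s *\<^sub>R j) + f u"
  have comm: "u + s *\<^sub>R j + s *\<^sub>R i = u + s *\<^sub>R i + s *\<^sub>R j" by (simp add: add_ac)
  have X2: "f (u + s *\<^sub>R j + s *\<^sub>R i) - f (u + s *\<^sub>R j) - f (u + s *\<^sub>R i) + f u = X"
    unfolding comm X_def by simp
  have "\<bar>X - s\<^sup>2 * Di j\<bar> \<le> 2 * e * (norm i + norm j) * s\<^sup>2"
    using d1(2)[of s] s by (simp add: X_def)
  moreover have "\<bar>X - s\<^sup>2 * Dj i\<bar> \<le> 2 * e * (norm i + norm j) * s\<^sup>2"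
    using d2(2)[of s, unfolded X2] s by (simp add: add.commute)
  ultimately have "\<bar>s\<^sup>2 * Di j - s\<^sup>2 * Dj i\<bar> \<le> 4 * e * (norm i + norm j) * s\<^sup>2"
    by linarith
  then have "s\<^sup>2 * \<bar>Di j - Dj i\<bar> \<le> s\<^sup>2 * (4 * e * (norm i + norm j))"
    by (simp add: abs_mult flip: right_diff_distrib) (simp add: mult_ac)
  then have "\<bar>Di j - Dj i\<bar> \<le> 4 * e * (norm i + norm j)"
    using s by (simp add: mult_le_cancel_left)
  also have "\<dots> < 4 * e * C + 4 * e * C" 
  proof -
    have "4 * e * (norm i + norm j) \<le> 4 * e * C" using e by (intro mult_left_mono) (auto simp: C_def)
    moreover have "4 * e * C > 0" using e C by simp
    ultimately show ?thesis by linarith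
  qed
  also have "\<dots> = \<bar>Di j - Dj i\<bar>" using C by (simp add: e_def)
  finally show False by simp
qed

lemma second_derivative_symmetric:
  fixes f :: "'a::real_normed_vector \<Rightarrow> 'b::euclidean_space"
  assumes S: "open S" "u \<in> S" and f': "\<And>x. x \<in> S \<Longrightarrow> (f has_derivative f' x) (at x)"
    and Di: "((\<lambda>x. f' x i) has_derivative Di) (at u)"
    and Dj: "((\<lambda>x. f' x j) has_derivative Dj) (at u)"
  shows "Di j = Dj i"
proof (rule euclidean_eqI)
  fix b :: 'b assume "b \<in> Basis"
  show "Di j \<bullet> b = Dj i \<bullet> b"
    by (rule second_derivative_symmetric_real[OF S, of "\<lambda>x. f x \<bullet> b" "\<lambda>x v. f' x v \<bullet> b"])
       (auto intro!: has_derivative_inner_left f' Di Dj)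
qed

subsection \<open>Linear systems depending on a parameter\<close>

text \<open>A Gronwall estimate without exponentials: on a ball so small that \<open>a r \<le> 1/2\<close> the
  maximum of \<open>y\<close>, attained by compactness, absorbs half of itself in the mean value
  inequality.\<close>

lemma linear_growth_bound:
  fixes y :: "'a::euclidean_space \<Rightarrow> 'b::euclidean_space"
  assumes r: "r \<ge> 0" and ar: "a * r \<le> 1 / 2" "a \<ge> 0" "b \<ge> 0"
    and y': "\<And>x. x \<in> cball u r \<Longrightarrow> (y has_derivative y' x) (at x)"
    and bd: "\<And>x v. x \<in> cball u r \<Longrightarrow> norm (y' x v) \<le> (a * norm (y x) + b) * norm v"
    and x: "x \<in> cball u r"
  shows "norm (y x) \<le> 2 * (norm (y u) + b * r)"
proof -
  let ?C = "cball u r"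
  have "?C \<noteq> {}" "compact ?C" using x by (blast, simp)
  moreover have "continuous_on ?C (\<lambda>x. norm (y x))"
  proof (intro continuous_on_norm continuous_at_imp_continuous_on ballI)
    show "isCont y x" if "x \<in> ?C" for x using has_derivative_continuous[OF y'[OF that]] .
  qed
  ultimately obtain m where m: "m \<in> ?C" "\<And>x. x \<in> ?C \<Longrightarrow> norm (y x) \<le> norm (y m)"
    using continuous_attains_sup[of ?C "\<lambda>x. norm (y x)"] by blast
  define N where "N = norm (y m)"
  have "norm (y m - y u) \<le> (a * N + b) * norm (m - u)"
  proof (rule differentiable_bound[of ?C])
    show "(y has_derivative y' x) (at x within ?C)" if "x \<in> ?C" for x
      using y'[OF that] has_derivative_at_withinI by blast
    show "onorm (y' x) \<le> a * N + b" if "x \<in> ?C" for x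
    proof (rule onorm_le)
      fix v
      have "norm (y' x v) \<le> (a * norm (y x) + b) * norm v" by (rule bd[OF that])
      also have "\<dots> \<le> (a * N + b) * norm v"
        using m(2)[OF that] ar by (intro mult_right_mono add_right_mono mult_left_mono) (auto simp: N_def)
      finally show "norm (y' x v) \<le> (a * N + b) * norm v" .
    qed
  qed (use m r in auto)
  also have "\<dots> \<le> (a * N + b) * r"
    using m(1) ar by (intro mult_left_mono) (auto simp: N_def dist_norm norm_minus_commute)
  also have "\<dots> = (a * r) * N + b * r" by (simp add: algebra_simps)
  also have "\<dots> \<le> 1 / 2 * N + b * r"
    using ar by (intro add_right_mono mult_right_mono) (auto simp: N_def)
  finally have "N \<le> norm (y u) + 1 / 2 * N + b * r"
    using norm_triangle_sub[of "y m" "y u"] by (simp add: N_def)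
  then show ?thesis using m(2)[OF x] by (simp add: N_def)
qed

text \<open>If \<open>G\<close> solves the linear system \<open>dG = G T\<close> for all parameters near
  \<open>\<mu>0\<close> except \<open>\<mu>0\<close>, and \<open>G\<close> extends continuously in the
  parameter at each point separately, then the extension solves the limiting system. Pointwise convergence
  at the centre is spread over a ball by the growth estimate, applied to differences of two solutions;
  this gives the uniform convergence of derivatives that is needed to interchange limit and derivative.\<close>

lemma frame_derivative_at_puncture:
  fixes G :: "'a::euclidean_space \<Rightarrow> complex \<Rightarrow> complex^'m^'m"
    and T :: "'a \<Rightarrow> complex \<Rightarrow> 'a \<Rightarrow> complex^'m^'m"
  assumes \<rho>: "\<rho> > 0" and u: "u \<in> S" and "L \<ge> 0"
    and D: "\<And>x \<mu>. x \<in> S \<Longrightarrow> \<mu> \<noteq> \<mu>0 \<Longrightarrow> norm (\<mu> - \<mu>0) < \<rho> \<Longrightarrow>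
      ((\<lambda>x. G x \<mu>) has_derivative (\<lambda>v. G x \<mu> ** T x \<mu> v)) (at x)"
    and lim: "\<And>x. x \<in> S \<Longrightarrow> (G x \<longlongrightarrow> G x \<mu>0) (at \<mu>0)"
    and bd: "\<exists>r>0. \<exists>K. cball u r \<subseteq> S \<and>
      (\<forall>x\<in>cball u r. \<forall>\<mu> v. norm (\<mu> - \<mu>0) < \<rho> \<longrightarrow> norm (T x \<mu> v) \<le> K * norm v)"
    and lip: "\<And>x \<mu> \<nu> v. x \<in> S \<Longrightarrow> norm (T x \<mu> v - T x \<nu> v) \<le> L * norm (\<mu> - \<nu>) * norm v"
  shows "((\<lambda>x. G x \<mu>0) has_derivative (\<lambda>v. G u \<mu>0 ** T u \<mu>0 v)) (at u)"
proof -
  obtain M where M: "M > 0" "\<And>(A :: complex^'m^'m) (B :: complex^'m^'m). norm (A ** B) \<le> norm A * norm B * M"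
    using bounded_bilinear.pos_bounded[OF bounded_bilinear_matrix_mult[where 'n = 'm]] by blast
  obtain r0 K0 where r0: "r0 > 0" "cball u r0 \<subseteq> S"
    and K0': "\<forall>x\<in>cball u r0. \<forall>\<mu> v. norm (\<mu> - \<mu>0) < \<rho> \<longrightarrow> norm (T x \<mu> v) \<le> K0 * norm v"
    using bd by blast
  have K0: "norm (T x \<mu> v) \<le> K0 * norm v" if "x \<in> cball u r0" "norm (\<mu> - \<mu>0) < \<rho>" for x \<mu> v
    using K0' that by blast
  define K where "K = max K0 0"
  have K: "K \<ge> 0" "\<And>x \<mu> v. x \<in> cball u r0 \<Longrightarrow> norm (\<mu> - \<mu>0) < \<rho> \<Longrightarrow> norm (T x \<mu> v) \<le> K * norm v"
  proof -
    show "K \<ge> 0" by (simp add: K_def)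
    fix x \<mu> v assume "x \<in> cball u r0" "norm (\<mu> - \<mu>0) < \<rho>"
    then have "norm (T x \<mu> v) \<le> K0 * norm v" by (rule K0)
    also have "\<dots> \<le> K * norm v" by (intro mult_right_mono) (auto simp: K_def)
    finally show "norm (T x \<mu> v) \<le> K * norm v" .
  qed
  define a where "a = M * K"
  have a: "a \<ge> 0" using M K by (simp add: a_def)
  \<comment> \<open>the radius for which the growth estimate applies, \<open>a r \<le> 1/2\<close>\<close>
  define r where "r = min r0 (1 / (2 * (a + 1)))"
  have r: "r > 0" "r \<le> r0" using r0 a by (auto simp: r_def)
  have ar: "a * r \<le> 1 / 2"
  proof -
    have "a * r \<le> a * (1 / (2 * (a + 1)))" using a by (intro mult_left_mono) (auto simp: r_def)
    also have "\<dots> \<le> 1 / 2" using a by (simp add: divide_le_eq)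
    finally show ?thesis .
  qed
  define C where "C = cball u r"
  have CS: "x \<in> S" "x \<in> cball u r0" if "x \<in> C" for x using that r r0(2) by (auto simp: C_def)
  have uC: "u \<in> C" using r by (simp add: C_def)
  \<comment> \<open>a sequence in the punctured disk that tends to the puncture; the shift by 2 keeps it strictly
    inside\<close>
  define m where "m = (\<lambda>n. \<mu>0 + of_real (\<rho> / real (n + 2)))"
  have m: "m n \<noteq> \<mu>0" "norm (m n - \<mu>0) < \<rho>" for n
  proof -
    show "m n \<noteq> \<mu>0" using \<rho> by (simp add: m_def del: of_real_divide)
    have "norm (m n - \<mu>0) = \<rho> / real (n + 2)" using \<rho> by (simp add: m_def del: of_real_divide)
    also have "\<dots> < \<rho>" using \<rho> divide_strict_left_mono[of 1 "real (n + 2)" \<rho>] by simp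
    finally show "norm (m n - \<mu>0) < \<rho>" .
  qed
  have "(\<lambda>n. \<rho> / real (n + 2)) \<longlonglongrightarrow> 0"
    by (rule LIMSEQ_ignore_initial_segment[OF lim_const_over_n[of \<rho>], of 2])
  then have "(\<lambda>n. \<mu>0 + of_real (\<rho> / real (n + 2))) \<longlonglongrightarrow> \<mu>0 + of_real 0"
    by (intro tendsto_intros)
  then have m_lim: "m \<longlonglongrightarrow> \<mu>0" by (simp add: m_def)
  have Glim: "(\<lambda>n. G x (m n)) \<longlonglongrightarrow> G x \<mu>0" if "x \<in> S" for x
    by (rule filterlim_compose[OF lim[OF that]]) (auto intro!: filterlim_atI m_lim simp: m(1))
  have D': "((\<lambda>x. G x (m n)) has_derivative (\<lambda>v. G x (m n) ** T x (m n) v)) (at x)" if "x \<in> C" for x n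
    using D CS that m by blast
  obtain Q where Q: "\<And>n. norm (G u (m n)) \<le> Q"
    using convergent_imp_bounded[OF Glim[OF u]] by (auto simp: bounded_iff)
  have Q0: "Q \<ge> 0" using Q[of 0] norm_ge_zero order_trans by blast
  have GQ: "norm (G x (m n)) \<le> 2 * Q" if "x \<in> C" for x n
  proof -
    have "norm (G x (m n)) \<le> 2 * (norm (G u (m n)) + 0 * r)"
    proof (rule linear_growth_bound[of r a 0 u "\<lambda>x. G x (m n)"])
      show "norm (G x (m n) ** T x (m n) v) \<le> (a * norm (G x (m n)) + 0) * norm v"
        if "x \<in> cball u r" for x v
      proof -
        have "norm (G x (m n) ** T x (m n) v) \<le> norm (G x (m n)) * norm (T x (m n) v) * M"
          by (rule M)
        also have "\<dots> \<le> norm (G x (m n)) * (K * norm v) * M"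
          using that CS K(2) m M by (intro mult_right_mono mult_left_mono) (auto simp: C_def)
        finally show ?thesis by (simp add: a_def mult_ac)
      qed
    qed (use r a ar D' that in \<open>auto simp: C_def\<close>)
    also have "\<dots> \<le> 2 * Q" using Q by simp
    finally show ?thesis .
  qed
  have GQ0: "norm (G x \<mu>0) \<le> 2 * Q" if "x \<in> C" for x
    using Lim_bounded[OF tendsto_norm[OF Glim[OF CS(1)[OF that]]], of 0 "2 * Q"] GQ[OF that] by blast
  define b where "b = M * (2 * Q) * L"
  have b: "b \<ge> 0" using M Q0 \<open>L \<ge> 0\<close> by (simp add: b_def)
  have diff: "norm (A ** T x (m n) v - A' ** T x \<nu> v) \<le> (a * norm (A - A') + b * norm (m n - \<nu>)) * norm v"
    if "x \<in> C" "norm A' \<le> 2 * Q" for x n \<nu> v and A A' :: "complex^'m^'m"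
  proof -
    have eq: "A ** T x (m n) v - A' ** T x \<nu> v = (A - A') ** T x (m n) v + A' ** (T x (m n) v - T x \<nu> v)"
      by (simp add: mat_algebra_ring)
    have "norm (A ** T x (m n) v - A' ** T x \<nu> v)
        \<le> norm (A - A') * norm (T x (m n) v) * M + norm A' * norm (T x (m n) v - T x \<nu> v) * M"
      unfolding eq
      using norm_triangle_ineq[of "(A - A') ** T x (m n) v" "A' ** (T x (m n) v - T x \<nu> v)"]
        M(2)[of "A - A'" "T x (m n) v"] M(2)[of A' "T x (m n) v - T x \<nu> v"] by linarith
    also have "\<dots> \<le> norm (A - A') * (K * norm v) * M + (2 * Q) * (L * norm (m n - \<nu>) * norm v) * M"
      using that CS K m M lip Q0 \<open>L \<ge> 0\<close>
      by (intro add_mono mult_right_mono mult_mono) auto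
    finally show ?thesis by (simp add: a_def b_def algebra_simps)
  qed
  have cauchy: "norm (G x (m n) - G x (m k)) \<le> 2 * (norm (G u (m n) - G u (m k)) + b * norm (m n - m k) * r)"
    if "x \<in> C" for x n k
  proof (rule linear_growth_bound[of r a "b * norm (m n - m k)" u "\<lambda>x. G x (m n) - G x (m k)"])
    show "((\<lambda>x. G x (m n) - G x (m k)) has_derivative
        (\<lambda>v. G x (m n) ** T x (m n) v - G x (m k) ** T x (m k) v)) (at x)" if "x \<in> cball u r" for x
      using D' that by (intro has_derivative_diff) (auto simp: C_def)
    show "norm (G x (m n) ** T x (m n) v - G x (m k) ** T x (m k) v)
        \<le> (a * norm (G x (m n) - G x (m k)) + b * norm (m n - m k)) * norm v"
      if "x \<in> cball u r" for x v
      using diff that GQ by (simp add: C_def)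
  qed (use r a ar b that in \<open>auto simp: C_def\<close>)
  define \<epsilon> where "\<epsilon> = (\<lambda>n. 2 * (norm (G u (m n) - G u \<mu>0) + b * norm (m n - \<mu>0) * r))"
  have unif: "norm (G x (m n) - G x \<mu>0) \<le> \<epsilon> n" if "x \<in> C" for x n
    unfolding \<epsilon>_def
  proof (rule tendsto_le[OF sequentially_bot])
    show "(\<lambda>k. norm (G x (m n) - G x (m k))) \<longlonglongrightarrow> norm (G x (m n) - G x \<mu>0)"
      using Glim CS that by (intro tendsto_intros) auto
    show "(\<lambda>k. 2 * (norm (G u (m n) - G u (m k)) + b * norm (m n - m k) * r))
      \<longlonglongrightarrow> 2 * (norm (G u (m n) - G u \<mu>0) + b * norm (m n - \<mu>0) * r)"
      using Glim[OF u] m_lim by (intro tendsto_intros)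
    show "\<forall>\<^sub>F k in sequentially. norm (G x (m n) - G x (m k))
        \<le> 2 * (norm (G u (m n) - G u (m k)) + b * norm (m n - m k) * r)"
      using cauchy[OF that] by simp
  qed
  have "\<epsilon> \<longlonglongrightarrow> 2 * (norm (G u \<mu>0 - G u \<mu>0) + b * norm (\<mu>0 - \<mu>0) * r)"
    unfolding \<epsilon>_def using Glim[OF u] m_lim by (intro tendsto_intros)
  moreover have "(\<lambda>n. norm (m n - \<mu>0)) \<longlonglongrightarrow> norm (\<mu>0 - \<mu>0)"
    using m_lim by (intro tendsto_intros)
  ultimately have "(\<lambda>n. a * \<epsilon> n + b * norm (m n - \<mu>0)) \<longlonglongrightarrow> a * 0 + b * 0"
    by (intro tendsto_intros) auto
  then have small: "\<forall>\<^sub>F n in sequentially. a * \<epsilon> n + b * norm (m n - \<mu>0) < e" if "e > 0" for e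
    using that by (intro order_tendstoD(2)) auto
  have "\<exists>g. \<forall>x\<in>C. (\<lambda>n. G x (m n)) \<longlonglongrightarrow> g x \<and>
      (g has_derivative (\<lambda>v. G x \<mu>0 ** T x \<mu>0 v)) (at x within C)"
  proof (rule has_derivative_sequence[where f' = "\<lambda>n x v. G x (m n) ** T x (m n) v"])
    show "convex C" by (simp add: C_def)
    show "((\<lambda>x. G x (m n)) has_derivative (\<lambda>v. G x (m n) ** T x (m n) v)) (at x within C)"
      if "x \<in> C" for n x using D' that has_derivative_at_withinI by blast
    show "\<forall>\<^sub>F n in sequentially. \<forall>x\<in>C. \<forall>h.
        norm (G x (m n) ** T x (m n) h - G x \<mu>0 ** T x \<mu>0 h) \<le> e * norm h" if "e > 0" for e
      using small[OF that]
    proof eventually_elim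
      case (elim n)
      show ?case
      proof (intro ballI allI)
        fix x h assume x: "x \<in> C"
        have "norm (G x (m n) ** T x (m n) h - G x \<mu>0 ** T x \<mu>0 h)
            \<le> (a * norm (G x (m n) - G x \<mu>0) + b * norm (m n - \<mu>0)) * norm h"
          using diff[OF x GQ0[OF x]] .
        also have "\<dots> \<le> (a * \<epsilon> n + b * norm (m n - \<mu>0)) * norm h"
          using unif[OF x] a by (intro mult_right_mono add_right_mono mult_left_mono) auto
        also have "\<dots> \<le> e * norm h" using elim by (intro mult_right_mono) auto
        finally show "norm (G x (m n) ** T x (m n) h - G x \<mu>0 ** T x \<mu>0 h) \<le> e * norm h" .
      qed
    qed
    show "u \<in> C" by (rule uC)
    show "(\<lambda>n. G u (m n)) \<longlonglongrightarrow> G u \<mu>0" by (rule Glim[OF u])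
  qed
  then obtain g where g: "\<And>x. x \<in> C \<Longrightarrow> (\<lambda>n. G x (m n)) \<longlonglongrightarrow> g x"
    "\<And>x. x \<in> C \<Longrightarrow> (g has_derivative (\<lambda>v. G x \<mu>0 ** T x \<mu>0 v)) (at x within C)" by blast
  have eq: "g x = G x \<mu>0" if "x \<in> C" for x
    using LIMSEQ_unique[OF g(1)[OF that] Glim[OF CS(1)[OF that]]] .
  have "ball u r \<subseteq> C" by (auto simp: C_def)
  then have "(g has_derivative (\<lambda>v. G u \<mu>0 ** T u \<mu>0 v)) (at u within ball u r)"
    by (rule has_derivative_subset[OF g(2)[OF uC]])
  moreover have ub: "u \<in> ball u r" using r by simp
  ultimately have "(g has_derivative (\<lambda>v. G u \<mu>0 ** T u \<mu>0 v)) (at u)"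
    by (simp only: at_within_open[OF ub open_ball])
  then show ?thesis
    by (rule has_derivative_transform_within_open[OF _ open_ball ub])
       (use eq \<open>ball u r \<subseteq> C\<close> in blast)
qed

section \<open>Simple elements as spectral combinations\<close>

text \<open>Every simple element, and every polynomial numerator of one, is a combination of a projection and its
  complement; products of two with the same projection multiply eigenvalue by eigenvalue.\<close>

definition spectral :: "complex^'n^'n \<Rightarrow> complex \<Rightarrow> complex \<Rightarrow> complex^'n^'n" where
  "spectral P a b = smult_mat a P + smult_mat b (perp P)"

lemma spectral_mult:
  assumes "hermitian_projection P"
  shows "spectral P a b ** spectral P c d = spectral P (a * c) (b * d)"
  using hermitian_projectionD(1)[OF assms]
  by (simp add: spectral_def perp_def mat_algebra smult_mat_algebra)
     (simp add: vec_eq_iff algebra_simps)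

lemma spectral_fix:
  assumes "hermitian_projection P"
  shows "spectral P a b ** P = smult_mat a P" "P ** spectral P a b = smult_mat a P"
    "spectral P a b ** perp P = smult_mat b (perp P)"
    "perp P ** spectral P a b = smult_mat b (perp P)"
  using hermitian_projectionD(1)[OF assms]
  by (simp_all add: spectral_def perp_def mat_algebra smult_mat_algebra)

lemma spectral_algebra:
  "spectral P 1 1 = mat 1" "smult_mat k (spectral P a b) = spectral P (k * a) (k * b)"
  "spectral (perp P) a b = spectral P b a"
  "conj_mat (spectral P a b) = spectral (conj_mat P) (cnj a) (cnj b)"
  by (auto simp: spectral_def perp_def vec_eq_iff mat_def algebra_simps)

lemma adj_spectral:
  assumes "hermitian_projection P"
  shows "adj (spectral P a b) = spectral P (cnj a) (cnj b)"
  using hermitian_projectionD(2)[OF assms]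
  by (simp add: spectral_def perp_def adj_algebra)

lemma simple_element_spectral:
  "simple_element w P \<mu> = spectral P 1 ((\<mu> - cnj w) / (\<mu> - w))"
  by (simp add: simple_element_def spectral_def smult_mat_algebra)

lemma simple_element_inverse:
  assumes P: "hermitian_projection P" and \<mu>: "\<mu> \<noteq> w" "\<mu> \<noteq> cnj w"
  shows "simple_element w P \<mu> ** simple_element (cnj w) P \<mu> = mat 1"
    "simple_element (cnj w) P \<mu> ** simple_element w P \<mu> = mat 1"
  using \<mu> by (simp_all add: simple_element_spectral spectral_mult[OF P] spectral_algebra)

text \<open>Exchanging the projection with its complement and the pole with its conjugate changes a simple element
  only by a scalar factor. This accounts for the form of the factors in front of \<open>X\<close>.\<close>

lemma simple_element_perp:
  assumes "\<mu> \<noteq> w" "\<mu> \<noteq> cnj w"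
  shows "smult_mat ((\<mu> - cnj w) / (\<mu> - w)) (simple_element (cnj w) (perp P) \<mu>)
    = simple_element w P \<mu>"
  using assms by (simp add: simple_element_spectral spectral_algebra)

lemma adj_simple_element:
  assumes "hermitian_projection P"
  shows "adj (simple_element w P (cnj \<mu>)) = simple_element (cnj w) P \<mu>"
  by (simp add: simple_element_spectral adj_spectral[OF assms])

section \<open>Loop groups and uniqueness of the dressing action\<close>

lemma holomorphic_zero_off_finite:
  assumes f: "f holomorphic_on UNIV" and S: "finite S" and z: "\<And>\<mu>. \<mu> \<notin> S \<Longrightarrow> f \<mu> = 0"
  shows "f \<mu> = (0::complex)"
proof -
  have "f \<midarrow>\<mu>\<rightarrow> f \<mu>"
    using f holomorphic_on_imp_continuous_on continuous_on_eq_continuous_at isCont_def by blast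
  moreover have "\<forall>\<^sub>F x in at \<mu>. x \<in> - (S - {\<mu>})"
    by (rule eventually_at_in_open'[OF open_Compl[OF finite_imp_closed]]) (use S in auto)
  then have "\<forall>\<^sub>F x in at \<mu>. f x = 0"
    using eventually_neq_at_within[of \<mu> \<mu> UNIV] by eventually_elim (use z in auto)
  then have "f \<midarrow>\<mu>\<rightarrow> 0" by (simp add: tendsto_eventually)
  ultimately show ?thesis by (rule LIM_unique)
qed

text \<open>An entire numerator that vanishes at both poles cancels them: removable singularities, one pole at a
  time.\<close>

lemma divide_two_zeros:
  assumes f: "f holomorphic_on UNIV" and ab: "a \<noteq> b" "f a = 0" "f b = 0"
  shows "\<exists>g. g holomorphic_on UNIV \<and> (\<forall>\<mu>. \<mu> \<notin> {a, b} \<longrightarrow> g \<mu> = f \<mu> / ((\<mu> - a) * (\<mu> - b)))"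
proof -
  define f1 where "f1 = (\<lambda>z. if z = a then deriv f a else (f z - f a) / (z - a))"
  have "f1 holomorphic_on UNIV" unfolding f1_def by (rule pole_lemma[OF f]) auto
  then have "(\<lambda>z. if z = b then deriv f1 b else (f1 z - f1 b) / (z - b)) holomorphic_on UNIV"
    by (rule pole_lemma) auto
  moreover have "f1 b = 0" using ab by (simp add: f1_def)
  ultimately show ?thesis using ab
    by (intro exI[of _ "\<lambda>z. if z = b then deriv f1 b else (f1 z - f1 b) / (z - b)"])
       (auto simp: f1_def)
qed

definition holomorphic_vec :: "(complex \<Rightarrow> complex^'m) \<Rightarrow> complex set \<Rightarrow> bool" where
  "holomorphic_vec X S \<longleftrightarrow> (\<forall>i. (\<lambda>\<mu>. X \<mu> $ i) holomorphic_on S)"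

lemma divide_two_zeros_mat:
  assumes N: "holomorphic_mat N UNIV" and ab: "a \<noteq> b" "N a = 0" "N b = 0"
  shows "\<exists>G. holomorphic_mat G UNIV \<and>
    (\<forall>\<mu>. \<mu> \<notin> {a, b} \<longrightarrow> G \<mu> = smult_mat (1 / ((\<mu> - a) * (\<mu> - b))) (N \<mu>))"
proof -
  have "\<exists>g. g holomorphic_on UNIV \<and>
      (\<forall>\<mu>. \<mu> \<notin> {a, b} \<longrightarrow> g \<mu> = N \<mu> $ i $ j / ((\<mu> - a) * (\<mu> - b)))" for i j
    using N ab by (intro divide_two_zeros) (auto simp: holomorphic_mat_def)
  then obtain g where "\<And>i j. g i j holomorphic_on UNIV"
    "\<And>i j \<mu>. \<mu> \<notin> {a, b} \<Longrightarrow> g i j \<mu> = N \<mu> $ i $ j / ((\<mu> - a) * (\<mu> - b))" by metis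
  then show ?thesis
    by (intro exI[of _ "\<lambda>\<mu>. \<chi> i j. g i j \<mu>"]) (auto simp: holomorphic_mat_def vec_eq_iff)
qed

lemma divide_two_zeros_vec:
  assumes N: "holomorphic_vec N UNIV" and ab: "a \<noteq> b" "N a = 0" "N b = 0"
  shows "\<exists>G. holomorphic_vec G UNIV \<and>
    (\<forall>\<mu>. \<mu> \<notin> {a, b} \<longrightarrow> G \<mu> = (1 / ((\<mu> - a) * (\<mu> - b))) *s N \<mu>)"
proof -
  have "\<exists>g. g holomorphic_on UNIV \<and>
      (\<forall>\<mu>. \<mu> \<notin> {a, b} \<longrightarrow> g \<mu> = N \<mu> $ i / ((\<mu> - a) * (\<mu> - b)))" for i
    using N ab by (intro divide_two_zeros) (auto simp: holomorphic_vec_def)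
  then obtain g where "\<And>i. g i holomorphic_on UNIV"
    "\<And>i \<mu>. \<mu> \<notin> {a, b} \<Longrightarrow> g i \<mu> = N \<mu> $ i / ((\<mu> - a) * (\<mu> - b))" by metis
  then show ?thesis
    by (intro exI[of _ "\<lambda>\<mu>. \<chi> i. g i \<mu>"]) (auto simp: holomorphic_vec_def vec_eq_iff)
qed

text \<open>The coordinate \<open>1/\<mu>\<close> at infinity, with the normalisation there built in; both
  conditions of a negative loop then become conditions on one function on a disk.\<close>

definition near_infinity :: "(complex \<Rightarrow> complex^'m^'m) \<Rightarrow> complex \<Rightarrow> complex^'m^'m" where
  "near_infinity g \<zeta> = (if \<zeta> = 0 then mat 1 else g (1 / \<zeta>))"

lemma loops_minus_iff:
  fixes g :: "complex \<Rightarrow> complex^'m^'m"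
  shows "g \<in> loops_minus r \<longleftrightarrow> holomorphic_mat (near_infinity g) (ball 0 r) \<and>
     (\<forall>\<zeta>\<in>ball 0 r. invertible (near_infinity g \<zeta>))"
proof -
  have "invertible (mat 1 :: complex^'m^'m)"
    unfolding invertible_def by (rule exI[of _ "mat 1"]) simp
  then show ?thesis by (auto simp: loops_minus_def near_infinity_def[abs_def])
qed

lemma holomorphic_mat_subset: "holomorphic_mat G S \<Longrightarrow> T \<subseteq> S \<Longrightarrow> holomorphic_mat G T"
  unfolding holomorphic_mat_def using holomorphic_on_subset by blast

lemma loops_minus_mono:
  assumes "g \<in> loops_minus r" "r' \<le> r" shows "g \<in> loops_minus r'"
proof -
  have "ball (0::complex) r' \<subseteq> ball 0 r" using assms(2) by auto
  then show ?thesis using assms(1) holomorphic_mat_subset unfolding loops_minus_iff by blast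
qed

lemma loops_minus_mult:
  assumes "g \<in> loops_minus r" "h \<in> loops_minus r"
  shows "(\<lambda>\<mu>. g \<mu> ** h \<mu>) \<in> loops_minus r"
proof -
  have "near_infinity (\<lambda>\<mu>. g \<mu> ** h \<mu>) = (\<lambda>\<zeta>. near_infinity g \<zeta> ** near_infinity h \<zeta>)"
    by (auto simp: near_infinity_def)
  then show ?thesis
    using assms unfolding loops_minus_iff by (auto intro: holomorphic_mat_mult invertible_mult)
qed

text \<open>Two factorisations differ by a map that is entire on one side and tends to the identity at infinity on
  the other, so Liouville's theorem applies.\<close>

lemma is_dressing_unique:
  fixes g G G1 G2 :: "complex \<Rightarrow> complex^'m^'m"
  assumes 1: "is_dressing g G G1" and 2: "is_dressing g G G2"
  shows "G1 = G2"
proof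
  fix \<mu>0
  obtain r1 g1 where r1: "r1 > 0" "g1 \<in> loops_minus r1"
    "\<And>\<mu>. 1 / r1 < cmod \<mu> \<Longrightarrow> g \<mu> ** G \<mu> = G1 \<mu> ** g1 \<mu>"
    using 1 unfolding is_dressing_def by blast
  obtain r2 g2 where r2: "r2 > 0" "g2 \<in> loops_minus r2"
    "\<And>\<mu>. 1 / r2 < cmod \<mu> \<Longrightarrow> g \<mu> ** G \<mu> = G2 \<mu> ** g2 \<mu>"
    using 2 unfolding is_dressing_def by blast
  define r where "r = min r1 r2"
  have r: "r > 0" "g1 \<in> loops_minus r" "g2 \<in> loops_minus r"
    using r1 r2 by (auto simp: r_def intro: loops_minus_mono)
  have plus: "holomorphic_mat G1 UNIV" "holomorphic_mat G2 UNIV" "\<And>\<mu>. invertible (G1 \<mu>)"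
    using 1 2 by (auto simp: is_dressing_def loops_plus_def)
  define H where "H = (\<lambda>\<mu>. matrix_inv (G1 \<mu>) ** G2 \<mu>)"
  define K where "K = (\<lambda>\<zeta>. near_infinity g1 \<zeta> ** matrix_inv (near_infinity g2 \<zeta>))"
  have holH: "holomorphic_mat H UNIV"
    unfolding H_def by (intro holomorphic_mat_mult holomorphic_mat_inv plus)
  have holK: "holomorphic_mat K (ball 0 r)"
    unfolding K_def using r unfolding loops_minus_iff
    by (intro holomorphic_mat_mult holomorphic_mat_inv) auto
  have K0: "K 0 = mat 1"
    using matrix_inv_unique_right(1)[of "mat 1" "mat 1"] by (simp add: K_def near_infinity_def)
  have HK: "H (inverse \<zeta>) = K \<zeta>" if \<zeta>: "\<zeta> \<in> ball 0 r" "\<zeta> \<noteq> 0" for \<zeta>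
  proof -
    let ?m = "inverse \<zeta>"
    have "cmod \<zeta> < r" using \<zeta> by simp
    then have "1 / r < cmod ?m" using \<zeta> r(1) by (simp add: norm_inverse divide_inverse)
    then have m: "1 / r1 < cmod ?m" "1 / r2 < cmod ?m"
      using r1(1) r2(1) frac_le[of 1 1 r r1] frac_le[of 1 1 r r2] r(1) by (auto simp: r_def)
    then have eq: "G1 ?m ** g1 ?m = G2 ?m ** g2 ?m" using r1 r2 by metis
    have "invertible (near_infinity g2 \<zeta>)" using r \<zeta> by (simp add: loops_minus_iff)
    then have inv: "invertible (g2 ?m)" using \<zeta> by (simp add: near_infinity_def divide_inverse)
    have "K \<zeta> = matrix_inv (G1 ?m) ** G1 ?m ** g1 ?m ** matrix_inv (g2 ?m)"
      using \<zeta> plus(3) by (simp add: K_def near_infinity_def divide_inverse matrix_inv_cancel)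
    also have "\<dots> = matrix_inv (G1 ?m) ** (G2 ?m ** g2 ?m) ** matrix_inv (g2 ?m)"
      by (simp add: mat_mul_assoc_right flip: eq)
    also have "\<dots> = H ?m"
      using inv by (simp add: H_def mat_mul_assoc_right matrix_inv_cancel)
    finally show ?thesis by simp
  qed
  have "H \<mu>0 $ i $ j = (mat 1 :: complex^'m^'m) $ i $ j" for i j
  proof (rule Liouville_weak[of "\<lambda>\<mu>. H \<mu> $ i $ j"])
    show "(\<lambda>\<mu>. H \<mu> $ i $ j) holomorphic_on UNIV"
      using holH by (simp add: holomorphic_mat_def)
    have "(\<lambda>\<zeta>. K \<zeta> $ i $ j) holomorphic_on ball 0 r"
      using holK by (simp add: holomorphic_mat_def)
    then have "isCont (\<lambda>\<zeta>. K \<zeta> $ i $ j) 0"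
      using r(1) continuous_on_eq_continuous_at[OF open_ball] holomorphic_on_imp_continuous_on
      by (metis centre_in_ball)
    then have "((\<lambda>\<zeta>. K \<zeta> $ i $ j) \<longlongrightarrow> mat 1 $ i $ j) (at 0)" by (simp add: isCont_def K0)
    then have "(((\<lambda>\<mu>. H \<mu> $ i $ j) \<circ> inverse) \<longlongrightarrow> mat 1 $ i $ j) (at 0)"
      by (rule Lim_transform_within_open[of _ _ _ _ "ball 0 r"]) (use r HK in auto)
    then show "((\<lambda>\<mu>. H \<mu> $ i $ j) \<longlongrightarrow> mat 1 $ i $ j) at_infinity"
      by (simp add: lim_at_infinity_0)
  qed
  then have "H \<mu>0 = mat 1" by (simp add: vec_eq_iff)
  then have "G1 \<mu>0 ** H \<mu>0 = G1 \<mu>0" by simp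
  then show "G1 \<mu>0 = G2 \<mu>0"
    using plus(3) by (simp add: H_def matrix_mul_assoc matrix_inv_cancel)
qed

lemma is_dressing_imp_dress:
  assumes "is_dressing g G G'" shows "dress g G = G'"
  unfolding dress_def
proof (rule the_equality, rule assms)
  show "H = G'" if "is_dressing g G H" for H using is_dressing_unique[OF that assms] .
qed

lemma is_dressing_imp_dressable:
  assumes "is_dressing g G G'" "G \<in> loops_plus" shows "dressable g G"
  unfolding dressable_def using assms is_dressing_unique by blast

lemma is_dressing_one:
  fixes g :: "complex \<Rightarrow> complex^'m^'m"
  assumes "g \<in> loops_minus r" "r > 0" shows "is_dressing g (\<lambda>_. mat 1) (\<lambda>_. mat 1)"
proof -
  have "(\<lambda>_. mat 1 :: complex^'m^'m) \<in> loops_plus"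
    by (auto simp: loops_plus_def holomorphic_mat_def invertible_def intro!: exI[of _ "mat 1"])
  then show ?thesis using assms unfolding is_dressing_def by auto
qed

lemma is_dressing_comp:
  fixes g1 g2 F F1 F2 :: "complex \<Rightarrow> complex^'m^'m"
  assumes 1: "is_dressing g1 F F1" and 2: "is_dressing g2 F1 F2"
  shows "is_dressing (\<lambda>\<mu>. g2 \<mu> ** g1 \<mu>) F F2"
proof -
  obtain r1 k1 where r1: "r1 > 0" "g1 \<in> loops_minus r1" "k1 \<in> loops_minus r1"
    "\<And>\<mu>. 1 / r1 < cmod \<mu> \<Longrightarrow> g1 \<mu> ** F \<mu> = F1 \<mu> ** k1 \<mu>"
    using 1 unfolding is_dressing_def by blast
  obtain r2 k2 where r2: "r2 > 0" "g2 \<in> loops_minus r2" "k2 \<in> loops_minus r2"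
    "\<And>\<mu>. 1 / r2 < cmod \<mu> \<Longrightarrow> g2 \<mu> ** F1 \<mu> = F2 \<mu> ** k2 \<mu>"
    using 2 unfolding is_dressing_def by blast
  define r where "r = min r1 r2"
  have r: "r > 0" "r \<le> r1" "r \<le> r2" using r1 r2 by (auto simp: r_def)
  have "g2 \<mu> ** g1 \<mu> ** F \<mu> = F2 \<mu> ** (k2 \<mu> ** k1 \<mu>)" if "1 / r < cmod \<mu>" for \<mu>
  proof -
    have m: "1 / r1 < cmod \<mu>" "1 / r2 < cmod \<mu>"
      using that r r1(1) r2(1) frac_le[of 1 1 r r1] frac_le[of 1 1 r r2] by auto
    have "g2 \<mu> ** g1 \<mu> ** F \<mu> = g2 \<mu> ** F1 \<mu> ** k1 \<mu>"
      using r1(4)[OF m(1)] by (simp add: mat_mul_assoc_right)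
    also have "\<dots> = F2 \<mu> ** (k2 \<mu> ** k1 \<mu>)"
      using r2(4)[OF m(2)] by (simp add: mat_mul_assoc_right)
    finally show ?thesis .
  qed
  moreover have "F2 \<in> loops_plus" using 2 by (simp add: is_dressing_def)
  ultimately show ?thesis
    unfolding is_dressing_def using r r1 r2
    by (intro conjI exI[of _ r] bexI[of _ "\<lambda>\<mu>. k2 \<mu> ** k1 \<mu>"])
       (auto intro: loops_minus_mult loops_minus_mono)
qed

text \<open>Only the values near infinity of the acting loop matter, because the disk of the factorisation may
  shrink. This disposes of the dummy values of simple elements at their poles.\<close>

lemma is_dressing_cong:
  fixes g h F F' :: "complex \<Rightarrow> complex^'m^'m"
  assumes d: "is_dressing g F F'" and eq: "\<And>\<mu>. R < cmod \<mu> \<Longrightarrow> g \<mu> = h \<mu>"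
  shows "is_dressing h F F'"
proof -
  obtain r k where r: "r > 0" "g \<in> loops_minus r" "k \<in> loops_minus r"
    "\<And>\<mu>. 1 / r < cmod \<mu> \<Longrightarrow> g \<mu> ** F \<mu> = F' \<mu> ** k \<mu>"
    using d unfolding is_dressing_def by blast
  define s where "s = min r (1 / (\<bar>R\<bar> + 1))"
  have s: "s > 0" "s \<le> r" using r by (auto simp: s_def)
  have big: "R < cmod \<mu>" "1 / r < cmod \<mu>" if "1 / s < cmod \<mu>" for \<mu>
  proof -
    have "1 / (1 / (\<bar>R\<bar> + 1)) \<le> 1 / s" using s by (intro divide_left_mono) (auto simp: s_def)
    then show "R < cmod \<mu>" using that by simp
    show "1 / r < cmod \<mu>" using that s r frac_le[of 1 1 s r] by auto
  qed
  have ni: "near_infinity g \<zeta> = near_infinity h \<zeta>" if "\<zeta> \<in> ball 0 s" for \<zeta>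
  proof (cases "\<zeta> = 0")
    case False
    then have "1 / s < cmod (1 / \<zeta>)" using that s by (simp add: norm_divide frac_less2)
    then show ?thesis using eq big by (simp add: near_infinity_def)
  qed (simp add: near_infinity_def)
  have "g \<in> loops_minus s" "k \<in> loops_minus s" using r s loops_minus_mono by blast+
  moreover have "h \<in> loops_minus s"
    using \<open>g \<in> loops_minus s\<close> ni unfolding loops_minus_iff holomorphic_mat_def
    by (metis (no_types, lifting) holomorphic_transform)
  moreover have "h \<mu> ** F \<mu> = F' \<mu> ** k \<mu>" if "1 / s < cmod \<mu>" for \<mu>
    using r(4)[OF big(2)[OF that]] eq[OF big(1)[OF that]] by simp
  moreover have "F' \<in> loops_plus" using d by (simp add: is_dressing_def)
  ultimately show ?thesis using s unfolding is_dressing_def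
    by (intro conjI exI[of _ s] bexI[of _ k]) auto
qed

text \<open>The involution whose fixed points are the frames with real data. Reflection at the imaginary axis, not
  at the real axis, keeps \<open>i \<mu>\<close> compatible with conjugation.\<close>

definition reflect :: "(complex \<Rightarrow> complex^'m^'m) \<Rightarrow> complex \<Rightarrow> complex^'m^'m" where
  "reflect G \<mu> = conj_mat (G (- cnj \<mu>))"

lemma holomorphic_reflect:
  assumes f: "f holomorphic_on S" and S: "open S" "\<And>\<mu>. \<mu> \<in> S \<Longrightarrow> - cnj \<mu> \<in> S"
  shows "(\<lambda>\<mu>. cnj (f (- cnj \<mu>))) holomorphic_on S"
proof -
  have "uminus ` S \<subseteq> cnj ` S"
  proof
    fix y assume "y \<in> uminus ` S"
    then obtain x where x: "x \<in> S" "y = - x" by blast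
    then have "y = cnj (- cnj x)" by simp
    with S(2)[OF x(1)] show "y \<in> cnj ` S" by blast
  qed
  have "(\<lambda>\<mu>. f (- \<mu>)) holomorphic_on cnj ` S"
  proof (rule holomorphic_on_compose_gen[unfolded o_def, OF _ f])
    show "uminus ` (cnj ` S) \<subseteq> S" using S by auto
  qed (auto intro!: holomorphic_intros)
  from holomorphic_on_compose_cnj_cnj[OF this S(1)] show ?thesis by (simp add: o_def)
qed

lemma is_dressing_reflect:
  fixes g F F' :: "complex \<Rightarrow> complex^'m^'m"
  assumes d: "is_dressing g F F'"
  shows "is_dressing (reflect g) (reflect F) (reflect F')"
proof -
  have inv: "invertible (conj_mat A)" if "invertible A" for A :: "complex^'m^'m"
    using that unfolding invertible_def by (metis conj_mat_algebra(3,5))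
  have lm: "reflect k \<in> loops_minus r" if "k \<in> loops_minus r" for k :: "complex \<Rightarrow> complex^'m^'m" and r
  proof -
    have ni: "near_infinity (reflect k) = (\<lambda>\<zeta>. conj_mat (near_infinity k (- cnj \<zeta>)))"
      by (auto simp: near_infinity_def reflect_def conj_mat_algebra)
    show ?thesis using that unfolding loops_minus_iff ni holomorphic_mat_def
      by (auto intro!: holomorphic_reflect inv)
  qed
  obtain r k where r: "r > 0" "g \<in> loops_minus r" "k \<in> loops_minus r"
    "\<And>\<mu>. 1 / r < cmod \<mu> \<Longrightarrow> g \<mu> ** F \<mu> = F' \<mu> ** k \<mu>"
    using d unfolding is_dressing_def by blast
  have "reflect F' \<in> loops_plus"
    using d unfolding is_dressing_def loops_plus_def holomorphic_mat_def
    by (auto simp: reflect_def intro!: holomorphic_reflect inv)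
  moreover have "reflect g \<mu> ** reflect F \<mu> = reflect F' \<mu> ** reflect k \<mu>" if "1 / r < cmod \<mu>" for \<mu>
    using r(4)[of "- cnj \<mu>"] that by (simp add: reflect_def flip: conj_mat_algebra(3))
  ultimately show ?thesis
    unfolding is_dressing_def using r lm
    by (intro conjI exI[of _ r] bexI[of _ "reflect k"]) auto
qed

subsection \<open>The factorisation by a simple element\<close>

text \<open>The shape of the negative factors on both sides of the factorisation. The vector \<open>y\<close>
  compensates the pole that the translation part would otherwise acquire; for \<open>y = 0\<close> this is
  the acting simple element.\<close>

definition dressing_factor ::
  "complex \<Rightarrow> complex^'n^'n \<Rightarrow> complex^'n \<Rightarrow> complex \<Rightarrow> complex^('n + 1)^('n + 1)" where
  "dressing_factor w P y \<mu> = block (simple_element w P \<mu>) (((cnj w - w) / (\<mu> - w)) *s y)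
     ((\<mu> - cnj w) / (\<mu> - w))"

lemma simple_element_ext_factor: "simple_element_ext w P = dressing_factor w P 0"
  by (simp add: fun_eq_iff simple_element_ext_def dressing_factor_def)

lemma dressing_factor_loops_minus:
  fixes P :: "complex^'n^'n"
  assumes P: "hermitian_projection P" and w: "w \<noteq> 0" and r: "r \<le> 1 / cmod w"
  shows "dressing_factor w P y \<in> loops_minus r"
proof -
  let ?c = "\<lambda>\<zeta>. (1 - cnj w * \<zeta>) / (1 - w * \<zeta>)"
  have nz: "1 - w * \<zeta> \<noteq> 0" "1 - cnj w * \<zeta> \<noteq> 0" if "\<zeta> \<in> ball 0 r" for \<zeta>
  proof -
    have "cmod \<zeta> < 1 / cmod w" using that r by simp
    then have "cmod (w * \<zeta>) < 1" "cmod (cnj w * \<zeta>) < 1"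
      using w by (auto simp: norm_mult field_simps)
    then show "1 - w * \<zeta> \<noteq> 0" "1 - cnj w * \<zeta> \<noteq> 0" by force+
  qed
  have ni: "near_infinity (dressing_factor w P y) \<zeta> =
      block (spectral P 1 (?c \<zeta>)) (((cnj w - w) * \<zeta> / (1 - w * \<zeta>)) *s y) (?c \<zeta>)"
    if z: "\<zeta> \<in> ball 0 r" for \<zeta>
  proof (cases "\<zeta> = 0")
    case True then show ?thesis by (simp add: near_infinity_def spectral_algebra block_one)
  next
    case False
    then have "1 / \<zeta> - w \<noteq> 0" using nz(1)[OF z] by (simp add: field_simps)
    then have "(1 / \<zeta> - cnj w) / (1 / \<zeta> - w) = ?c \<zeta>"
      "(cnj w - w) / (1 / \<zeta> - w) = (cnj w - w) * \<zeta> / (1 - w * \<zeta>)"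
      using nz(1)[OF z] False by (auto simp: field_simps)
    then show ?thesis using False
      by (simp add: near_infinity_def dressing_factor_def simple_element_spectral)
  qed
  have "(\<lambda>\<zeta>. block (spectral P 1 (?c \<zeta>)) (((cnj w - w) * \<zeta> / (1 - w * \<zeta>)) *s y) (?c \<zeta>) $ p $ q)
      holomorphic_on ball 0 r" for p q
  proof -
    have "\<forall>p q. (\<lambda>\<zeta>. block (spectral P 1 (?c \<zeta>)) (((cnj w - w) * \<zeta> / (1 - w * \<zeta>)) *s y) (?c \<zeta>) $ p $ q)
      holomorphic_on ball 0 r"
      by (simp add: all_plus_one spectral_def) (use nz in \<open>auto intro!: holomorphic_intros\<close>)
    then show ?thesis by blast
  qed
  then have "holomorphic_mat (near_infinity (dressing_factor w P y)) (ball 0 r)"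
    unfolding holomorphic_mat_def using ni by (metis (no_types, lifting) holomorphic_transform)
  moreover have "invertible (near_infinity (dressing_factor w P y) \<zeta>)" if "\<zeta> \<in> ball 0 r" for \<zeta>
  proof -
    have c: "?c \<zeta> \<noteq> 0" using nz[OF that] by simp
    then have "spectral P 1 (?c \<zeta>) ** spectral P 1 (1 / ?c \<zeta>) = mat 1"
      by (simp add: spectral_mult[OF P] spectral_algebra del: divide_divide_eq_right)
    then show ?thesis unfolding ni[OF that] using c by (rule invertible_block)
  qed
  ultimately show ?thesis unfolding loops_minus_iff by blast
qed

text \<open>The factorisation of \<open>g\<^bsub>w,P\<^esub> * (E, X)\<close> at a fixed point \<open>u\<close>. The
  numerators of both blocks vanish at \<open>w\<close> and at its conjugate by the choice of
  \<open>Q\<close> and \<open>\<eta>\<close>, so they are divisible by \<open>(\<mu> - w)(\<mu> -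
  w\<^sup>*)\<close>. Unitarity holds off the poles and extends to them by continuity; it also provides
  invertibility of the new frame.\<close>

lemma simple_element_dressing:
  fixes E :: "complex \<Rightarrow> complex^'n^'n" and X :: "complex \<Rightarrow> complex^'n"
  assumes P: "hermitian_projection P" and w: "Im w \<noteq> 0"
    and E: "holomorphic_mat E UNIV" and X: "holomorphic_vec X UNIV"
    and unit: "\<And>\<mu>. adj (E (cnj \<mu>)) ** E \<mu> = mat 1"
    and Q: "Q = proj_formula (adj (E (cnj w))) P" and \<eta>: "\<eta> = adj (E w) *v X (cnj w)"
  shows "\<exists>E' X'. is_dressing (simple_element_ext w P) (\<lambda>\<mu>. block (E \<mu>) (X \<mu>) 1)
        (\<lambda>\<mu>. block (E' \<mu>) (X' \<mu>) 1) \<and>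
      holomorphic_mat E' UNIV \<and> holomorphic_vec X' UNIV \<and>
      (\<forall>\<mu>. adj (E' (cnj \<mu>)) ** E' \<mu> = mat 1) \<and>
      (\<forall>\<mu>. \<mu> \<notin> {w, cnj w} \<longrightarrow>
        E' \<mu> = simple_element w P \<mu> ** E \<mu> ** simple_element (cnj w) Q \<mu> \<and>
        X' \<mu> = simple_element (cnj w) (perp P) \<mu> *v
          (X \<mu> - ((cnj w - w) / (\<mu> - w)) *s (E \<mu> *v (Q *v \<eta>))))"
proof -
  have ww: "w \<noteq> cnj w" using w by (auto simp: complex_eq_iff)
  have unit': "E \<mu> ** adj (E (cnj \<mu>)) = mat 1" for \<mu>
    using unit matrix_inv_unique_right(3) by blast
  have inv: "invertible (adj (E (cnj w)))"
    using unit unfolding invertible_def using unit' by blast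
  have hQ: "hermitian_projection Q"
    unfolding Q by (rule hermitian_projection_formula[OF P inv])
  note ann = proj_formula_annihilates[OF P unit[of w], folded Q, unfolded adj_algebra]
  define N where "N = (\<lambda>\<mu>. spectral P (\<mu> - w) (\<mu> - cnj w) ** E \<mu> ** spectral Q (\<mu> - cnj w) (\<mu> - w))"
  have hol_spec: "holomorphic_mat (\<lambda>\<mu>. spectral R (\<mu> - a) (\<mu> - b)) UNIV" for R :: "complex^'n^'n" and a b
    unfolding holomorphic_mat_def spectral_def by (auto intro!: holomorphic_intros)
  have "holomorphic_mat N UNIV" unfolding N_def by (intro holomorphic_mat_mult hol_spec E)
  moreover have "N w = 0"
    using ann(2) by (simp add: N_def spectral_def smult_mat_algebra mat_algebra)
  moreover have "N (cnj w) = 0"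
    using ann(3) by (simp add: N_def spectral_def smult_mat_algebra mat_algebra)
  ultimately obtain E' where E': "holomorphic_mat E' UNIV"
    "\<And>\<mu>. \<mu> \<notin> {w, cnj w} \<Longrightarrow> E' \<mu> = smult_mat (1 / ((\<mu> - w) * (\<mu> - cnj w))) (N \<mu>)"
    using divide_two_zeros_mat[of N w "cnj w"] ww by blast
  define NX where "NX = (\<lambda>\<mu>. spectral P (\<mu> - w) (\<mu> - cnj w) *v
      ((\<mu> - w) *s X \<mu> - (cnj w - w) *s (E \<mu> *v (Q *v \<eta>))))"
  have "holomorphic_vec NX UNIV"
    using E X unfolding NX_def holomorphic_vec_def holomorphic_mat_def spectral_def matrix_vector_mult_def
    by (auto intro!: holomorphic_intros)
  moreover have "NX w = 0"
  proof -
    have "perp P *v (E w *v (Q *v \<eta>)) = 0"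
      using arg_cong[OF ann(2), of "\<lambda>M. M *v \<eta>"] by (simp add: mat_vec_assoc_right mat_algebra_ring)
    then show ?thesis by (simp add: NX_def spectral_def smult_mat_algebra mat_algebra)
  qed
  moreover have "NX (cnj w) = 0"
  proof -
    have "P *v (E (cnj w) *v (perp Q *v \<eta>)) = 0"
      using arg_cong[OF ann(3), of "\<lambda>M. M *v \<eta>"] by (simp add: mat_vec_assoc_right mat_algebra_ring)
    moreover have "E (cnj w) *v \<eta> = X (cnj w)"
      using unit'[of "cnj w"] by (simp add: \<eta> matrix_vector_mul_assoc)
    ultimately have "P *v X (cnj w) = P *v (E (cnj w) *v (Q *v \<eta>))"
      by (simp add: perp_def mat_algebra)
    then show ?thesis by (simp add: NX_def spectral_def smult_mat_algebra mat_algebra)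
  qed
  ultimately obtain X' where X': "holomorphic_vec X' UNIV"
    "\<And>\<mu>. \<mu> \<notin> {w, cnj w} \<Longrightarrow> X' \<mu> = (1 / ((\<mu> - w) * (\<mu> - cnj w))) *s NX \<mu>"
    using divide_two_zeros_vec[of NX w "cnj w"] ww by blast
  have E'_off: "E' \<mu> = simple_element w P \<mu> ** E \<mu> ** simple_element (cnj w) Q \<mu>"
    if "\<mu> \<notin> {w, cnj w}" for \<mu>
  proof -
    have "simple_element w P \<mu> = smult_mat (1 / (\<mu> - w)) (spectral P (\<mu> - w) (\<mu> - cnj w))"
      "simple_element (cnj w) Q \<mu> = smult_mat (1 / (\<mu> - cnj w)) (spectral Q (\<mu> - cnj w) (\<mu> - w))"
      using that by (simp_all add: simple_element_spectral spectral_algebra)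
    then show ?thesis
      by (simp add: E'(2)[OF that] N_def mat_algebra_ring smult_mat_algebra mult.commute)
  qed
  have X'_off: "X' \<mu> = simple_element (cnj w) (perp P) \<mu> *v
          (X \<mu> - ((cnj w - w) / (\<mu> - w)) *s (E \<mu> *v (Q *v \<eta>)))"
    if "\<mu> \<notin> {w, cnj w}" for \<mu>
  proof -
    have 1: "simple_element (cnj w) (perp P) \<mu> = smult_mat (1 / (\<mu> - cnj w)) (spectral P (\<mu> - w) (\<mu> - cnj w))"
      using that by (simp add: simple_element_spectral spectral_algebra)
    have gen: "x - (k / d) *s y = (1 / d) *s (d *s x - k *s y)" if "d \<noteq> 0"
      for d k :: complex and x y :: "complex^'n"
      using that by (simp add: vec_eq_iff field_simps)
    have 2: "X \<mu> - ((cnj w - w) / (\<mu> - w)) *s (E \<mu> *v (Q *v \<eta>))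
      = (1 / (\<mu> - w)) *s ((\<mu> - w) *s X \<mu> - (cnj w - w) *s (E \<mu> *v (Q *v \<eta>)))"
      using that by (intro gen) auto
    have 3: "1 / ((\<mu> - w) * (\<mu> - cnj w)) = 1 / (\<mu> - w) * (1 / (\<mu> - cnj w))"
      by simp
    show ?thesis unfolding 1 2 X'(2)[OF that] NX_def 3
      by (simp only: mat_algebra_ring(19,20) vector_smult_assoc)
  qed
  have unitE': "adj (E' (cnj \<mu>)) ** E' \<mu> = mat 1" for \<mu>
  proof -
    have off: "adj (E' (cnj \<mu>)) ** E' \<mu> = mat 1" if "\<mu> \<notin> {w, cnj w}" for \<mu>
    proof -
      have m: "cnj \<mu> \<notin> {w, cnj w}" "\<mu> \<noteq> w" "\<mu> \<noteq> cnj w"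
        using that by (auto dest: arg_cong[of _ _ cnj])
      have "adj (E' (cnj \<mu>)) = simple_element w Q \<mu> ** adj (E (cnj \<mu>)) ** simple_element (cnj w) P \<mu>"
        using adj_simple_element[OF hQ, of "cnj w" \<mu>]
        by (simp add: E'_off[OF m(1)] adj_algebra adj_simple_element[OF P] mat_mul_assoc_right)
      then have "adj (E' (cnj \<mu>)) ** E' \<mu> = simple_element w Q \<mu> ** (adj (E (cnj \<mu>)) **
          (simple_element (cnj w) P \<mu> ** simple_element w P \<mu>) ** E \<mu>) ** simple_element (cnj w) Q \<mu>"
        by (simp add: E'_off[OF that] mat_mul_assoc_right)
      then show ?thesis
        using m by (simp add: simple_element_inverse[OF P] unit simple_element_inverse[OF hQ])
    qed
    have "(adj (E' (cnj \<mu>)) ** E' \<mu> - mat 1) $ i $ j = 0" for i j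
    proof (rule holomorphic_zero_off_finite[where S = "{w, cnj w}" and
          f = "\<lambda>\<mu>. (adj (E' (cnj \<mu>)) ** E' \<mu> - mat 1) $ i $ j"])
      have c: "(\<lambda>\<mu>. cnj (E' (cnj \<mu>) $ a $ b)) holomorphic_on UNIV" for a b
        using E'(1) holomorphic_on_compose_cnj_cnj[of "\<lambda>\<mu>. E' \<mu> $ a $ b" UNIV]
        by (simp add: o_def holomorphic_mat_def) (metis holomorphic_on_subset top_greatest)
      show "(\<lambda>\<mu>. (adj (E' (cnj \<mu>)) ** E' \<mu> - mat 1) $ i $ j) holomorphic_on UNIV"
        using c E'(1) unfolding holomorphic_mat_def matrix_matrix_mult_def
        by (auto intro!: holomorphic_intros)
    qed (use off in auto)
    then show ?thesis by (simp add: vec_eq_iff)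
  qed
  have "is_dressing (simple_element_ext w P) (\<lambda>\<mu>. block (E \<mu>) (X \<mu>) 1) (\<lambda>\<mu>. block (E' \<mu>) (X' \<mu>) 1)"
    unfolding is_dressing_def
  proof (intro conjI exI[of _ "1 / cmod w"] bexI[of _ "dressing_factor w Q (Q *v \<eta>)"] allI impI)
    have "\<forall>p q. (\<lambda>\<mu>. block (E' \<mu>) (X' \<mu>) 1 $ p $ q) holomorphic_on UNIV"
      using E'(1) X'(1) by (simp add: all_plus_one holomorphic_mat_def holomorphic_vec_def)
    moreover have "invertible (block (E' \<mu>) (X' \<mu>) 1)" for \<mu>
      using matrix_inv_unique_right(3)[OF unitE'] by (intro invertible_block) auto
    ultimately show "(\<lambda>\<mu>. block (E' \<mu>) (X' \<mu>) 1) \<in> loops_plus"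
      by (simp add: loops_plus_def holomorphic_mat_def)
    have "w \<noteq> 0" using w by auto
    then show "0 < 1 / cmod w" by simp
    show "simple_element_ext w P \<in> loops_minus (1 / cmod w)"
      "dressing_factor w Q (Q *v \<eta>) \<in> loops_minus (1 / cmod w)"
      unfolding simple_element_ext_factor
      using dressing_factor_loops_minus P hQ \<open>w \<noteq> 0\<close> by blast+
    fix \<mu> assume "1 / (1 / cmod w) < cmod \<mu>"
    then have m: "\<mu> \<notin> {w, cnj w}" "\<mu> \<noteq> w" "\<mu> \<noteq> cnj w" by auto
    let ?c = "(\<mu> - cnj w) / (\<mu> - w)" and ?k = "(cnj w - w) / (\<mu> - w)"
    have 1: "E' \<mu> ** simple_element w Q \<mu> = simple_element w P \<mu> ** E \<mu>"
      using m simple_element_inverse(2)[OF hQ, of \<mu> w]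
      by (simp add: E'_off mat_mul_assoc_right)
    have 2: "simple_element (cnj w) Q \<mu> *v (Q *v \<eta>) = Q *v \<eta>"
      using spectral_fix(1)[OF hQ, of 1]
      by (simp add: simple_element_spectral matrix_vector_mul_assoc smult_mat_algebra)
    \<comment> \<open>clearing the scalar factor turns the factor in front of the translation part into the acting
      simple element\<close>
    have 3: "?c *s X' \<mu> = simple_element w P \<mu> *v (X \<mu> - ?k *s (E \<mu> *v (Q *v \<eta>)))"
      using simple_element_perp[OF m(2,3), of P] X'_off[OF m(1)]
      by (metis mat_algebra_ring(19))
    show "simple_element_ext w P \<mu> ** block (E \<mu>) (X \<mu>) 1
        = block (E' \<mu>) (X' \<mu>) 1 ** dressing_factor w Q (Q *v \<eta>) \<mu>"
      unfolding simple_element_ext_def dressing_factor_def block_mult block_eq_iff 1 3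
      by (simp add: E'_off[OF m(1)] mat_algebra 2)
  qed
  then show ?thesis using E'(1) X'(1) unitE' E'_off X'_off by blast
qed

section \<open>Hermitian frames and dressing by one simple element\<close>

text \<open>The rotational part of the connection form, for an arbitrary complex matrix in place of the rotation
  coefficients. Diagonal entries of \<open>B\<close> cancel in the commutator.\<close>

definition conn :: "complex^'n^'n \<Rightarrow> complex \<Rightarrow> real^'n \<Rightarrow> complex^'n^'n" where
  "conn B \<mu> v = smult_mat (\<i> * \<mu>) (delta v) + (delta v ** B - B ** delta v)"

lemma adj_conn: "adj B = B \<Longrightarrow> adj (conn B \<mu> v) = - conn B (cnj \<mu>) v"
  by (simp add: conn_def adj_algebra smult_mat_algebra) (simp add: vec_eq_iff)

lemmas bilin_mult = bounded_bilinear.FDERIV[OF bounded_bilinear_matrix_mult]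
lemmas bilin_vec = bounded_bilinear.FDERIV[OF bounded_bilinear_matrix_vector_mult]
lemmas bilin_inner = bounded_bilinear.FDERIV[OF bounded_bilinear_cinner]
lemmas lin_maps = bounded_linear_finite_dim_maps[THEN bounded_linear.has_derivative]

text \<open>The relations between the parameter, the poles and \<open>e = 1 - (\<mu> - w) / (\<mu> -
  w\<^sup>*)\<close>. Expressing \<open>w\<close> through \<open>e\<close> turns the rational identities
  below into polynomial ones.\<close>

lemma pole_ratio:
  fixes m a y :: complex
  shows "m \<noteq> y \<Longrightarrow> a = y + (1 - (m - a) / (m - y)) * (m - y)"
    and "m \<noteq> a \<Longrightarrow> m \<noteq> y \<Longrightarrow> (m - a) / (m - y) * ((y - a) / (m - a)) = (m - a) / (m - y) - 1"
proof -
  have "(1 - r / d) * d = d - r" if "d \<noteq> 0" for r d :: complex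
    using that by (simp add: left_diff_distrib)
  from this[of "m - y" "m - a"] show "m \<noteq> y \<Longrightarrow> a = y + (1 - (m - a) / (m - y)) * (m - y)" by simp
  assume m: "m \<noteq> a" "m \<noteq> y"
  then have "(m - a) / (m - y) * ((y - a) / (m - a)) = (y - a) / (m - y)" by simp
  also have "\<dots> = ((m - a) - (m - y)) / (m - y)" by simp
  also have "\<dots> = (m - a) / (m - y) - (m - y) / (m - y)" by (rule diff_divide_distrib)
  also have "\<dots> = (m - a) / (m - y) - 1" using m by simp
  finally show "(m - a) / (m - y) * ((y - a) / (m - a)) = (m - a) / (m - y) - 1" .
qed

text \<open>Here \<open>k\<close> is the inverse of the new simple element and the bracket is the derivative of the
  projection \<open>Q\<close>, so the identity says that \<open>k\<close> is a gauge transformation from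
  the old connection to the one with \<open>B + s Q\<close>. After substituting for \<open>w\<close> it is
  polynomial in \<open>e\<close>, \<open>\<mu>\<close>, \<open>y\<close> and linear in the words formed
  from \<open>Q\<close>, \<open>B\<close>, \<open>d\<close>.\<close>

lemma intertwine_matrix:
  fixes Q B d :: "complex^'n^'n" and e \<mu> y w s :: complex
  assumes Q: "Q ** Q = Q" and w: "w = y + e * (\<mu> - y)" and s: "s = \<i> * (w - y)"
  defines "A \<equiv> \<lambda>m. smult_mat (\<i> * m) d + (d ** B - B ** d)"
  defines "k \<equiv> Q + smult_mat (1 - e) (mat 1 - Q)"
  shows "A \<mu> ** k + smult_mat e (Q ** A y - A w ** Q + smult_mat s (Q ** d ** Q))
    = k ** (smult_mat (\<i> * \<mu>) d + (d ** (B + smult_mat s Q) - (B + smult_mat s Q) ** d))"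
proof -
  have QQ: "Q ** (Q ** M) = Q ** M" for M by (metis Q matrix_mul_assoc)
  show ?thesis unfolding A_def k_def s w
    by (simp add: mat_algebra smult_mat_algebra Q QQ) (simp add: vec_eq_iff algebra_simps)
qed

text \<open>The companion for the translation part: the derivative of \<open>\<eta>\<close> enters as \<open>d H - A
  \<eta>\<close>, and the new vector \<open>H + s Q \<eta>\<close> comes out.\<close>

lemma intertwine_vector:
  fixes Q B d :: "complex^'n^'n" and H \<eta> :: "complex^'n" and e \<mu> y w s :: complex
  assumes Q: "Q ** Q = Q" and w: "w = y + e * (\<mu> - y)" and s: "s = \<i> * (w - y)"
  defines "A \<equiv> \<lambda>m. smult_mat (\<i> * m) d + (d ** B - B ** d)"
  defines "k \<equiv> Q + smult_mat (1 - e) (mat 1 - Q)"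
  shows "(1 - e) *s (d *v H) + e *s (A \<mu> *v (Q *v \<eta>)
      + ((Q ** A y - A w ** Q + smult_mat s (Q ** d ** Q)) *v \<eta> + Q *v (d *v H - A y *v \<eta>)))
    = k *v (d *v (H + s *s (Q *v \<eta>)))"
proof -
  have QQ: "Q *v (Q *v M) = Q *v M" for M by (metis Q matrix_vector_mul_assoc)
  show ?thesis unfolding A_def k_def s w
    by (simp add: mat_algebra smult_mat_algebra Q QQ) (simp add: vec_eq_iff algebra_simps)
qed

text \<open>The class of frames that is preserved by a single simple element. The function \<open>\<phi>\<close> is
  a potential for the squares of the entries of \<open>H\<close>; it is complex-valued only to match the
  Hermitian form.\<close>

locale hermitian_frame =
  fixes \<Omega> :: "(real^'n) set" and B :: "real^'n \<Rightarrow> complex^'n^'n" and H :: "real^'n \<Rightarrow> complex^'n"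
    and \<phi> :: "real^'n \<Rightarrow> complex"
    and E :: "real^'n \<Rightarrow> complex \<Rightarrow> complex^'n^'n" and X :: "real^'n \<Rightarrow> complex \<Rightarrow> complex^'n"
  assumes open_domain: "open \<Omega>" and connected_domain: "connected \<Omega>" and zero_in: "0 \<in> \<Omega>"
    and B_herm: "\<And>u. u \<in> \<Omega> \<Longrightarrow> adj (B u) = B u"
    and B_smooth: "\<And>k. diffk k \<Omega> B" and H_smooth: "\<And>k. diffk k \<Omega> H"
    and E_der: "\<And>u \<mu>. u \<in> \<Omega> \<Longrightarrow>
      ((\<lambda>x. E x \<mu>) has_derivative (\<lambda>v. E u \<mu> ** conn (B u) \<mu> v)) (at u)"
    and X_der: "\<And>u \<mu>. u \<in> \<Omega> \<Longrightarrow>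
      ((\<lambda>x. X x \<mu>) has_derivative (\<lambda>v. E u \<mu> *v (delta v *v H u))) (at u)"
    and E_zero: "\<And>\<mu>. E 0 \<mu> = mat 1" and X_zero: "\<And>\<mu>. X 0 \<mu> = 0"
    and E_hol: "\<And>u. u \<in> \<Omega> \<Longrightarrow> holomorphic_mat (E u) UNIV"
    and X_hol: "\<And>u. u \<in> \<Omega> \<Longrightarrow> holomorphic_vec (X u) UNIV"
    and \<phi>_der: "\<And>u. u \<in> \<Omega> \<Longrightarrow> (\<phi> has_derivative (\<lambda>v. cinner (H u) (delta v *v H u))) (at u)"
begin

lemma unitary:
  assumes u: "u \<in> \<Omega>"
  shows "E u \<mu> ** adj (E u (cnj \<mu>)) = mat 1" "adj (E u (cnj \<mu>)) ** E u \<mu> = mat 1"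
proof -
  \<comment> \<open>in this order the two connection terms meet in the middle and cancel; in the other order only
    their commutator would appear\<close>
  have "((\<lambda>x. E x \<mu> ** adj (E x (cnj \<mu>))) has_derivative (\<lambda>v. 0)) (at x)" if x: "x \<in> \<Omega>" for x
  proof -
    have "((\<lambda>x. E x \<mu> ** adj (E x (cnj \<mu>))) has_derivative
      (\<lambda>v. E x \<mu> ** adj (E x (cnj \<mu>) ** conn (B x) (cnj \<mu>) v)
        + (E x \<mu> ** conn (B x) \<mu> v) ** adj (E x (cnj \<mu>)))) (at x)"
      by (intro bilin_mult lin_maps(1) E_der x)
    then show ?thesis by (simp add: adj_algebra adj_conn B_herm x mat_algebra)
  qed
  from has_derivative_zero_unique_connected[OF open_domain connected_domain this u zero_in]
  show 1: "E u \<mu> ** adj (E u (cnj \<mu>)) = mat 1"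
    by (simp add: E_zero adj_algebra)
  then show "adj (E u (cnj \<mu>)) ** E u \<mu> = mat 1" by (rule matrix_inv_unique_right)
qed

lemma matrix_inv_E: "u \<in> \<Omega> \<Longrightarrow> matrix_inv (E u \<mu>) = adj (E u (cnj \<mu>))"
  using matrix_inv_unique_right(1) unitary(1) by blast

lemma conn_smooth: "diffk k \<Omega> (\<lambda>u. conn (B u) \<mu> v)"
  unfolding conn_def
  by (intro diffk_add diffk_diff diffk_const diffk_bilinear[OF bounded_bilinear_matrix_mult] B_smooth)

lemma E_smooth: "diffk k \<Omega> (\<lambda>u. E u \<mu>)"
proof (induction k)
  case (Suc k)
  then show ?case using E_der
    by (auto intro!: exI[of _ "\<lambda>u v. E u \<mu> ** conn (B u) \<mu> v"]
        diffk_bilinear[OF bounded_bilinear_matrix_mult] conn_smooth)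
qed auto

lemma X_smooth: "diffk k \<Omega> (\<lambda>u. X u \<mu>)"
proof (cases k)
  case (Suc m)
  then show ?thesis using X_der
    by (auto intro!: exI[of _ "\<lambda>u v. E u \<mu> *v (delta v *v H u)"]
        diffk_bilinear[OF bounded_bilinear_matrix_vector_mult] diffk_const E_smooth H_smooth)
qed auto

end

locale dressed_frame = hermitian_frame \<Omega> B H \<phi> E X
  for \<Omega> :: "(real^'n) set" and B H \<phi> E X +
  fixes w :: complex and P :: "complex^'n^'n"
  assumes w: "Im w \<noteq> 0" and P: "hermitian_projection P"
begin

text \<open>The projection \<open>\<pi>'\<close> onto \<open>E(u,w)\<^sup>-\<^sup>1 (Im P)\<close>, since the
  adjoint at the conjugate point is the inverse.\<close>

definition pt :: "real^'n \<Rightarrow> complex^'n^'n" where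
  "pt u = proj_formula (adj (E u (cnj w))) P"

text \<open>The vector \<open>E\<^sup>-\<^sup>1 X\<close> at the conjugate pole.\<close>

definition \<eta> :: "real^'n \<Rightarrow> complex^'n" where
  "\<eta> u = adj (E u w) *v X u (cnj w)"

text \<open>A real number; this is why Hermitian data stay Hermitian.\<close>

definition s :: complex where "s = \<i> * (w - cnj w)"

text \<open>The right-hand side of the differential equation that \<open>\<pi>'\<close> satisfies.\<close>

definition dpt :: "real^'n \<Rightarrow> real^'n \<Rightarrow> complex^'n^'n" where
  "dpt u v = pt u ** conn (B u) (cnj w) v - conn (B u) w v ** pt u
     + smult_mat s (pt u ** delta v ** pt u)"

lemma cnj_s: "cnj s = s"
  by (simp add: s_def algebra_simps)

lemma inv_adj_E: "u \<in> \<Omega> \<Longrightarrow> invertible (adj (E u (cnj w)))"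
  using matrix_inv_unique_right(2)[OF unitary(2)] .

lemma pt_herm: "u \<in> \<Omega> \<Longrightarrow> hermitian_projection (pt u)"
  unfolding pt_def by (intro hermitian_projection_formula P inv_adj_E)

lemmas ptD = hermitian_projectionD[OF pt_herm]

lemma pt_annihilates:
  assumes "u \<in> \<Omega>"
  shows "perp (pt u) ** adj (E u (cnj w)) ** P = 0" "perp P ** E u w ** pt u = 0"
  using proj_formula_annihilates[OF P unitary(2)[OF assms, of w]] by (simp_all add: pt_def)

lemma pt_differentiable:
  assumes u: "u \<in> \<Omega>" shows "pt differentiable (at u)"
proof -
  have mult: "(\<lambda>x. f x ** g x) differentiable (at u)"
    if "f differentiable (at u)" "g differentiable (at u)" for f g :: "real^'n \<Rightarrow> complex^'n^'n"
  proof -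
    obtain f' g' where "(f has_derivative f') (at u)" "(g has_derivative g') (at u)"
      using \<open>f differentiable (at u)\<close> \<open>g differentiable (at u)\<close> unfolding differentiable_def by blast
    from bilin_mult[OF this] show ?thesis by (rule differentiableI)
  qed
  have A: "(\<lambda>x. adj (E x (cnj w))) differentiable (at u)" "(\<lambda>x. adj (adj (E x (cnj w)))) differentiable (at u)"
    using differentiableI[OF lin_maps(1)[OF E_der[OF u]]] differentiableI[OF E_der[OF u]]
    by (simp_all add: adj_algebra)
  have "(\<lambda>x. matrix_inv (gram (adj (E x (cnj w))) P)) differentiable (at u)"
  proof (rule differentiable_matrix_inv[OF _ open_domain u])
    show "(\<lambda>x. gram (adj (E x (cnj w))) P) differentiable (at u)"
      unfolding gram_def by (intro differentiable_add mult A differentiable_const)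
    show "invertible (gram (adj (E x (cnj w))) P)" if "x \<in> \<Omega>" for x
      by (intro invertible_gram P inv_adj_E that)
  qed
  then have "(\<lambda>x. proj_formula (adj (E x (cnj w))) P) differentiable (at u)"
    unfolding proj_formula_def by (intro mult A differentiable_const)
  then show ?thesis by (simp add: pt_def[abs_def])
qed

text \<open>The derivative of the incidence \<open>P\<^sup>\<bottom> E(w) \<pi>' = 0\<close> fixes the block of
  \<open>d\<pi>'\<close> from \<open>Im \<pi>'\<close> to its complement. Since \<open>d\<pi>'\<close> is
  self-adjoint the opposite block is its adjoint, and since \<open>\<pi>'\<close> stays a projection the
  diagonal blocks vanish.\<close>

lemma pt_der:
  assumes u: "u \<in> \<Omega>" shows "(pt has_derivative dpt u) (at u)"
proof -
  obtain D where D: "(pt has_derivative D) (at u)"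
    using pt_differentiable[OF u] unfolding differentiable_def by blast
  note within = has_derivative_transform_within_open[OF _ open_domain u]
  have "((\<lambda>x. pt x ** pt x) has_derivative (\<lambda>v. pt u ** D v + D v ** pt u)) (at u)"
    by (intro bilin_mult D)
  then have "(pt has_derivative (\<lambda>v. pt u ** D v + D v ** pt u)) (at u)"
    by (rule within) (simp add: ptD)
  from fun_cong[OF has_derivative_unique[OF D this]]
  have D1: "D v = pt u ** D v + D v ** pt u" for v .
  have "((\<lambda>x. adj (pt x)) has_derivative (\<lambda>v. adj (D v))) (at u)" by (intro lin_maps D)
  then have "(pt has_derivative (\<lambda>v. adj (D v))) (at u)"
    by (rule within) (simp add: ptD)
  from fun_cong[OF has_derivative_unique[OF this D]]
  have D2: "adj (D v) = D v" for v .
  have "((\<lambda>x. perp P ** E x w ** pt x) has_derivative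
      (\<lambda>v. perp P ** E u w ** D v + (perp P ** (E u w ** conn (B u) w v)) ** pt u)) (at u)"
    by (intro bilin_mult D bounded_bilinear.bounded_linear_right[OF bounded_bilinear_matrix_mult,
          THEN bounded_linear.has_derivative] E_der u)
  then have "((\<lambda>x. 0) has_derivative
      (\<lambda>v. perp P ** E u w ** D v + (perp P ** (E u w ** conn (B u) w v)) ** pt u)) (at u)"
    by (rule within) (simp add: pt_annihilates)
  from fun_cong[OF has_derivative_unique[OF this has_derivative_const]]
  have "perp P ** E u w ** D v + (perp P ** (E u w ** conn (B u) w v)) ** pt u = 0" for v .
  then have D3: "perp P ** (E u w ** (conn (B u) w v ** pt u + D v)) = 0" for v
    by (simp add: mat_algebra add.commute)
  have "D = dpt u"
  proof
    fix v
    let ?Y = "conn (B u) w v ** pt u + D v"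
    have "perp (pt u) ** ?Y = perp (pt u) ** (adj (E u (cnj w)) ** E u w) ** ?Y"
      by (simp add: unitary u)
    also have "\<dots> = (perp (pt u) ** adj (E u (cnj w)) ** P) ** (E u w ** ?Y)
        + perp (pt u) ** adj (E u (cnj w)) ** (perp P ** (E u w ** ?Y))"
      by (simp add: perp_def mat_algebra)
    also have "\<dots> = 0" unfolding D3 pt_annihilates(1)[OF u] by (simp add: mat_algebra_ring)
    finally have 1: "D v = pt u ** D v - conn (B u) w v ** pt u + pt u ** conn (B u) w v ** pt u"
      by (simp add: perp_def mat_algebra eq_iff_diff_eq_0[of "D v"] algebra_simps)
    have "adj (D v) = adj (pt u ** D v - conn (B u) w v ** pt u + pt u ** conn (B u) w v ** pt u)"
      using 1 by simp
    then have 2: "D v = D v ** pt u + pt u ** conn (B u) (cnj w) v - pt u ** conn (B u) (cnj w) v ** pt u"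
      by (simp add: adj_algebra D2 ptD u adj_conn B_herm mat_algebra)
    have "D v + D v = (pt u ** D v - conn (B u) w v ** pt u + pt u ** conn (B u) w v ** pt u)
        + (D v ** pt u + pt u ** conn (B u) (cnj w) v - pt u ** conn (B u) (cnj w) v ** pt u)"
      by (rule arg_cong2[where f = "(+)", OF 1 2])
    also have "\<dots> = (pt u ** D v + D v ** pt u) - conn (B u) w v ** pt u + pt u ** conn (B u) w v ** pt u
        + pt u ** conn (B u) (cnj w) v - pt u ** conn (B u) (cnj w) v ** pt u"
      by (simp add: algebra_simps)
    finally have "D v + D v = \<dots>" .
    then have "D v = pt u ** conn (B u) (cnj w) v - conn (B u) w v ** pt u
        + pt u ** (conn (B u) w v - conn (B u) (cnj w) v) ** pt u"
      unfolding D1[of v, symmetric] by (simp add: mat_algebra)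
    also have "conn (B u) w v - conn (B u) (cnj w) v = smult_mat s (delta v)"
      by (simp add: conn_def s_def vec_eq_iff algebra_simps)
    finally show "D v = dpt u v" by (simp add: dpt_def mat_algebra)
  qed
  then show ?thesis using D by simp
qed

lemma \<eta>_der:
  assumes u: "u \<in> \<Omega>"
  shows "(\<eta> has_derivative (\<lambda>v. delta v *v H u - conn (B u) (cnj w) v *v \<eta> u)) (at u)"
proof -
  have "((\<lambda>x. adj (E x w) *v X x (cnj w)) has_derivative
      (\<lambda>v. adj (E u w) *v (E u (cnj w) *v (delta v *v H u))
        + adj (E u w ** conn (B u) w v) *v X u (cnj w))) (at u)"
    by (intro bilin_vec lin_maps E_der X_der u)
  moreover have "adj (E u w) *v (E u (cnj w) *v y) = y" for y
    using unitary(2)[OF u, of "cnj w"] by (simp add: matrix_vector_mul_assoc)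
  ultimately show ?thesis
    by (simp add: \<eta>_def[abs_def] adj_algebra adj_conn B_herm u mat_algebra)
qed

lemma pt_smooth: "diffk k \<Omega> pt"
proof (induction k)
  case (Suc k)
  have "diffk k \<Omega> (\<lambda>u. dpt u v)" for v
    unfolding dpt_def
    by (intro diffk_add diffk_diff diffk_bounded_linear[OF bounded_linear_finite_dim_maps(4)]
        diffk_bilinear[OF bounded_bilinear_matrix_mult] diffk_const conn_smooth Suc)
  then show ?case using pt_der by auto
qed auto

lemma \<eta>_smooth: "diffk k \<Omega> \<eta>"
  unfolding \<eta>_def[abs_def]
  by (intro diffk_bilinear[OF bounded_bilinear_matrix_vector_mult] X_smooth
      diffk_bounded_linear[OF bounded_linear_finite_dim_maps(1)] E_smooth)

definition B' :: "real^'n \<Rightarrow> complex^'n^'n" where "B' u = B u + smult_mat s (pt u)"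
definition H' :: "real^'n \<Rightarrow> complex^'n" where "H' u = H u + s *s (pt u *v \<eta> u)"
text \<open>The explicit potential of the dressed metric: the derivative of the quadratic form in
  \<open>\<eta>\<close> produces exactly the cross terms of the new vector \<open>H'\<close>.\<close>

definition \<phi>' :: "real^'n \<Rightarrow> complex" where "\<phi>' u = \<phi> u + s * cinner (\<eta> u) (pt u *v \<eta> u)"

lemma B'_smooth: "diffk k \<Omega> B'"
  unfolding B'_def[abs_def]
  by (intro diffk_add B_smooth diffk_bounded_linear[OF bounded_linear_finite_dim_maps(4)] pt_smooth)

lemma H'_smooth: "diffk k \<Omega> H'"
  unfolding H'_def[abs_def]
  by (intro diffk_add H_smooth diffk_bounded_linear[OF bounded_linear_finite_dim_maps(5)]
      diffk_bilinear[OF bounded_bilinear_matrix_vector_mult] pt_smooth \<eta>_smooth)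

lemma B'_herm: "u \<in> \<Omega> \<Longrightarrow> adj (B' u) = B' u"
  by (simp add: B'_def adj_algebra B_herm ptD cnj_s)

lemma \<phi>'_der:
  assumes u: "u \<in> \<Omega>"
  shows "(\<phi>' has_derivative (\<lambda>v. cinner (H' u) (delta v *v H' u))) (at u)"
proof -
  let ?d = "\<lambda>v. delta v *v H u - conn (B u) (cnj w) v *v \<eta> u"
  have D: "(\<phi>' has_derivative (\<lambda>v. cinner (H u) (delta v *v H u)
      + s * (cinner (\<eta> u) (pt u *v ?d v + dpt u v *v \<eta> u) + cinner (?d v) (pt u *v \<eta> u)))) (at u)"
    unfolding \<phi>'_def[abs_def]
    by (intro has_derivative_add \<phi>_der u has_derivative_mult_right bilin_inner bilin_vec \<eta>_der pt_der)
  have eq: "cinner (H u) (delta v *v H u)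
      + s * (cinner (\<eta> u) (pt u *v ?d v + dpt u v *v \<eta> u) + cinner (?d v) (pt u *v \<eta> u))
      = cinner (H' u) (delta v *v H' u)" for v
  proof -
    have 1: "cinner (conn (B u) (cnj w) v *v \<eta> u) x = - cinner (\<eta> u) (conn (B u) w v *v x)" for x
      using cinner_adj[of "\<eta> u" "conn (B u) w v" x]
      by (simp add: adj_conn B_herm u mat_algebra cinner_algebra)
    have 2: "cinner (delta v *v x) y = cinner x (delta v *v y)" for x y
      by (simp add: cinner_adj adj_algebra)
    have 3: "cinner (pt u *v x) y = cinner x (pt u *v y)" for x y
      by (simp add: cinner_adj ptD u)
    show ?thesis
      by (simp add: H'_def dpt_def mat_algebra cinner_algebra 1 2 3 cnj_s ptD u)
         (simp add: algebra_simps)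
  qed
  show ?thesis using D by (simp only: eq)
qed

lemma dressed_E_der:
  assumes u: "u \<in> \<Omega>" and \<mu>: "\<mu> \<noteq> w" "\<mu> \<noteq> cnj w"
  shows "((\<lambda>x. simple_element w P \<mu> ** E x \<mu> ** simple_element (cnj w) (pt x) \<mu>) has_derivative
    (\<lambda>v. (simple_element w P \<mu> ** E u \<mu> ** simple_element (cnj w) (pt u) \<mu>) ** conn (B' u) \<mu> v)) (at u)"
proof -
  define e where "e = 1 - (\<mu> - w) / (\<mu> - cnj w)"
  have k: "simple_element (cnj w) (pt x) \<mu> = pt x + smult_mat (1 - e) (mat 1 - pt x)" for x
    by (simp add: simple_element_def e_def perp_def)
  have we: "w = cnj w + e * (\<mu> - cnj w)" using pole_ratio(1)[OF \<mu>(2)] by (simp add: e_def)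
  have "((\<lambda>x. pt x + smult_mat (1 - e) (mat 1 - pt x)) has_derivative
      (\<lambda>v. dpt u v + smult_mat (1 - e) (0 - dpt u v))) (at u)"
    by (intro has_derivative_add has_derivative_diff has_derivative_const lin_maps pt_der u)
  moreover have "dpt u v + smult_mat (1 - e) (0 - dpt u v) = smult_mat e (dpt u v)" for v
    by (simp add: vec_eq_iff algebra_simps)
  ultimately have dk: "((\<lambda>x. simple_element (cnj w) (pt x) \<mu>) has_derivative
      (\<lambda>v. smult_mat e (dpt u v))) (at u)" unfolding k by simp
  have D: "((\<lambda>x. simple_element w P \<mu> ** E x \<mu> ** simple_element (cnj w) (pt x) \<mu>) has_derivative
    (\<lambda>v. (simple_element w P \<mu> ** E u \<mu>) ** smult_mat e (dpt u v)
      + (simple_element w P \<mu> ** (E u \<mu> ** conn (B u) \<mu> v)) ** simple_element (cnj w) (pt u) \<mu>)) (at u)"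
    by (intro bilin_mult dk bounded_bilinear.bounded_linear_right[OF bounded_bilinear_matrix_mult,
          THEN bounded_linear.has_derivative] E_der u)
  have "conn (B u) \<mu> v ** simple_element (cnj w) (pt u) \<mu> + smult_mat e (dpt u v)
      = simple_element (cnj w) (pt u) \<mu> ** conn (B' u) \<mu> v" for v
    using intertwine_matrix[OF ptD(1)[OF u] we s_def, of "delta v" "B u"]
    unfolding k dpt_def B'_def conn_def .
  then have eq: "(simple_element w P \<mu> ** E u \<mu>) ** smult_mat e (dpt u v)
      + (simple_element w P \<mu> ** (E u \<mu> ** conn (B u) \<mu> v)) ** simple_element (cnj w) (pt u) \<mu>
      = (simple_element w P \<mu> ** E u \<mu> ** simple_element (cnj w) (pt u) \<mu>) ** conn (B' u) \<mu> v" for v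
    unfolding mat_mul_assoc_right
    by (metis (no_types, lifting) add.commute mat_algebra_ring(1))
  show ?thesis using D by (simp only: eq)
qed

text \<open>The factor in front is a scalar multiple of the simple element in front of \<open>E\<close>; moving that
  scalar inside is what makes the vector identity applicable.\<close>

lemma dressed_X_der:
  assumes u: "u \<in> \<Omega>" and \<mu>: "\<mu> \<noteq> w" "\<mu> \<noteq> cnj w"
  shows "((\<lambda>x. simple_element (cnj w) (perp P) \<mu> *v
      (X x \<mu> - ((cnj w - w) / (\<mu> - w)) *s (E x \<mu> *v (pt x *v \<eta> x)))) has_derivative
    (\<lambda>v. (simple_element w P \<mu> ** E u \<mu> ** simple_element (cnj w) (pt u) \<mu>) *v (delta v *v H' u))) (at u)"
proof -
  define e where "e = 1 - (\<mu> - w) / (\<mu> - cnj w)"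
  define \<kappa> where "\<kappa> = (cnj w - w) / (\<mu> - w)"
  define q where "q = simple_element (cnj w) (perp P) \<mu>"
  have k: "simple_element (cnj w) (pt x) \<mu> = pt x + smult_mat (1 - e) (mat 1 - pt x)" for x
    by (simp add: simple_element_def e_def perp_def)
  have we: "w = cnj w + e * (\<mu> - cnj w)" using pole_ratio(1)[OF \<mu>(2)] by (simp add: e_def)
  have "smult_mat ((\<mu> - cnj w) / (\<mu> - w)) q = simple_element w P \<mu>"
    unfolding q_def using simple_element_perp \<mu> by blast
  then have "smult_mat ((\<mu> - w) / (\<mu> - cnj w)) (smult_mat ((\<mu> - cnj w) / (\<mu> - w)) q)
      = smult_mat ((\<mu> - w) / (\<mu> - cnj w)) (simple_element w P \<mu>)" by simp
  then have q: "q = smult_mat (1 - e) (simple_element w P \<mu>)"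
    using \<mu> by (simp add: smult_mat_algebra e_def)
  have e\<kappa>: "(1 - e) * \<kappa> = - e" using pole_ratio(2)[OF \<mu>] by (simp add: e_def \<kappa>_def)
  let ?d = "\<lambda>v. delta v *v H u - conn (B u) (cnj w) v *v \<eta> u"
  let ?Y = "\<lambda>v. conn (B u) \<mu> v *v (pt u *v \<eta> u) + (dpt u v *v \<eta> u + pt u *v ?d v)"
  have D: "((\<lambda>x. q *v (X x \<mu> - \<kappa> *s (E x \<mu> *v (pt x *v \<eta> x)))) has_derivative
    (\<lambda>v. q *v (E u \<mu> *v (delta v *v H u) - \<kappa> *s (E u \<mu> *v (pt u *v ?d v + dpt u v *v \<eta> u)
       + (E u \<mu> ** conn (B u) \<mu> v) *v (pt u *v \<eta> u))))) (at u)"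
    by (intro bilin_vec \<eta>_der pt_der E_der X_der u lin_maps has_derivative_diff
        bounded_bilinear.bounded_linear_right[OF bounded_bilinear_matrix_vector_mult,
          THEN bounded_linear.has_derivative])
  have eq: "q *v (E u \<mu> *v (delta v *v H u) - \<kappa> *s (E u \<mu> *v (pt u *v ?d v + dpt u v *v \<eta> u)
       + (E u \<mu> ** conn (B u) \<mu> v) *v (pt u *v \<eta> u)))
      = (simple_element w P \<mu> ** E u \<mu> ** simple_element (cnj w) (pt u) \<mu>) *v (delta v *v H' u)" for v
  proof -
    have "q *v (E u \<mu> *v (delta v *v H u) - \<kappa> *s (E u \<mu> *v (pt u *v ?d v + dpt u v *v \<eta> u)
       + (E u \<mu> ** conn (B u) \<mu> v) *v (pt u *v \<eta> u)))
      = q *v (E u \<mu> *v (delta v *v H u - \<kappa> *s ?Y v))"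
      by (simp add: mat_algebra algebra_simps)
    also have "\<dots> = simple_element w P \<mu> *v (E u \<mu> *v ((1 - e) *s (delta v *v H u - \<kappa> *s ?Y v)))"
      unfolding q by (simp only: mat_algebra_ring(19,20))
    also have "(1 - e) *s (delta v *v H u - \<kappa> *s ?Y v) = (1 - e) *s (delta v *v H u) - ((1 - e) * \<kappa>) *s ?Y v"
      by (simp only: vector_ssub_ldistrib vector_smult_assoc)
    also have "\<dots> = (1 - e) *s (delta v *v H u) + e *s ?Y v"
      unfolding e\<kappa> by (simp add: vec_eq_iff)
    also have "\<dots> = simple_element (cnj w) (pt u) \<mu> *v (delta v *v H' u)"
      using intertwine_vector[OF ptD(1)[OF u] we s_def, of "delta v" "H u" "B u" "\<eta> u"]
      unfolding k dpt_def H'_def conn_def .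
    finally show ?thesis by (simp only: mat_vec_assoc_right)
  qed
  show ?thesis using D[unfolded eq] unfolding q_def \<kappa>_def .
qed

end

subsection \<open>The derivative at the poles\<close>

definition upper_left :: "complex^('n + 1)^('n + 1) \<Rightarrow> complex^'n^'n" where
  "upper_left M = (\<chi> i j. M $ Inl i $ Inl j)"

definition upper_right :: "complex^('n + 1)^('n + 1) \<Rightarrow> complex^'n" where
  "upper_right M = (\<chi> i. M $ Inl i $ Inr 1)"

lemma upper_block [simp]:
  "upper_left (block A b d) = A" "upper_right (block A b d) = b"
  by (simp_all add: upper_left_def upper_right_def vec_eq_iff)

lemma bounded_linear_upper:
  "bounded_linear (upper_left :: complex^('n::finite + 1)^('n + 1) \<Rightarrow> _)"
  "bounded_linear (upper_right :: complex^('n::finite + 1)^('n + 1) \<Rightarrow> _)"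
  unfolding linear_conv_bounded_linear[symmetric]
  by (auto intro!: linearI simp: vec_eq_iff upper_left_def upper_right_def)

text \<open>The full connection form on affine frames.\<close>

definition block_conn ::
  "complex^'n^'n \<Rightarrow> complex^'n \<Rightarrow> complex \<Rightarrow> real^'n \<Rightarrow> complex^('n + 1)^('n + 1)" where
  "block_conn B H \<mu> v = block (conn B \<mu> v) (delta v *v H) 0"

lemma has_derivative_block_iff:
  fixes E :: "real^'n \<Rightarrow> complex^'n^'n" and X :: "real^'n \<Rightarrow> complex^'n"
  shows "((\<lambda>x. block (E x) (X x) 1) has_derivative (\<lambda>v. block (E u) (X u) 1 ** block_conn B H \<mu> v)) (at u)
    \<longleftrightarrow> (E has_derivative (\<lambda>v. E u ** conn B \<mu> v)) (at u) \<and>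
        (X has_derivative (\<lambda>v. E u *v (delta v *v H))) (at u)"
proof -
  have b: "block (E u) (X u) 1 ** block_conn B H \<mu> v = block (E u ** conn B \<mu> v) (E u *v (delta v *v H)) 0" for v
    by (simp add: block_conn_def block_mult)
  show ?thesis unfolding b
  proof (intro iffI conjI)
    assume "((\<lambda>x. block (E x) (X x) 1) has_derivative
      (\<lambda>v. block (E u ** conn B \<mu> v) (E u *v (delta v *v H)) 0)) (at u)"
    from bounded_linear_upper[THEN bounded_linear.has_derivative, OF this]
    show "(E has_derivative (\<lambda>v. E u ** conn B \<mu> v)) (at u)"
      "(X has_derivative (\<lambda>v. E u *v (delta v *v H))) (at u)" by simp_all
  next
    assume "(E has_derivative (\<lambda>v. E u ** conn B \<mu> v)) (at u) \<and>
        (X has_derivative (\<lambda>v. E u *v (delta v *v H))) (at u)"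
    then have "((\<lambda>x. (E x, X x, 1)) has_derivative (\<lambda>v. (E u ** conn B \<mu> v, E u *v (delta v *v H), 0))) (at u)"
      by (intro has_derivative_Pair has_derivative_const) auto
    from bounded_linear.has_derivative[OF bounded_linear_block this]
    show "((\<lambda>x. block (E x) (X x) 1) has_derivative
      (\<lambda>v. block (E u ** conn B \<mu> v) (E u *v (delta v *v H)) 0)) (at u)" by simp
  qed
qed

lemma block_conn_lipschitz:
  obtains L where "L \<ge> 0" "\<And>(B :: complex^'n^'n) H \<mu> \<nu> v.
    norm (block_conn B H \<mu> v - block_conn B H \<nu> v) \<le> L * norm (\<mu> - \<nu>) * norm v"
proof -
  have "bounded_bilinear (\<lambda>(a::complex) (v::real^'n). block (smult_mat (\<i> * a) (delta v)) 0 0)"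
    unfolding bilinear_conv_bounded_bilinear[symmetric] bilinear_def
    by (auto intro!: linearI simp: vec_eq_iff all_plus_one algebra_simps)
       (simp_all add: scaleR_conv_of_real)
  then obtain L where L: "L \<ge> 0"
    "\<And>a (v::real^'n). norm (block (smult_mat (\<i> * a) (delta v)) 0 0 :: complex^('n + 1)^('n + 1))
        \<le> norm a * norm v * L"
    using bounded_bilinear.nonneg_bounded by blast
  have "norm (block_conn B H \<mu> v - block_conn B H \<nu> v) \<le> L * norm (\<mu> - \<nu>) * norm v"
    for B :: "complex^'n^'n" and H \<mu> \<nu> v
  proof -
    have "conn B \<mu> v - conn B \<nu> v = smult_mat (\<i> * (\<mu> - \<nu>)) (delta v)"
      by (simp add: conn_def vec_eq_iff algebra_simps)
    then have "block_conn B H \<mu> v - block_conn B H \<nu> v = block (smult_mat (\<i> * (\<mu> - \<nu>)) (delta v)) 0 0"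
      by (simp add: block_conn_def block_diff)
    then have "norm (block_conn B H \<mu> v - block_conn B H \<nu> v) \<le> norm (\<mu> - \<nu>) * norm v * L"
      using L(2) by metis
    also have "\<dots> = L * norm (\<mu> - \<nu>) * norm v" by simp
    finally show ?thesis .
  qed
  then show thesis using L(1) that by blast
qed

text \<open>The connection is linear in the tangent vector, so a bound on the finitely many coordinate directions
  suffices.\<close>

lemma block_conn_bounded:
  fixes B :: "real^'n \<Rightarrow> complex^'n^'n"
  assumes S: "compact S" and B: "continuous_on S B" and H: "continuous_on S H"
  shows "\<exists>K. \<forall>x\<in>S. \<forall>v. norm (block_conn (B x) (H x) 0 v) \<le> K * norm v"
proof -
  have lin: "linear (block_conn B H 0)" for B :: "complex^'n^'n" and H
  proof -
    have d: "delta (x + y) = delta x + delta y" "delta (r *\<^sub>R x) = smult_mat (of_real r) (delta x)"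
      for r and x y :: "real^'n" by (auto simp: vec_eq_iff)
    show ?thesis unfolding block_conn_def conn_def
      by (intro linearI; simp add: d mat_algebra_ring smult_mat_algebra)
         (simp_all add: vec_eq_iff all_plus_one algebra_simps scaleR_conv_of_real[where 'a = complex])
  qed
  have "\<exists>K. \<forall>x\<in>S. norm (block_conn (B x) (H x) 0 (axis j 1)) \<le> K" for j
  proof -
    have "continuous_on S (\<lambda>x. block_conn (B x) (H x) 0 (axis j 1))"
    proof -
      have "continuous_on S (\<lambda>x. (conn (B x) 0 (axis j 1), delta (axis j 1) *v H x, 0 :: complex))"
        unfolding conn_def
        by (intro continuous_intros B H
            bounded_bilinear.continuous_on[OF bounded_bilinear_matrix_mult]
            bounded_bilinear.continuous_on[OF bounded_bilinear_matrix_vector_mult])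
      from bounded_linear.continuous_on[OF bounded_linear_block this]
      show ?thesis by (simp add: block_conn_def)
    qed
    then have "bounded ((\<lambda>x. block_conn (B x) (H x) 0 (axis j 1)) ` S)"
      using S compact_continuous_image compact_imp_bounded by blast
    then show ?thesis by (auto simp: bounded_iff)
  qed
  then obtain K where K: "\<And>j x. x \<in> S \<Longrightarrow> norm (block_conn (B x) (H x) 0 (axis j 1)) \<le> K j"
    by metis
  have "norm (block_conn (B x) (H x) 0 v) \<le> (\<Sum>j\<in>UNIV. K j) * norm v" if x: "x \<in> S" for x v
  proof -
    have "v = (\<Sum>j\<in>UNIV. v $ j *\<^sub>R axis j 1)"
      by (simp add: vec_eq_iff axis_def if_distrib cong: if_cong)
    then have "block_conn (B x) (H x) 0 v = block_conn (B x) (H x) 0 (\<Sum>j\<in>UNIV. v $ j *\<^sub>R axis j 1)"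
      by simp
    also have "\<dots> = (\<Sum>j\<in>UNIV. v $ j *\<^sub>R block_conn (B x) (H x) 0 (axis j 1))"
      by (simp add: linear_sum[OF lin] linear_cmul[OF lin])
    finally have eq: "block_conn (B x) (H x) 0 v
      = (\<Sum>j\<in>UNIV. v $ j *\<^sub>R block_conn (B x) (H x) 0 (axis j 1))" .
    have "norm (block_conn (B x) (H x) 0 v) \<le> (\<Sum>j\<in>UNIV. norm (v $ j *\<^sub>R block_conn (B x) (H x) 0 (axis j 1)))"
      unfolding eq by (rule norm_sum)
    also have "\<dots> \<le> (\<Sum>j\<in>UNIV. norm v * K j)"
      using component_le_norm_cart[of v] K[OF x] by (intro sum_mono) (auto intro!: mult_mono)
    finally show ?thesis by (simp add: sum_distrib_left sum_distrib_right mult.commute)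
  qed
  then show ?thesis by blast
qed

context dressed_frame
begin

text \<open>The Hermitian frames are closed under the action of a simple element, with explicit new data, and off
  the poles the new frame is given by a formula. At the poles the new frame is a value of an analytic
  continuation, and its derivative in \<open>u\<close> is a limit of derivatives from nearby parameters.\<close>

lemma dressed_frame_exists:
  "\<exists>E' X'. hermitian_frame \<Omega> B' H' \<phi>' E' X' \<and>
    (\<forall>u\<in>\<Omega>. is_dressing (simple_element_ext w P) (\<lambda>\<mu>. block (E u \<mu>) (X u \<mu>) 1)
      (\<lambda>\<mu>. block (E' u \<mu>) (X' u \<mu>) 1)) \<and>
    (\<forall>u\<in>\<Omega>. \<forall>\<mu>. \<mu> \<notin> {w, cnj w} \<longrightarrow>
        E' u \<mu> = simple_element w P \<mu> ** E u \<mu> ** simple_element (cnj w) (pt u) \<mu> \<and>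
        X' u \<mu> = simple_element (cnj w) (perp P) \<mu> *v
          (X u \<mu> - ((cnj w - w) / (\<mu> - w)) *s (E u \<mu> *v (pt u *v \<eta> u))))"
proof -
  have "\<forall>u\<in>\<Omega>. \<exists>Y. is_dressing (simple_element_ext w P) (\<lambda>\<mu>. block (E u \<mu>) (X u \<mu>) 1)
        (\<lambda>\<mu>. block (fst Y \<mu>) (snd Y \<mu>) 1) \<and>
      holomorphic_mat (fst Y) UNIV \<and> holomorphic_vec (snd Y) UNIV \<and>
      (\<forall>\<mu>. \<mu> \<notin> {w, cnj w} \<longrightarrow>
        fst Y \<mu> = simple_element w P \<mu> ** E u \<mu> ** simple_element (cnj w) (pt u) \<mu> \<and>
        snd Y \<mu> = simple_element (cnj w) (perp P) \<mu> *v
          (X u \<mu> - ((cnj w - w) / (\<mu> - w)) *s (E u \<mu> *v (pt u *v \<eta> u))))"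
    (is "\<forall>u\<in>\<Omega>. ?Q u")
  proof
    fix u assume u: "u \<in> \<Omega>"
    obtain E' X' where "is_dressing (simple_element_ext w P) (\<lambda>\<mu>. block (E u \<mu>) (X u \<mu>) 1)
        (\<lambda>\<mu>. block (E' \<mu>) (X' \<mu>) 1)" "holomorphic_mat E' UNIV" "holomorphic_vec X' UNIV"
      "\<And>\<mu>. \<mu> \<notin> {w, cnj w} \<Longrightarrow>
        E' \<mu> = simple_element w P \<mu> ** E u \<mu> ** simple_element (cnj w) (pt u) \<mu> \<and>
        X' \<mu> = simple_element (cnj w) (perp P) \<mu> *v
          (X u \<mu> - ((cnj w - w) / (\<mu> - w)) *s (E u \<mu> *v (pt u *v \<eta> u)))"
      using simple_element_dressing[OF P w E_hol[OF u] X_hol[OF u] unitary(2)[OF u] pt_def \<eta>_def]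
      by blast
    then show "?Q u" by (intro exI[of _ "(E', X')"]) simp
  qed
  from bchoice[OF this] obtain Y where Y: "\<And>u. u \<in> \<Omega> \<Longrightarrow> is_dressing (simple_element_ext w P) (\<lambda>\<mu>. block (E u \<mu>) (X u \<mu>) 1)
        (\<lambda>\<mu>. block (fst (Y u) \<mu>) (snd (Y u) \<mu>) 1) \<and>
      holomorphic_mat (fst (Y u)) UNIV \<and> holomorphic_vec (snd (Y u)) UNIV \<and>
      (\<forall>\<mu>. \<mu> \<notin> {w, cnj w} \<longrightarrow>
        fst (Y u) \<mu> = simple_element w P \<mu> ** E u \<mu> ** simple_element (cnj w) (pt u) \<mu> \<and>
        snd (Y u) \<mu> = simple_element (cnj w) (perp P) \<mu> *v
          (X u \<mu> - ((cnj w - w) / (\<mu> - w)) *s (E u \<mu> *v (pt u *v \<eta> u))))"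
    by blast
  define E' where "E' = (\<lambda>u. fst (Y u))"
  define X' where "X' = (\<lambda>u. snd (Y u))"
  have dr: "is_dressing (simple_element_ext w P) (\<lambda>\<mu>. block (E u \<mu>) (X u \<mu>) 1)
        (\<lambda>\<mu>. block (E' u \<mu>) (X' u \<mu>) 1)"
    and hol: "holomorphic_mat (E' u) UNIV" "holomorphic_vec (X' u) UNIV"
    and E'_off: "\<mu> \<notin> {w, cnj w} \<Longrightarrow>
        E' u \<mu> = simple_element w P \<mu> ** E u \<mu> ** simple_element (cnj w) (pt u) \<mu>"
    and X'_off: "\<mu> \<notin> {w, cnj w} \<Longrightarrow> X' u \<mu> = simple_element (cnj w) (perp P) \<mu> *v
          (X u \<mu> - ((cnj w - w) / (\<mu> - w)) *s (E u \<mu> *v (pt u *v \<eta> u)))"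
    if "u \<in> \<Omega>" for u \<mu>
    using Y[OF that] by (auto simp: E'_def X'_def)
  define G where "G = (\<lambda>u \<mu>. block (E' u \<mu>) (X' u \<mu>) 1)"
  have G_off: "((\<lambda>x. G x \<mu>) has_derivative (\<lambda>v. G u \<mu> ** block_conn (B' u) (H' u) \<mu> v)) (at u)"
    if u: "u \<in> \<Omega>" and m: "\<mu> \<notin> {w, cnj w}" for u \<mu>
    unfolding G_def
  proof (rule has_derivative_block_iff[of "\<lambda>x. E' x \<mu>" "\<lambda>x. X' x \<mu>" u "B' u" "H' u" \<mu>, THEN iffD2], rule conjI)
    have m': "\<mu> \<noteq> w" "\<mu> \<noteq> cnj w" using m by auto
    show "((\<lambda>x. E' x \<mu>) has_derivative (\<lambda>v. E' u \<mu> ** conn (B' u) \<mu> v)) (at u)"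
      unfolding E'_off[OF u m]
      by (rule has_derivative_transform_within_open[OF dressed_E_der[OF u m'] open_domain u])
         (simp add: E'_off[OF _ m])
    show "((\<lambda>x. X' x \<mu>) has_derivative (\<lambda>v. E' u \<mu> *v (delta v *v H' u))) (at u)"
      unfolding E'_off[OF u m]
      by (rule has_derivative_transform_within_open[OF dressed_X_der[OF u m'] open_domain u])
         (simp add: X'_off[OF _ m])
  qed
  obtain L where L: "L \<ge> 0" "\<And>(B :: complex^'n^'n) H \<mu> \<nu> v.
      norm (block_conn B H \<mu> v - block_conn B H \<nu> v) \<le> L * norm (\<mu> - \<nu>) * norm v"
    using block_conn_lipschitz by blast
  have G_der: "((\<lambda>x. G x \<mu>0) has_derivative (\<lambda>v. G u \<mu>0 ** block_conn (B' u) (H' u) \<mu>0 v)) (at u)"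
    if u: "u \<in> \<Omega>" for u \<mu>0
  proof (cases "\<mu>0 \<in> {w, cnj w}")
    case False then show ?thesis using G_off u by blast
  next
    case True
    \<comment> \<open>within this distance of one pole the other pole is not met\<close>
    define \<rho> where "\<rho> = cmod (w - cnj w)"
    have "w \<noteq> cnj w" using w by (auto simp: complex_eq_iff)
    then have \<rho>: "\<rho> > 0" by (simp add: \<rho>_def)
    show ?thesis
    proof (rule frame_derivative_at_puncture[OF \<rho> u L(1), where T = "\<lambda>u. block_conn (B' u) (H' u)"])
      fix x \<mu> assume x: "x \<in> \<Omega>" and "\<mu> \<noteq> \<mu>0" "norm (\<mu> - \<mu>0) < \<rho>"
      then have "\<mu> \<notin> {w, cnj w}" using True by (auto simp: \<rho>_def norm_minus_commute)
      then show "((\<lambda>x. G x \<mu>) has_derivative (\<lambda>v. G x \<mu> ** block_conn (B' x) (H' x) \<mu> v)) (at x)"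
        using G_off x by blast
    next
      fix x assume x: "x \<in> \<Omega>"
      have cont: "f \<midarrow>\<mu>0\<rightarrow> f \<mu>0" if "f holomorphic_on UNIV" for f
        using that holomorphic_on_imp_continuous_on continuous_on_eq_continuous_at isCont_def by blast
      have "(\<lambda>\<mu>. E' x \<mu> $ i $ j) \<midarrow>\<mu>0\<rightarrow> E' x \<mu>0 $ i $ j" for i j
        using hol(1)[OF x] by (intro cont[of "\<lambda>\<mu>. E' x \<mu> $ i $ j"]) (simp add: holomorphic_mat_def)
      moreover have "(\<lambda>\<mu>. X' x \<mu> $ i) \<midarrow>\<mu>0\<rightarrow> X' x \<mu>0 $ i" for i
        using hol(2)[OF x] by (intro cont[of "\<lambda>\<mu>. X' x \<mu> $ i"]) (simp add: holomorphic_vec_def)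
      ultimately have "\<forall>p q. (\<lambda>\<mu>. G x \<mu> $ p $ q) \<midarrow>\<mu>0\<rightarrow> G x \<mu>0 $ p $ q"
        by (simp add: all_plus_one G_def)
      then show "G x \<midarrow>\<mu>0\<rightarrow> G x \<mu>0" by (intro vec_tendstoI) auto
    next
      obtain r where r: "r > 0" "cball u r \<subseteq> \<Omega>"
        using open_domain u open_contains_cball by blast
      have cont: "continuous_on (cball u r) B'" "continuous_on (cball u r) H'"
        using B'_smooth[of 1] H'_smooth[of 1] r(2)
        by (auto intro!: continuous_at_imp_continuous_on dest!: bspec has_derivative_continuous)
      obtain K where K: "\<And>x v. x \<in> cball u r \<Longrightarrow> norm (block_conn (B' x) (H' x) 0 v) \<le> K * norm v"
        using block_conn_bounded[OF compact_cball cont] by blast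
      have "norm (block_conn (B' x) (H' x) \<mu> v) \<le> (K + L * (cmod \<mu>0 + \<rho>)) * norm v"
        if x: "x \<in> cball u r" and m: "norm (\<mu> - \<mu>0) < \<rho>" for x \<mu> v
      proof -
        have "cmod \<mu> \<le> cmod \<mu>0 + \<rho>" using m norm_triangle_sub[of \<mu> \<mu>0] by linarith
        then have "L * cmod \<mu> * norm v \<le> L * (cmod \<mu>0 + \<rho>) * norm v"
          using L(1) by (intro mult_right_mono mult_left_mono) auto
        moreover have "norm (block_conn (B' x) (H' x) \<mu> v)
            \<le> norm (block_conn (B' x) (H' x) 0 v) + L * cmod \<mu> * norm v"
          using L(2)[of "B' x" "H' x" \<mu> v 0]
            norm_triangle_sub[of "block_conn (B' x) (H' x) \<mu> v" "block_conn (B' x) (H' x) 0 v"]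
          by simp
        ultimately show ?thesis using K[OF x, of v] by (simp add: algebra_simps)
      qed
      then show "\<exists>r>0. \<exists>K. cball u r \<subseteq> \<Omega> \<and> (\<forall>x\<in>cball u r. \<forall>\<mu> v. norm (\<mu> - \<mu>0) < \<rho> \<longrightarrow>
          norm (block_conn (B' x) (H' x) \<mu> v) \<le> K * norm v)"
        using r by blast
    qed (rule L(2))
  qed
  have w0: "w \<noteq> 0" using w by auto
  have g: "simple_element_ext w P \<in> loops_minus (1 / cmod w)"
    unfolding simple_element_ext_factor by (rule dressing_factor_loops_minus[OF P w0 order_refl])
  \<comment> \<open>the initial condition: the identity is fixed by every dressing, and the factorisation is unique\<close>
  have "is_dressing (simple_element_ext w P) (\<lambda>_. mat 1) (\<lambda>_. mat 1)"
    by (rule is_dressing_one[OF g]) (use w0 in auto)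
  moreover have "is_dressing (simple_element_ext w P) (\<lambda>_. mat 1) (\<lambda>\<mu>. block (E' 0 \<mu>) (X' 0 \<mu>) 1)"
    using dr[OF zero_in] by (simp add: E_zero X_zero block_one)
  ultimately have "(\<lambda>\<mu>. block (E' 0 \<mu>) (X' 0 \<mu>) 1) = (\<lambda>_. mat 1)"
    using is_dressing_unique by blast
  then have init: "E' 0 \<mu> = mat 1" "X' 0 \<mu> = 0" for \<mu>
    by (metis block_eq_iff block_one)+
  have der: "((\<lambda>x. E' x \<mu>) has_derivative (\<lambda>v. E' u \<mu> ** conn (B' u) \<mu> v)) (at u)"
    "((\<lambda>x. X' x \<mu>) has_derivative (\<lambda>v. E' u \<mu> *v (delta v *v H' u))) (at u)"
    if "u \<in> \<Omega>" for u \<mu>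
    using G_der[OF that, of \<mu>]
      has_derivative_block_iff[of "\<lambda>x. E' x \<mu>" "\<lambda>x. X' x \<mu>" u "B' u" "H' u" \<mu>]
    by (simp_all add: G_def)
  have "hermitian_frame \<Omega> B' H' \<phi>' E' X'"
    using der hol init B'_herm B'_smooth H'_smooth \<phi>'_der open_domain connected_domain zero_in
    by unfold_locales
  then show ?thesis using dr E'_off X'_off by blast
qed

end

section \<open>Reality of the frame\<close>

lemma delta_mult_nth:
  "(delta v ** M) $ a $ b = of_real (v $ a) * M $ a $ b"
  "(M ** delta v) $ a $ b = M $ a $ b * of_real (v $ b)"
  by (simp_all add: matrix_matrix_mult_def if_distrib if_distribR cong: if_cong)

lemma diagonal_mult_nth:
  fixes M :: "real^'n^'n"
  shows "((\<chi> a b. if a = b then d a else 0) ** M) $ i $ j = d i * M $ i $ j"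
  by (simp add: matrix_matrix_mult_def if_distrib if_distribR cong: if_cong)

lemma conn_zero_nth: "conn B 0 v $ a $ b = of_real (v $ a - v $ b) * B $ a $ b"
  by (simp add: conn_def delta_mult_nth algebra_simps)

lemma delta_vec_nth: "(delta v *v x) $ i = of_real (v $ i) * x $ i"
  by (simp add: matrix_vector_mult_def if_distrib if_distribR cong: if_cong)

lemma conj_conn: "conj_mat (conn B (- cnj \<mu>) v) = conn (conj_mat B) \<mu> v"
  by (simp add: conn_def conj_mat_algebra)

context hermitian_frame
begin

lemma E_cancel:
  assumes u: "u \<in> \<Omega>"
  shows "E u \<mu> ** M = E u \<mu> ** N \<Longrightarrow> M = N" "E u \<mu> *v x = E u \<mu> *v y \<Longrightarrow> x = y"
  using unitary(2)[OF u, of \<mu>] by (metis matrix_mul_assoc matrix_mul_lid,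
    metis matrix_vector_mul_assoc matrix_vector_mul_lid)

text \<open>Both \<open>E\<close> and its reflection solve the same linear system with the same initial value.
  Uniqueness is obtained as in the proof of unitarity, from the constancy of a product in which the
  connection terms cancel.\<close>

lemma reflect_frame:
  assumes real: "\<And>u. u \<in> \<Omega> \<Longrightarrow> conj_mat (B u) = B u" "\<And>u. u \<in> \<Omega> \<Longrightarrow> cnj_vec (H u) = H u"
    and u: "u \<in> \<Omega>"
  shows "conj_mat (E u (- cnj \<mu>)) = E u \<mu>" "cnj_vec (X u (- cnj \<mu>)) = X u \<mu>"
proof -
  have E_eq: "conj_mat (E u (- cnj \<mu>)) = E u \<mu>" if u: "u \<in> \<Omega>" for u
  proof -
    have "((\<lambda>x. conj_mat (E x (- cnj \<mu>)) ** adj (E x (cnj \<mu>))) has_derivative (\<lambda>v. 0)) (at x)"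
      if x: "x \<in> \<Omega>" for x
    proof -
      have "((\<lambda>x. conj_mat (E x (- cnj \<mu>)) ** adj (E x (cnj \<mu>))) has_derivative
        (\<lambda>v. conj_mat (E x (- cnj \<mu>)) ** adj (E x (cnj \<mu>) ** conn (B x) (cnj \<mu>) v)
          + conj_mat (E x (- cnj \<mu>) ** conn (B x) (- cnj \<mu>) v) ** adj (E x (cnj \<mu>)))) (at x)"
        by (intro bilin_mult lin_maps E_der x)
      then show ?thesis
        by (simp add: adj_algebra conj_mat_algebra adj_conn conj_conn B_herm real x mat_algebra)
    qed
    from has_derivative_zero_unique_connected[OF open_domain connected_domain this u zero_in]
    have "conj_mat (E u (- cnj \<mu>)) ** adj (E u (cnj \<mu>)) = mat 1"
      by (simp add: E_zero adj_algebra conj_mat_algebra)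
    then have "conj_mat (E u (- cnj \<mu>)) ** (adj (E u (cnj \<mu>)) ** E u \<mu>) = E u \<mu>"
      by (simp add: matrix_mul_assoc)
    then show ?thesis by (simp add: unitary u)
  qed
  show "conj_mat (E u (- cnj \<mu>)) = E u \<mu>" by (rule E_eq[OF u])
  have "((\<lambda>x. cnj_vec (X x (- cnj \<mu>)) - X x \<mu>) has_derivative (\<lambda>v. 0)) (at x)" if x: "x \<in> \<Omega>" for x
  proof -
    have "((\<lambda>x. cnj_vec (X x (- cnj \<mu>)) - X x \<mu>) has_derivative
      (\<lambda>v. cnj_vec (E x (- cnj \<mu>) *v (delta v *v H x)) - E x \<mu> *v (delta v *v H x))) (at x)"
      by (intro has_derivative_diff lin_maps X_der x)
    then show ?thesis by (simp add: conj_mat_algebra E_eq x real)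
  qed
  from has_derivative_zero_unique_connected[OF open_domain connected_domain this u zero_in]
  show "cnj_vec (X u (- cnj \<mu>)) = X u \<mu>" by (simp add: X_zero vec_eq_iff)
qed

text \<open>The converse: the two frames have equal derivatives, and \<open>E\<close> is invertible, so the
  connection equals its conjugate. The commutator with \<open>\<delta>\<close> sees the off-diagonal
  entries of \<open>B\<close> only.\<close>

lemma real_data:
  assumes E_real: "\<And>u \<mu>. u \<in> \<Omega> \<Longrightarrow> conj_mat (E u (- cnj \<mu>)) = E u \<mu>"
    and X_real: "\<And>u \<mu>. u \<in> \<Omega> \<Longrightarrow> cnj_vec (X u (- cnj \<mu>)) = X u \<mu>"
    and u: "u \<in> \<Omega>"
  shows "cnj (H u $ i) = H u $ i" "i \<noteq> j \<Longrightarrow> cnj (B u $ i $ j) = B u $ i $ j"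
proof -
  note within = has_derivative_transform_within_open[OF _ open_domain u]
  have "((\<lambda>x. conj_mat (E x (- cnj 0))) has_derivative
      (\<lambda>v. conj_mat (E u (- cnj 0) ** conn (B u) (- cnj 0) v))) (at u)"
    by (intro lin_maps E_der u)
  then have "((\<lambda>x. E x 0) has_derivative (\<lambda>v. conj_mat (E u (- cnj 0) ** conn (B u) (- cnj 0) v))) (at u)"
    by (rule within) (use E_real[of _ 0] in simp)
  from fun_cong[OF has_derivative_unique[OF this E_der[OF u]]]
  have "conj_mat (E u (- cnj 0)) ** conj_mat (conn (B u) (- cnj 0) v) = E u 0 ** conn (B u) 0 v" for v
    by (simp only: conj_mat_algebra(3))
  then have "conn (conj_mat (B u)) 0 v = conn (B u) 0 v" for v
    unfolding conj_conn E_real[OF u] by (rule E_cancel(1)[OF u])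
  then have "conn (conj_mat (B u)) 0 (axis i 1) $ i $ j = conn (B u) 0 (axis i 1) $ i $ j" by simp
  then show "i \<noteq> j \<Longrightarrow> cnj (B u $ i $ j) = B u $ i $ j"
    by (simp add: conn_zero_nth) (simp add: axis_def)
  have "((\<lambda>x. cnj_vec (X x (- cnj 0))) has_derivative
      (\<lambda>v. cnj_vec (E u (- cnj 0) *v (delta v *v H u)))) (at u)"
    by (intro lin_maps X_der u)
  then have "((\<lambda>x. X x 0) has_derivative (\<lambda>v. cnj_vec (E u (- cnj 0) *v (delta v *v H u)))) (at u)"
    by (rule within) (use X_real[of _ 0] in simp)
  from fun_cong[OF has_derivative_unique[OF this X_der[OF u]]]
  have "conj_mat (E u (- cnj 0)) *v (delta v *v cnj_vec (H u)) = E u 0 *v (delta v *v H u)" for v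
    by (simp only: conj_mat_algebra)
  then have "delta v *v cnj_vec (H u) = delta v *v H u" for v
    unfolding E_real[OF u] by (rule E_cancel(2)[OF u])
  then have "(delta (axis i 1) *v cnj_vec (H u)) $ i = (delta (axis i 1) *v H u) $ i" by simp
  then show "cnj (H u $ i) = H u $ i" by (simp add: delta_vec_nth)
qed

end

section \<open>Real frames and flat Egoroff metrics\<close>

text \<open>Real data \<open>h\<close> and \<open>\<beta>\<close> extracted from a Hermitian frame. The diagonal of
  \<open>B\<close> may be anything, whereas that of \<open>\<beta>\<close> is normalised to zero.\<close>

locale real_frame = hermitian_frame \<Omega> B H \<phi> E X
  for \<Omega> :: "(real^'n) set" and B H \<phi> E X +
  fixes h :: "real^'n \<Rightarrow> real^'n" and \<beta> :: "real^'n \<Rightarrow> real^'n^'n"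
  assumes H_eq: "\<And>u. u \<in> \<Omega> \<Longrightarrow> H u = cvec (h u)"
    and B_eq: "\<And>u i j. u \<in> \<Omega> \<Longrightarrow> i \<noteq> j \<Longrightarrow> B u $ i $ j = of_real (\<beta> u $ i $ j)"
    and \<beta>_diag: "\<And>u i. u \<in> \<Omega> \<Longrightarrow> \<beta> u $ i $ i = 0"
begin

lemma \<beta>_sym: "u \<in> \<Omega> \<Longrightarrow> \<beta> u $ i $ j = \<beta> u $ j $ i"
proof (cases "i = j")
  case False
  assume u: "u \<in> \<Omega>"
  have "adj (B u) $ i $ j = B u $ i $ j" by (simp add: B_herm u)
  then have "complex_of_real (\<beta> u $ j $ i) = of_real (\<beta> u $ i $ j)"
    using B_eq[OF u] False by simp
  then show ?thesis by (simp only: of_real_eq_iff)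
qed simp

lemma conn_eq: "u \<in> \<Omega> \<Longrightarrow> conn (B u) \<mu> v = conn (cmat (\<beta> u)) \<mu> v"
proof -
  assume u: "u \<in> \<Omega>"
  have "(delta v ** B u - B u ** delta v) $ i $ j = (delta v ** cmat (\<beta> u) - cmat (\<beta> u) ** delta v) $ i $ j" for i j
    using B_eq[OF u, of i j] by (cases "i = j") (simp_all add: delta_mult_nth)
  then have "delta v ** B u - B u ** delta v = delta v ** cmat (\<beta> u) - cmat (\<beta> u) ** delta v"
    unfolding vec_eq_iff by blast
  then show ?thesis by (simp only: conn_def)
qed

lemma h_component_smooth: "diffk k \<Omega> (\<lambda>u. h u $ i)"
proof (rule diffk_cong[OF _ open_domain])
  show "diffk k \<Omega> (\<lambda>u. Re (H u $ i))"
    by (intro diffk_bounded_linear[OF bounded_linear_Re] diffk_bounded_linear[OF bounded_linear_vec_nth] H_smooth)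
qed (simp add: H_eq)

lemma h_smooth: "diffk k \<Omega> h"
  by (intro diffk_vec h_component_smooth)

lemma h_der:
  obtains h' where "\<And>u. u \<in> \<Omega> \<Longrightarrow> (h has_derivative h' u) (at u)"
    "\<And>u i j. u \<in> \<Omega> \<Longrightarrow> h' u (axis j 1) $ i = partial j (\<lambda>v. h v $ i) u"
proof -
  obtain h' where h': "\<And>u. u \<in> \<Omega> \<Longrightarrow> (h has_derivative h' u) (at u)"
    using h_smooth[of 1] by auto
  moreover have "partial j (\<lambda>v. h v $ i) u = h' u (axis j 1) $ i" if "u \<in> \<Omega>" for u i j
    by (rule partial_eq[of _ "\<lambda>v. h' u v $ i"])
       (rule bounded_linear.has_derivative[OF bounded_linear_vec_nth h'[OF that]])
  ultimately show thesis using that by metis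
qed

text \<open>Symmetry of the second derivatives of \<open>X\<close> in directions \<open>i\<close> and
  \<open>j\<close>, compared in component \<open>i\<close> of the moving frame. The parameter is set to
  \<open>0\<close>, where the connection reduces to the commutator and its diagonal vanishes. Written as a
  product, the relation makes sense at zeros of \<open>h\<close>.\<close>

lemma partial_h:
  assumes u: "u \<in> \<Omega>" and ij: "i \<noteq> j"
  shows "partial j (\<lambda>v. h v $ i) u = \<beta> u $ i $ j * h u $ j"
proof -
  obtain h' where h': "\<And>u. u \<in> \<Omega> \<Longrightarrow> (h has_derivative h' u) (at u)"
    and h'_partial: "\<And>u i j. u \<in> \<Omega> \<Longrightarrow> h' u (axis j 1) $ i = partial j (\<lambda>v. h v $ i) u"
    using h_der by blast
  have H': "(H has_derivative (\<lambda>v. cvec (h' u v))) (at u)"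
    by (rule has_derivative_transform_within_open[OF lin_maps(8)[OF h'[OF u]] open_domain u]) (simp add: H_eq)
  have D: "((\<lambda>x. E x 0 *v (delta (axis a 1) *v H x)) has_derivative
     (\<lambda>v. E u 0 *v (delta (axis a 1) *v cvec (h' u v)) + (E u 0 ** conn (B u) 0 v) *v (delta (axis a 1) *v H u)))
     (at u)" for a
    by (intro bilin_vec E_der u H'
        bounded_bilinear.bounded_linear_right[OF bounded_bilinear_matrix_vector_mult,
          THEN bounded_linear.has_derivative])
  from second_derivative_symmetric[OF open_domain u X_der D[of i] D[of j]]
  have "E u 0 *v (delta (axis i 1) *v cvec (h' u (axis j 1)) + conn (B u) 0 (axis j 1) *v (delta (axis i 1) *v H u))
    = E u 0 *v (delta (axis j 1) *v cvec (h' u (axis i 1)) + conn (B u) 0 (axis i 1) *v (delta (axis j 1) *v H u))"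
    by (simp only: mat_algebra)
  then have "delta (axis i 1) *v cvec (h' u (axis j 1)) + conn (B u) 0 (axis j 1) *v (delta (axis i 1) *v H u)
    = delta (axis j 1) *v cvec (h' u (axis i 1)) + conn (B u) 0 (axis i 1) *v (delta (axis j 1) *v H u)"
    by (rule E_cancel(2)[OF u])
  then have eq: "(delta (axis i 1) *v cvec (h' u (axis j 1)) + conn (B u) 0 (axis j 1) *v (delta (axis i 1) *v H u)) $ i
    = (delta (axis j 1) *v cvec (h' u (axis i 1)) + conn (B u) 0 (axis i 1) *v (delta (axis j 1) *v H u)) $ i"
    by simp
  have dv: "delta (axis b 1) *v H u = axis b (of_real (h u $ b))" for b
    by (simp add: vec_eq_iff delta_vec_nth H_eq u) (simp add: axis_def)
  have "complex_of_real (h' u (axis j 1) $ i) = of_real (\<beta> u $ i $ j) * of_real (h u $ j)"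
    using eq ij B_eq[OF u ij] unfolding dv
    by (simp add: delta_vec_nth mat_vec_axis_nth conn_zero_nth) (simp add: axis_def)
  then have "h' u (axis j 1) $ i = \<beta> u $ i $ j * h u $ j"
    by (metis of_real_eq_iff of_real_mult)
  then show ?thesis by (simp add: h'_partial u)
qed

lemma rotation_coeff_eq:
  assumes "u \<in> \<Omega>" "\<And>i. h u $ i \<noteq> 0"
  shows "rotation_coeff h u = \<beta> u"
  using assms partial_h[OF assms(1)] \<beta>_diag[OF assms(1)]
  by (simp add: rotation_coeff_def vec_eq_iff)

lemma potential:
  assumes u: "u \<in> \<Omega>"
  shows "(\<lambda>x. Re (\<phi> x)) differentiable (at u)" "partial i (\<lambda>x. Re (\<phi> x)) u = (h u $ i)\<^sup>2"
proof -
  have D: "((\<lambda>x. Re (\<phi> x)) has_derivative (\<lambda>v. Re (cinner (H u) (delta v *v H u)))) (at u)"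
    by (rule bounded_linear.has_derivative[OF bounded_linear_Re \<phi>_der[OF u]])
  then show "(\<lambda>x. Re (\<phi> x)) differentiable (at u)" by (rule differentiableI)
  have "delta (axis i 1) *v H u = axis i (of_real (h u $ i))"
    by (simp add: vec_eq_iff delta_vec_nth H_eq u) (simp add: axis_def)
  then show "partial i (\<lambda>x. Re (\<phi> x)) u = (h u $ i)\<^sup>2"
    unfolding partial_eq[OF D]
    by (simp add: cinner_def axis_def H_eq u if_distrib power2_eq_square cong: if_cong)
qed

lemma christoffel_diag:
  assumes u: "u \<in> \<Omega>" and nz: "\<And>i. h u $ i \<noteq> 0"
  defines "p \<equiv> \<lambda>a b. partial b (\<lambda>v. h v $ a) u"
  shows "christoffel (diag_metric h) k i j u =
    (if j = k then p k i / h u $ k else 0) + (if i = k then p k j / h u $ k else 0)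
    - (if i = j then h u $ i * p i k / (h u $ k)\<^sup>2 else 0)"
proof -
  let ?G = "\<chi> a b. if a = b then 1 / (h u $ a)\<^sup>2 else (0::real)"
  have "diag_metric h u ** ?G = mat 1"
    using nz by (simp add: vec_eq_iff diag_metric_def diagonal_mult_nth[of "\<lambda>a. (h u $ a)\<^sup>2"] mat_def)
  then have inv: "matrix_inv (diag_metric h u) = ?G" by (rule matrix_inv_unique_right)
  obtain h' where h': "\<And>u. u \<in> \<Omega> \<Longrightarrow> (h has_derivative h' u) (at u)"
    and h'_partial: "\<And>u i j. u \<in> \<Omega> \<Longrightarrow> h' u (axis j 1) $ i = partial j (\<lambda>v. h v $ i) u"
    using h_der by blast
  have pg: "partial c (\<lambda>v. diag_metric h v $ a $ b) u = (if a = b then 2 * h u $ a * p a c else 0)" for a b c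
  proof (cases "a = b")
    case True
    have "((\<lambda>v. h v $ a) has_derivative (\<lambda>v. h' u v $ a)) (at u)"
      by (rule bounded_linear.has_derivative[OF bounded_linear_vec_nth h'[OF u]])
    from has_derivative_mult[OF this this]
    have "((\<lambda>v. (h v $ a)\<^sup>2) has_derivative (\<lambda>v. 2 * h u $ a * h' u v $ a)) (at u)"
      by (simp add: power2_eq_square algebra_simps)
    from partial_eq[OF this] show ?thesis using True by (simp add: diag_metric_def p_def h'_partial u)
  next
    case False
    then have "(\<lambda>v. diag_metric h v $ a $ b) = (\<lambda>v. 0)" by (simp add: diag_metric_def)
    then show ?thesis using False partial_eq[OF has_derivative_const] by auto
  qed
  have "christoffel (diag_metric h) k i j u = 1 / (2 * (h u $ k)\<^sup>2) *
     ((if j = k then 2 * h u $ j * p j i else 0) + (if i = k then 2 * h u $ i * p i j else 0)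
       - (if i = j then 2 * h u $ i * p i k else 0))"
  proof -
    have sum: "(\<Sum>l\<in>UNIV. ?G $ k $ l * Y l) = Y k / (h u $ k)\<^sup>2" for Y
    proof -
      have "(\<Sum>l\<in>UNIV. ?G $ k $ l * Y l) = (\<Sum>l\<in>UNIV. if k = l then Y l / (h u $ l)\<^sup>2 else 0)"
        by (intro sum.cong) auto
      then show ?thesis by simp
    qed
    show ?thesis unfolding christoffel_def inv sum pg by simp
  qed
  also have "\<dots> = (if j = k then p k i / h u $ k else 0) + (if i = k then p k j / h u $ k else 0)
    - (if i = j then h u $ i * p i k / (h u $ k)\<^sup>2 else 0)"
  proof -
    have "1 / (2 * x\<^sup>2) * ((if j = k then 2 * x * a else 0) + (if i = k then 2 * x * b else 0)
       - (if i = j then 2 * y * c else 0))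
      = (if j = k then a / x else 0) + (if i = k then b / x else 0) - (if i = j then y * c / x\<^sup>2 else 0)"
      if "x \<noteq> 0" for x y a b c :: real
      using that by (auto simp: power2_eq_square diff_divide_distrib add_divide_distrib)
    from this[of "h u $ k" "p k i" "p k j" "h u $ i" "p i k"] show ?thesis
      using nz[of k] by (simp cong: if_cong)
  qed
  finally show ?thesis .
qed

lemma christoffel_smooth:
  assumes S: "open S" "S \<subseteq> \<Omega>" and nz: "\<And>u i. u \<in> S \<Longrightarrow> h u $ i \<noteq> 0"
  shows "diffk n S (christoffel (diag_metric h) k i j)"
proof -
  have hs: "diffk n S (\<lambda>u. h u $ a)" for n a using h_component_smooth S(2) by (rule diffk_subset)
  have ps: "diffk n S (partial b (\<lambda>v. h v $ a))" for a b
    using hs S(1) by (rule diffk_partial)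
  have if_s: "diffk n S (\<lambda>u. if c then f u else 0)" if "diffk n S f" for c and f :: "real^'n \<Rightarrow> real"
    using that by (cases c) (auto intro: diffk_const)
  let ?f = "\<lambda>u. (if j = k then partial i (\<lambda>v. h v $ k) u / h u $ k else 0)
      + (if i = k then partial j (\<lambda>v. h v $ k) u / h u $ k else 0)
      - (if i = j then h u $ i * partial k (\<lambda>v. h v $ i) u / (h u $ k * h u $ k) else 0)"
  have "diffk n S ?f"
    by (intro diffk_diff diffk_add if_s diffk_divide diffk_bilinear[OF bounded_bilinear_mult] hs ps)
       (use nz in auto)
  then show ?thesis
    by (rule diffk_cong[OF _ S(1)]) (use christoffel_diag nz S(2) in \<open>auto simp: power2_eq_square\<close>)
qed

text \<open>The Christoffel symbols are the connection of the frame \<open>E diag(h)\<close>: the matrix equation is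
  the statement \<open>\<partial>\<^sub>i (E diag(h)) = E diag(h) \<Gamma>\<^sub>i\<close> with the factor
  \<open>E\<close> removed.\<close>

lemma christoffel_frame:
  assumes u: "u \<in> \<Omega>" and nz: "\<And>i. h u $ i \<noteq> 0"
  shows "delta (h u) ** cmat (\<chi> k j. christoffel (diag_metric h) k i j u)
    = conn (B u) 0 (axis i 1) ** delta (h u) + delta (\<chi> a. partial i (\<lambda>v. h v $ a) u)"
proof -
  have c: "conn (B u) 0 v $ a $ b = of_real ((v $ a - v $ b) * \<beta> u $ a $ b)" for v a b
    unfolding conn_eq[OF u] by (simp add: conn_zero_nth)
  have "h u $ k * christoffel (diag_metric h) k i j u
      = ((axis i 1 :: real^'n) $ k - (axis i 1 :: real^'n) $ j) * \<beta> u $ k $ j * h u $ j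
        + (if k = j then partial i (\<lambda>v. h v $ k) u else 0)" for k j
  proof (cases "k = j")
    case True
    then show ?thesis unfolding christoffel_diag[OF u nz]
      using nz[of k] by (auto simp: power2_eq_square)
  next
    case kj: False
    then have "partial j (\<lambda>v. h v $ k) u = \<beta> u $ k $ j * h u $ j"
      "partial k (\<lambda>v. h v $ j) u = \<beta> u $ k $ j * h u $ k"
      using partial_h[OF u] \<beta>_sym[OF u, of j k] by auto
    then show ?thesis unfolding christoffel_diag[OF u nz]
      using nz[of k] kj by (auto simp: power2_eq_square axis_def)
  qed
  then have "complex_of_real (h u $ k * christoffel (diag_metric h) k i j u)
      = of_real (((axis i 1 :: real^'n) $ k - (axis i 1 :: real^'n) $ j) * \<beta> u $ k $ j * h u $ j
        + (if k = j then partial i (\<lambda>v. h v $ k) u else 0))" for k j by simp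
  then show ?thesis by (simp add: vec_eq_iff delta_mult_nth c)
qed

text \<open>With \<open>\<partial>\<^sub>i J = J \<Gamma>\<^sub>i\<close>, the second derivatives are \<open>J
  (\<Gamma>\<^sub>j \<Gamma>\<^sub>i + \<partial>\<^sub>j \<Gamma>\<^sub>i)\<close>. Their symmetry in
  \<open>i\<close> and \<open>j\<close> is, after cancelling the invertible \<open>J\<close>, the
  vanishing of the Riemann tensor.\<close>

lemma flat:
  assumes S: "open S" "S \<subseteq> \<Omega>" and nz: "\<And>u i. u \<in> S \<Longrightarrow> h u $ i \<noteq> 0"
  shows "flat_on S (diag_metric h)"
  unfolding flat_on_def
proof (intro ballI allI)
  fix u l k i j assume uS: "u \<in> S"
  then have u: "u \<in> \<Omega>" using S by blast
  define J where "J = (\<lambda>x. E x 0 ** delta (h x))"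
  define \<Gamma> where "\<Gamma> = (\<lambda>i x. cmat (\<chi> k j. christoffel (diag_metric h) k i j x))"
  obtain h' where h': "\<And>u. u \<in> \<Omega> \<Longrightarrow> (h has_derivative h' u) (at u)"
    and h'_partial: "\<And>u i j. u \<in> \<Omega> \<Longrightarrow> h' u (axis j 1) $ i = partial j (\<lambda>v. h v $ i) u"
    using h_der by blast
  define J' where "J' = (\<lambda>x v. E x 0 ** delta (h' x v) + (E x 0 ** conn (B x) 0 v) ** delta (h x))"
  have J_der: "(J has_derivative J' x) (at x)" if "x \<in> S" for x
    unfolding J_def J'_def using that S(2) by (intro bilin_mult E_der lin_maps h') auto
  have J'_eq: "J' x (axis a 1) = J x ** \<Gamma> a x" if x: "x \<in> S" for x a
  proof -
    have xO: "x \<in> \<Omega>" using x S by blast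
    have "h' x (axis a 1) = (\<chi> b. partial a (\<lambda>v. h v $ b) x)"
      by (simp add: vec_eq_iff h'_partial xO)
    then have "J' x (axis a 1)
        = E x 0 ** (conn (B x) 0 (axis a 1) ** delta (h x) + delta (\<chi> b. partial a (\<lambda>v. h v $ b) x))"
      by (simp add: J'_def mat_algebra add.commute)
    then show ?thesis
      unfolding christoffel_frame[OF xO nz[OF x], symmetric] by (simp add: J_def \<Gamma>_def mat_algebra)
  qed
  have "\<exists>D. (christoffel (diag_metric h) b a c has_derivative D) (at u)" for a b c
  proof -
    have "diffk (Suc 0) S (christoffel (diag_metric h) b a c)"
      using nz by (intro christoffel_smooth[OF S]) auto
    from diffk_imp_differentiable[OF this uS] show ?thesis unfolding differentiable_def .
  qed
  then have "\<forall>a b c. \<exists>D. (christoffel (diag_metric h) b a c has_derivative D) (at u)" by blast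
  then obtain C where C: "\<And>a b c. (christoffel (diag_metric h) b a c has_derivative C a b c) (at u)"
    unfolding choice_iff by blast
  have \<Gamma>_der: "(\<Gamma> a has_derivative (\<lambda>v. cmat (\<chi> b c. C a b c v))) (at u)" for a
  proof -
    have "((\<lambda>x. \<chi> b c. christoffel (diag_metric h) b a c x) has_derivative (\<lambda>v. \<chi> b c. C a b c v)) (at u)"
    proof (subst has_derivative_componentwise_within, intro ballI)
      fix m :: "real^'n^'n" assume "m \<in> Basis"
      then obtain p q where "m = axis p (axis q 1)" by (auto simp: Basis_vec_def)
      then show "((\<lambda>x. (\<chi> b c. christoffel (diag_metric h) b a c x) \<bullet> m) has_derivative
          (\<lambda>v. (\<chi> b c. C a b c v) \<bullet> m)) (at u)"
        using C by (simp add: inner_axis)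
    qed
    from lin_maps(7)[OF this] show ?thesis by (simp add: \<Gamma>_def[abs_def])
  qed
  have D: "((\<lambda>x. J' x (axis a 1)) has_derivative
      (\<lambda>v. J u ** cmat (\<chi> b c. C a b c v) + J' u v ** \<Gamma> a u)) (at u)" for a
    by (rule has_derivative_transform_within_open[OF bilin_mult[OF J_der[OF uS] \<Gamma>_der[of a]] S(1) uS])
       (simp add: J'_eq)
  from second_derivative_symmetric[OF S(1) uS J_der D[of i] D[of j]]
  have "J u ** (cmat (\<chi> b c. C i b c (axis j 1)) + \<Gamma> j u ** \<Gamma> i u)
      = J u ** (cmat (\<chi> b c. C j b c (axis i 1)) + \<Gamma> i u ** \<Gamma> j u)"
    unfolding J'_eq[OF uS] by (simp only: mat_algebra)
  then have "adj (E u (cnj 0)) ** (J u ** (cmat (\<chi> b c. C i b c (axis j 1)) + \<Gamma> j u ** \<Gamma> i u))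
      = adj (E u (cnj 0)) ** (J u ** (cmat (\<chi> b c. C j b c (axis i 1)) + \<Gamma> i u ** \<Gamma> j u))" by simp
  then have "delta (h u) ** (cmat (\<chi> b c. C i b c (axis j 1)) + \<Gamma> j u ** \<Gamma> i u)
      = delta (h u) ** (cmat (\<chi> b c. C j b c (axis i 1)) + \<Gamma> i u ** \<Gamma> j u)"
    unfolding J_def matrix_mul_assoc unitary(2)[OF u] by (simp only: matrix_mul_lid)
  then have "(delta (h u) ** (cmat (\<chi> b c. C i b c (axis j 1)) + \<Gamma> j u ** \<Gamma> i u)) $ l $ k
      = (delta (h u) ** (cmat (\<chi> b c. C j b c (axis i 1)) + \<Gamma> i u ** \<Gamma> j u)) $ l $ k" by simp
  then have "complex_of_real (C i l k (axis j 1)) + (\<Gamma> j u ** \<Gamma> i u) $ l $ k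
      = of_real (C j l k (axis i 1)) + (\<Gamma> i u ** \<Gamma> j u) $ l $ k"
    using nz[OF uS, of l] by (simp add: delta_mult_nth)
  moreover have "(\<Gamma> a u ** \<Gamma> b u) $ l $ k = of_real (\<Sum>m\<in>UNIV. christoffel (diag_metric h) l a m u
      * christoffel (diag_metric h) m b k u)" for a b
    by (simp add: \<Gamma>_def matrix_matrix_mult_def)
  ultimately have "complex_of_real (C i l k (axis j 1) + (\<Sum>m\<in>UNIV. christoffel (diag_metric h) l j m u
      * christoffel (diag_metric h) m i k u)) = of_real (C j l k (axis i 1) +
      (\<Sum>m\<in>UNIV. christoffel (diag_metric h) l i m u * christoffel (diag_metric h) m j k u))"
    by simp
  then have "C i l k (axis j 1) + (\<Sum>m\<in>UNIV. christoffel (diag_metric h) l j m u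
      * christoffel (diag_metric h) m i k u) = C j l k (axis i 1) +
      (\<Sum>m\<in>UNIV. christoffel (diag_metric h) l i m u * christoffel (diag_metric h) m j k u)"
    by (simp only: of_real_eq_iff)
  then show "riemann_curvature (diag_metric h) l k i j u = 0"
    by (simp add: riemann_curvature_def partial_eq[OF C] sum_subtractf)
qed

lemma flat_egoroff:
  assumes S: "open S" "S \<subseteq> \<Omega>" and nz: "\<And>u i. u \<in> S \<Longrightarrow> h u $ i \<noteq> 0"
  shows "flat_egoroff S h"
  unfolding flat_egoroff_def
proof (intro conjI allI ballI)
  show "smooth_fun S (\<lambda>u. h u $ i)" for i
    using diffk_imp_smooth_fun[OF diffk_subset[OF h_component_smooth S(2)] S(1)] .
  show "flat_on S (diag_metric h)" using flat[OF S nz] .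
  show "\<exists>\<phi>. \<forall>u\<in>S. \<phi> differentiable (at u) \<and> (\<forall>i. partial i \<phi> u = (h u $ i)\<^sup>2)"
    using potential S(2) by blast
qed (use nz in auto)

end

section \<open>Permutability of simple elements\<close>

text \<open>The eigenvalues \<open>a\<close> and \<open>a\<^sup>*\<close> have the same real part, so the numerical
  range lies on a vertical line.\<close>

lemma cinner_spectral:
  assumes P: "hermitian_projection P"
  shows "Re (cinner x (spectral P a (cnj a) *v x)) = Re a * (norm x)\<^sup>2"
proof -
  define t where "t = (norm (P *v x))\<^sup>2"
  define n where "n = (norm x)\<^sup>2"
  have 1: "cinner x (P *v x) = of_real t"
    unfolding t_def cinner_self[symmetric]
    using cinner_adj[of "P *v x" P x] by (simp add: hermitian_projectionD[OF P] cinner_adj)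
  have 2: "cinner x x = of_real n" by (simp only: n_def cinner_self)
  have "cinner x (spectral P a (cnj a) *v x) = a * of_real t + cnj a * (of_real n - of_real t)"
    by (simp add: spectral_def perp_def smult_mat_algebra mat_algebra cinner_algebra 1 2 right_diff_distrib)
  then show ?thesis unfolding n_def[symmetric] by simp (simp add: algebra_simps)
qed

text \<open>Up to scalars, the product of the two simple elements is the monic quadratic \<open>(\<mu> - R)(\<mu> -
  S)\<close>, and its reflection is \<open>(\<mu> + R\<^sup>*)(\<mu> + S\<^sup>*)\<close>, the star being
  entrywise conjugation. Each has a right root, \<open>S\<close> and \<open>T = -S\<^sup>*\<close>
  respectively. The choice of \<open>\<rho>\<close> means \<open>R N = N T\<close> for \<open>N = S -
  T\<close>, which says precisely that \<open>T\<close> is a right root of the first polynomial too; by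
  conjugation \<open>S\<close> is one of the second. Two monic quadratics that share two right roots with
  invertible difference coincide, and \<open>N\<close> is invertible because its numerical range lies on
  the line with real part \<open>2 Re z\<close>, scaled by the square of the norm.\<close>

lemma simple_elements_permute:
  fixes \<pi> :: "complex^'n^'n"
  assumes \<pi>: "hermitian_projection \<pi>" and z: "Im z \<noteq> 0" "Re z \<noteq> 0"
  defines "\<rho> \<equiv> proj_formula (simple_element z \<pi> (- cnj z)) (conj_mat \<pi>)"
  defines "S \<equiv> spectral \<pi> z (cnj z)" and "R \<equiv> spectral \<rho> (- cnj z) (- z)"
  shows "hermitian_projection \<rho>" "conj_mat R + conj_mat S = - (R + S)"
    "conj_mat R ** conj_mat S = R ** S"
proof -
  let ?b = "- cnj z" and ?pb = "conj_mat \<pi>"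
  let ?A = "simple_element z \<pi> ?b" and ?C = "simple_element (cnj z) \<pi> ?b"
  have ne: "?b \<noteq> z" "?b \<noteq> cnj z" "cnj z + z \<noteq> 0" "cnj z \<noteq> 0"
    using z by (auto simp: complex_eq_iff)
  have hpb: "hermitian_projection ?pb" using \<pi> by (rule hermitian_projection_conj)
  have AC: "?A ** ?C = mat 1" using simple_element_inverse(1)[OF \<pi> ne(1,2)] .
  have invA: "invertible ?A" using AC by (rule matrix_inv_unique_right)
  show h\<rho>: "hermitian_projection \<rho>" unfolding \<rho>_def by (rule hermitian_projection_formula[OF hpb invA])
  note ann = proj_formula_annihilates[OF hpb AC, folded \<rho>_def]
  define T where "T = - conj_mat S"
  have T: "T = spectral ?pb (- cnj z) (- z)"
    unfolding T_def S_def spectral_algebra by (simp add: spectral_def vec_eq_iff)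
  define N where "N = S + conj_mat S"
  have N: "N = S - T" by (simp add: N_def T_def)
  have sub: "spectral \<pi> a c - spectral ?pb d d = spectral \<pi> (a - d) (c - d)" for a c d
    by (simp add: spectral_def perp_def vec_eq_iff algebra_simps)
  have S1: "S - spectral ?pb (- cnj z) (- cnj z) = smult_mat (cnj z + z) ?A"
  proof -
    have "(cnj z + z) * (2 * cnj z / (cnj z + z)) = 2 * cnj z" using ne(3) by simp
    moreover have "(?b - cnj z) / (?b - z) = 2 * cnj z / (cnj z + z)"
    proof -
      have "?b - cnj z = - (2 * cnj z)" "?b - z = - (cnj z + z)" by simp_all
      then show ?thesis by (simp only: minus_divide_divide)
    qed
    ultimately show ?thesis unfolding S_def sub simple_element_spectral spectral_algebra(2)
      by (simp add: add.commute)
  qed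
  have Npb: "N ** ?pb = smult_mat (cnj z + z) (?A ** ?pb)"
  proof -
    have "N ** ?pb = S ** ?pb - smult_mat (- cnj z) ?pb"
      unfolding N T by (simp add: mat_algebra_ring spectral_fix[OF hpb])
    also have "\<dots> = (S - spectral ?pb (- cnj z) (- cnj z)) ** ?pb"
      by (simp add: mat_algebra_ring spectral_fix[OF hpb])
    finally show ?thesis unfolding S1 by (simp add: mat_algebra_ring)
  qed
  have S2: "S - spectral ?pb (- z) (- z) = smult_mat (2 * z) (adj ?C)"
    unfolding simple_element_spectral adj_spectral[OF \<pi>] S_def sub spectral_algebra(2)
    using ne(4) by (intro arg_cong2[where f = "spectral \<pi>"]) (simp_all add: divide_simps)
  have Nperp: "N ** perp ?pb = smult_mat (2 * z) (adj ?C ** perp ?pb)"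
  proof -
    have "N ** perp ?pb = S ** perp ?pb - smult_mat (- z) (perp ?pb)"
      unfolding N T by (simp add: mat_algebra_ring spectral_fix[OF hpb])
    also have "\<dots> = (S - spectral ?pb (- z) (- z)) ** perp ?pb"
      by (simp add: mat_algebra_ring spectral_fix[OF hpb])
    finally show ?thesis unfolding S2 by (simp add: mat_algebra_ring)
  qed
  have 1: "perp \<rho> ** (N ** ?pb) = 0"
    using ann(1) by (simp add: Npb mat_algebra smult_mat_algebra)
  have "adj (perp ?pb ** ?C ** \<rho>) = \<rho> ** adj ?C ** perp ?pb"
    using hermitian_projectionD(2)[OF h\<rho>] hermitian_projectionD(2)[OF hermitian_projection_perp[OF hpb]]
    by (simp add: adj_algebra mat_mul_assoc_right)
  then have "\<rho> ** adj ?C ** perp ?pb = 0" unfolding ann(2) by (simp add: adj_algebra)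
  then have 2: "\<rho> ** (N ** perp ?pb) = 0"
    unfolding Nperp by (simp only: mat_algebra smult_mat_algebra)
  have "N ** ?pb = \<rho> ** (N ** ?pb)" "\<rho> ** N = \<rho> ** (N ** ?pb)"
    using 1 2 by (simp_all add: perp_def mat_algebra)
  then have comm: "\<rho> ** N = N ** ?pb" by simp
  have RN: "R ** N = N ** T"
    unfolding R_def T spectral_def perp_def by (simp add: mat_algebra smult_mat_algebra comm)
  have "T ** T - (R + S) ** T + R ** S = R ** N - N ** T"
    unfolding N by (simp add: mat_algebra algebra_simps)
  then have pT: "T ** T - (R + S) ** T + R ** S = 0" by (simp add: RN)
  have cT: "conj_mat T = - S" by (simp add: T_def vec_eq_iff)
  have "conj_mat (T ** T - (R + S) ** T + R ** S) = 0" unfolding pT by (simp add: vec_eq_iff)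
  then have qS: "S ** S + (conj_mat R + conj_mat S) ** S + conj_mat R ** conj_mat S = 0"
    by (simp add: conj_mat_algebra cT mat_algebra_ring algebra_simps)
  let ?D1 = "R + S + conj_mat R + conj_mat S" and ?D0 = "R ** S - conj_mat R ** conj_mat S"
  have e1: "?D0 = ?D1 ** S"
    using qS by (simp add: mat_algebra algebra_simps eq_neg_iff_add_eq_0)
  have e2: "?D0 = ?D1 ** T"
    using pT unfolding T_def by (simp add: mat_algebra algebra_simps eq_neg_iff_add_eq_0)
  have D1N: "?D1 ** N = 0" using e1 e2 unfolding N by (simp add: mat_algebra_ring)
  have "invertible N"
    unfolding invertible_iff_ker
  proof (intro allI impI)
    fix x assume "N *v x = 0"
    then have "cinner x (S *v x) + cinner x (conj_mat S *v x) = 0"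
      by (simp add: N_def mat_algebra_ring cinner_algebra flip: cinner_algebra(2))
    moreover have "conj_mat S = spectral ?pb (cnj z) (cnj (cnj z))"
      by (simp add: S_def spectral_algebra)
    ultimately have "Re (cinner x (spectral \<pi> z (cnj z) *v x))
        + Re (cinner x (spectral ?pb (cnj z) (cnj (cnj z)) *v x)) = 0"
      unfolding S_def by (metis plus_complex.sel(1) zero_complex.sel(1))
    then have "2 * Re z * (norm x)\<^sup>2 = 0"
      unfolding cinner_spectral[OF \<pi>] cinner_spectral[OF hpb] by simp
    then show "x = 0" using z by simp
  qed
  then have "?D1 ** (N ** matrix_inv N) = ?D1" by (simp add: matrix_inv_cancel)
  then have D1: "?D1 = 0" using D1N by (simp add: matrix_mul_assoc mat_algebra_ring(8))
  then show "conj_mat R + conj_mat S = - (R + S)"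
    by (metis (no_types, lifting) add.assoc add_eq_0_iff)
  have "?D0 = 0" using e1 D1 by (simp add: mat_algebra_ring(8))
  then show "conj_mat R ** conj_mat S = R ** S" by simp
qed

lemma reflect_simple_product:
  fixes \<pi> :: "complex^'n^'n"
  assumes \<pi>: "hermitian_projection \<pi>" and z: "Im z \<noteq> 0" "Re z \<noteq> 0"
    and \<rho>: "\<rho> = proj_formula (simple_element z \<pi> (- cnj z)) (conj_mat \<pi>)"
    and \<mu>: "\<mu> \<notin> {z, - cnj z}"
  shows "conj_mat (simple_element (- cnj z) \<rho> (- cnj \<mu>) ** simple_element z \<pi> (- cnj \<mu>))
    = simple_element (- cnj z) \<rho> \<mu> ** simple_element z \<pi> \<mu>"
proof -
  define S where "S = spectral \<pi> z (cnj z)"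
  define R where "R = spectral \<rho> (- cnj z) (- z)"
  note perm = simple_elements_permute[OF \<pi> z, folded \<rho>, folded S_def R_def]
  have se: "simple_element w Q \<nu> = smult_mat (1 / (\<nu> - w)) (smult_mat \<nu> (mat 1) - spectral Q w (cnj w))"
    if "\<nu> \<noteq> w" for w Q and \<nu>
    using that by (auto simp: simple_element_spectral spectral_def perp_def vec_eq_iff mat_def divide_simps)
      (auto simp: algebra_simps)
  have prod: "simple_element (- cnj z) \<rho> \<nu> ** simple_element z \<pi> \<nu>
      = smult_mat (1 / ((\<nu> + cnj z) * (\<nu> - z)))
          (smult_mat (\<nu> * \<nu>) (mat 1) - smult_mat \<nu> (R + S) + R ** S)"
    if "\<nu> \<noteq> z" "\<nu> \<noteq> - cnj z" for \<nu>
    using that by (simp add: se mat_algebra smult_mat_algebra S_def R_def)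
      (simp add: vec_eq_iff algebra_simps)
  have \<mu>': "\<mu> \<noteq> z" "\<mu> \<noteq> - cnj z" "- cnj \<mu> \<noteq> z" "- cnj \<mu> \<noteq> - cnj z"
    using \<mu> by (auto dest: arg_cong[of _ _ cnj])
  have "conj_mat (simple_element (- cnj z) \<rho> (- cnj \<mu>) ** simple_element z \<pi> (- cnj \<mu>))
      = smult_mat (1 / ((- \<mu> + z) * (- \<mu> - cnj z)))
          (smult_mat (\<mu> * \<mu>) (mat 1) - smult_mat (- \<mu>) (conj_mat R + conj_mat S) + conj_mat R ** conj_mat S)"
    unfolding prod[OF \<mu>'(3,4)] by (simp add: conj_mat_algebra)
  also have "(- \<mu> + z) * (- \<mu> - cnj z) = (\<mu> + cnj z) * (\<mu> - z)" by (simp add: algebra_simps)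
  also have "smult_mat (- \<mu>) (conj_mat R + conj_mat S) = smult_mat \<mu> (R + S)"
    unfolding perm(2) by (simp add: vec_eq_iff algebra_simps)
  finally show ?thesis unfolding prod[OF \<mu>'(1,2)] perm(3) .
qed

section \<open>From flat Egoroff metrics to Hermitian frames\<close>

text \<open>Symmetry of the second derivatives of the potential: \<open>h\<^sub>i \<partial>\<^sub>j h\<^sub>i =
  h\<^sub>j \<partial>\<^sub>i h\<^sub>j\<close>.\<close>

lemma flat_egoroff_rotation_symmetric:
  assumes S: "open \<Omega>" and eg: "flat_egoroff \<Omega> h" and u: "u \<in> \<Omega>"
  shows "rotation_coeff h u $ i $ j = rotation_coeff h u $ j $ i"
proof -
  have sm: "diffk k \<Omega> (\<lambda>u. h u $ a)" for k a
    using eg S by (intro smooth_fun_imp_diffk) (auto simp: flat_egoroff_def)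
  obtain \<phi> where \<phi>: "\<And>u. u \<in> \<Omega> \<Longrightarrow> \<phi> differentiable (at u)"
    "\<And>u i. u \<in> \<Omega> \<Longrightarrow> partial i \<phi> u = (h u $ i)\<^sup>2"
    using eg unfolding flat_egoroff_def by blast
  have D\<phi>: "(\<phi> has_derivative frechet_derivative \<phi> (at x)) (at x)" if "x \<in> \<Omega>" for x
    using \<phi>(1)[OF that] by (simp add: frechet_derivative_works)
  have hd: "((\<lambda>u. h u $ a) has_derivative frechet_derivative (\<lambda>u. h u $ a) (at u)) (at u)" for a
    using diffk_imp_differentiable[OF sm[of "Suc 0" a] u] by (simp add: frechet_derivative_works)
  have D: "((\<lambda>x. frechet_derivative \<phi> (at x) (axis a 1)) has_derivative
      (\<lambda>v. 2 * h u $ a * frechet_derivative (\<lambda>u. h u $ a) (at u) v)) (at u)" for a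
  proof (rule has_derivative_transform_within_open[OF _ S u])
    show "((\<lambda>x. h x $ a * h x $ a) has_derivative
      (\<lambda>v. 2 * h u $ a * frechet_derivative (\<lambda>u. h u $ a) (at u) v)) (at u)"
      using has_derivative_mult[OF hd[of a] hd[of a]] by (simp add: algebra_simps)
    show "h x $ a * h x $ a = frechet_derivative \<phi> (at x) (axis a 1)" if "x \<in> \<Omega>" for x
      using \<phi>(2)[OF that, of a] by (simp add: partial_def power2_eq_square)
  qed
  from second_derivative_symmetric[OF S u D\<phi> D[of i] D[of j]]
  have "h u $ i * partial j (\<lambda>v. h v $ i) u = h u $ j * partial i (\<lambda>v. h v $ j) u"
    by (simp add: partial_def)
  moreover have "h u $ i \<noteq> 0" "h u $ j \<noteq> 0" using eg u by (auto simp: flat_egoroff_def)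
  ultimately show ?thesis by (auto simp: rotation_coeff_def field_simps)
qed

lemma frame_form_block_conn: "frame_form \<beta> h \<mu> v = block_conn (cmat \<beta>) (cvec h) \<mu> v"
  by (simp add: frame_form_def block_conn_def conn_def)

lemma flat_egoroff_hermitian_frame:
  fixes \<Omega> :: "(real^'n) set"
  assumes domain: "frame_domain \<Omega>" and eg: "flat_egoroff \<Omega> h"
    and frame: "extended_frame \<Omega> h F"
    and blocks: "\<And>u \<mu>. u \<in> \<Omega> \<Longrightarrow> F u \<mu> = block (E u \<mu>) (X u \<mu>) 1"
  obtains \<phi> where "hermitian_frame \<Omega> (\<lambda>u. cmat (rotation_coeff h u)) (\<lambda>u. cvec (h u)) \<phi> E X"
proof -
  have S: "open \<Omega>" "connected \<Omega>" "0 \<in> \<Omega>" using domain by (auto simp: frame_domain_def)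
  have fr: "holomorphic_mat (F u) UNIV" "((\<lambda>w. F w \<mu>) has_derivative
      (\<lambda>v. F u \<mu> ** frame_form (rotation_coeff h u) (h u) \<mu> v)) (at u)" "F 0 \<mu> = mat 1"
    if "u \<in> \<Omega>" for u \<mu>
    using frame that unfolding extended_frame_def frame_with_data_def by blast+
  obtain \<phi> where \<phi>: "\<And>u. u \<in> \<Omega> \<Longrightarrow> \<phi> differentiable (at u)"
    "\<And>u i. u \<in> \<Omega> \<Longrightarrow> partial i \<phi> u = (h u $ i)\<^sup>2"
    using eg unfolding flat_egoroff_def by blast
  have hs: "diffk k \<Omega> (\<lambda>u. h u $ a)" for k a
    using eg S by (intro smooth_fun_imp_diffk) (auto simp: flat_egoroff_def)
  have rs: "diffk k \<Omega> (\<lambda>u. rotation_coeff h u $ i $ j)" for k i j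
  proof (cases "i = j")
    case True then show ?thesis by (simp add: rotation_coeff_def diffk_const)
  next
    case False
    have "diffk k \<Omega> (\<lambda>u. partial j (\<lambda>v. h v $ i) u / h u $ j)"
      using eg by (intro diffk_divide diffk_partial[OF hs S(1)] hs) (auto simp: flat_egoroff_def)
    then show ?thesis using False by (simp add: rotation_coeff_def)
  qed
  have "hermitian_frame \<Omega> (\<lambda>u. cmat (rotation_coeff h u)) (\<lambda>u. cvec (h u)) (\<lambda>u. of_real (\<phi> u)) E X"
  proof
    show "adj (cmat (rotation_coeff h u)) = cmat (rotation_coeff h u)" if "u \<in> \<Omega>" for u
      using flat_egoroff_rotation_symmetric[OF S(1) eg that] by (simp add: vec_eq_iff)
    show "diffk k \<Omega> (\<lambda>u. cmat (rotation_coeff h u))" for k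
      by (intro diffk_bounded_linear[OF bounded_linear_finite_dim_maps(7)] diffk_vec rs)
    show "diffk k \<Omega> (\<lambda>u. cvec (h u))" for k
      by (intro diffk_bounded_linear[OF bounded_linear_finite_dim_maps(8)] diffk_vec hs)
    fix u \<mu> assume u: "u \<in> \<Omega>"
    have "((\<lambda>x. block (E x \<mu>) (X x \<mu>) 1) has_derivative (\<lambda>v. block (E u \<mu>) (X u \<mu>) 1 **
        block_conn (cmat (rotation_coeff h u)) (cvec (h u)) \<mu> v)) (at u)"
      using fr(2)[OF u, of \<mu>] unfolding frame_form_block_conn blocks[OF u]
      by (rule has_derivative_transform_within_open[OF _ S(1) u]) (simp add: blocks)
    then show "((\<lambda>x. E x \<mu>) has_derivative (\<lambda>v. E u \<mu> ** conn (cmat (rotation_coeff h u)) \<mu> v)) (at u)"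
      "((\<lambda>x. X x \<mu>) has_derivative (\<lambda>v. E u \<mu> *v (delta v *v cvec (h u)))) (at u)"
      using has_derivative_block_iff[of "\<lambda>x. E x \<mu>" "\<lambda>x. X x \<mu>" u _ _ \<mu>] by blast+
    have "(\<lambda>\<mu>. F u \<mu> $ p $ q) holomorphic_on UNIV" for p q
      using fr(1)[OF u] by (simp add: holomorphic_mat_def)
    from this[of "Inl _" "Inl _"] this[of "Inl _" "Inr 1"]
    show "holomorphic_mat (E u) UNIV" "holomorphic_vec (X u) UNIV"
      by (simp_all add: blocks u holomorphic_mat_def holomorphic_vec_def)
    have "((\<lambda>x. complex_of_real (\<phi> x)) has_derivative
        (\<lambda>v. of_real (frechet_derivative \<phi> (at u) v))) (at u)"
      using \<phi>(1)[OF u] by (intro has_derivative_of_real) (simp add: frechet_derivative_works)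
    moreover have "complex_of_real (frechet_derivative \<phi> (at u) v)
        = cinner (cvec (h u)) (delta v *v cvec (h u))" for v
      unfolding has_derivative_partial_sum[OF \<phi>(1)[OF u]]
      by (simp add: cinner_def delta_vec_nth \<phi>(2)[OF u] power2_eq_square mult_ac)
    ultimately show "((\<lambda>x. complex_of_real (\<phi> x)) has_derivative
        (\<lambda>v. cinner (cvec (h u)) (delta v *v cvec (h u)))) (at u)" by simp
  next
    fix \<mu>
    have "block (E 0 \<mu>) (X 0 \<mu>) 1 = mat 1" using fr(3)[OF S(3)] blocks[OF S(3)] by simp
    then show "E 0 \<mu> = mat 1" "X 0 \<mu> = 0" unfolding block_one[symmetric] block_eq_iff by simp_all
  qed (use S in auto)
  then show thesis by (rule that)
qed

section \<open>The action of two simple elements\<close>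

lemma (in dressed_frame) pt_eq:
  assumes "u \<in> \<Omega>"
  shows "projection_onto ((\<lambda>x. matrix_inv (E u w) *v x) ` image_mat P) = pt u"
  using projection_onto_image[OF P inv_adj_E[OF assms]] by (simp add: pt_def matrix_inv_E assms)

lemma (in dressed_frame) \<eta>_eq: "u \<in> \<Omega> \<Longrightarrow> \<eta> u = matrix_inv (E u (cnj w)) *v X u (cnj w)"
  by (simp add: \<eta>_def matrix_inv_E)

lemma (in dressed_frame) \<eta>_zero: "\<eta> 0 = 0"
  by (simp add: \<eta>_def X_zero)

theorem corollary6p2:
  fixes \<Omega> :: "(real^'n) set"
    and h :: "real^'n \<Rightarrow> real^'n"
    and \<beta> :: "real^'n \<Rightarrow> real^'n^'n"
    and F :: "real^'n \<Rightarrow> complex \<Rightarrow> complex^('n + 1)^('n + 1)"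
    and E :: "real^'n \<Rightarrow> complex \<Rightarrow> complex^'n^'n"
    and X :: "real^'n \<Rightarrow> complex \<Rightarrow> complex^'n"
    and \<pi> \<rho> :: "complex^'n^'n"
    and z :: complex
    and \<pi>t \<rho>t :: "real^'n \<Rightarrow> complex^'n^'n"
    and \<eta>1 \<eta>12 :: "real^'n \<Rightarrow> complex^'n"
  assumes domain: "frame_domain \<Omega>"
    and egoroff: "flat_egoroff \<Omega> h"
    and beta: "\<beta> = rotation_coeff h"
    and frame: "extended_frame \<Omega> h F"
    and blocks: "\<And>u \<mu>. u \<in> \<Omega> \<Longrightarrow> F u \<mu> = block (E u \<mu>) (X u \<mu>) 1"
    and proj: "hermitian_projection \<pi>"
    and z: "Im z \<noteq> 0" "Re z \<noteq> 0"
    and rho: "\<rho> = rho_proj z \<pi>"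
    and pit: "\<pi>t = (\<lambda>u. projection_onto ((\<lambda>x. matrix_inv (E u z) *v x) ` image_mat \<pi>))"
    and rhot: "\<rho>t = (\<lambda>u. projection_onto
        ((\<lambda>x. (simple_element z (\<pi>t u) (- cnj z) ** matrix_inv (E u (- cnj z))) *v x)
          ` image_mat (conj_mat \<pi>)))"
    and eta1: "\<eta>1 = (\<lambda>u. matrix_inv (E u (cnj z)) *v X u (cnj z))"
    and eta12: "\<eta>12 = (\<lambda>u.
        (simple_element (cnj z) (perp (\<pi>t u)) (- z) ** matrix_inv (E u (- z))) *v X u (- z)
        + ((cnj z - z) / (cnj z + z)) *s (\<pi>t u *v \<eta>1 u))"
  shows "(\<forall>u\<in>\<Omega>. f_dressable z \<pi> (F u)) \<and>
    (\<exists>Eh Xh hh \<beta>h.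
      (\<forall>u\<in>\<Omega>. \<forall>\<mu>. f_dress z \<pi> (F u) \<mu> = block (Eh u \<mu>) (Xh u \<mu>) 1) \<and>
      frame_with_data \<Omega> \<beta>h hh (\<lambda>u. f_dress z \<pi> (F u)) \<and>
      (\<forall>u\<in>\<Omega>. \<forall>\<mu>. \<mu> \<notin> {z, cnj z, - z, - cnj z} \<longrightarrow>
        Xh u \<mu> =
          (simple_element (- z) (perp \<rho>) \<mu> ** simple_element (cnj z) (perp \<pi>) \<mu>) *v
            (X u \<mu>
             - ((cnj z - z) / (\<mu> - z)) *s ((E u \<mu> ** \<pi>t u) *v \<eta>1 u)
             - ((cnj z - z) / (\<mu> + cnj z)) *s
                 ((E u \<mu> ** simple_element z (perp (\<pi>t u)) \<mu> ** \<rho>t u) *v \<eta>12 u))) \<and>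
      (\<forall>u\<in>\<Omega>. cvec (hh u) =
        cvec (h u) + (\<i> * (z - cnj z)) *s (\<pi>t u *v \<eta>1 u + \<rho>t u *v \<eta>12 u)) \<and>
      (\<forall>u\<in>\<Omega>. cmat (\<beta>h u) =
        cmat (\<beta> u) + smult_mat (\<i> * (z - cnj z)) (off_diag (\<pi>t u + \<rho>t u))) \<and>
      (\<exists>\<Omega>'. frame_domain \<Omega>' \<and> \<Omega>' \<subseteq> \<Omega> \<and> (\<forall>u\<in>\<Omega>'. \<forall>i. hh u $ i \<noteq> 0)) \<and>
      (\<forall>\<Omega>'. frame_domain \<Omega>' \<and> \<Omega>' \<subseteq> \<Omega> \<and> (\<forall>u\<in>\<Omega>'. \<forall>i. hh u $ i \<noteq> 0) \<longrightarrow>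
        flat_egoroff \<Omega>' hh \<and>
        (\<forall>u\<in>\<Omega>'. rotation_coeff hh u = \<beta>h u) \<and>
        extended_frame \<Omega>' hh (\<lambda>u. f_dress z \<pi> (F u))))"
proof -
  define b where "b = - cnj z"
  have b: "cnj b = - z" "b \<noteq> z" "b \<noteq> cnj z" "- z \<noteq> z" "- z \<noteq> cnj z" "Im b \<noteq> 0"
    using z by (auto simp: b_def complex_eq_iff)
  have \<Omega>: "open \<Omega>" "0 \<in> \<Omega>" using domain by (auto simp: frame_domain_def)
  define B0 where "B0 = (\<lambda>u. cmat (\<beta> u))"
  define H0 where "H0 = (\<lambda>u. cvec (h u))"
  obtain \<phi> where h0: "hermitian_frame \<Omega> B0 H0 \<phi> E X"
    using flat_egoroff_hermitian_frame[OF domain egoroff frame blocks] unfolding B0_def H0_def beta by blast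
  interpret f0: hermitian_frame \<Omega> B0 H0 \<phi> E X by (rule h0)
  interpret s1: dressed_frame \<Omega> B0 H0 \<phi> E X z \<pi>
    by unfold_locales (use z proj in auto)
  obtain E1 X1 where h1: "hermitian_frame \<Omega> s1.B' s1.H' s1.\<phi>' E1 X1"
    and dr1: "\<And>u. u \<in> \<Omega> \<Longrightarrow> is_dressing (simple_element_ext z \<pi>) (\<lambda>\<mu>. block (E u \<mu>) (X u \<mu>) 1)
      (\<lambda>\<mu>. block (E1 u \<mu>) (X1 u \<mu>) 1)"
    and off1: "\<And>u \<mu>. u \<in> \<Omega> \<Longrightarrow> \<mu> \<notin> {z, cnj z} \<Longrightarrow>
        E1 u \<mu> = simple_element z \<pi> \<mu> ** E u \<mu> ** simple_element (cnj z) (s1.pt u) \<mu>"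
      "\<And>u \<mu>. u \<in> \<Omega> \<Longrightarrow> \<mu> \<notin> {z, cnj z} \<Longrightarrow> X1 u \<mu> = simple_element (cnj z) (perp \<pi>) \<mu> *v
          (X u \<mu> - ((cnj z - z) / (\<mu> - z)) *s (E u \<mu> *v (s1.pt u *v s1.\<eta> u)))"
    using s1.dressed_frame_exists by blast
  have AC: "simple_element z \<pi> b ** simple_element (cnj z) \<pi> b = mat 1"
    using simple_element_inverse(1)[OF proj b(2,3)] .
  have invA: "invertible (simple_element z \<pi> b)" using AC by (rule matrix_inv_unique_right)
  have hpb: "hermitian_projection (conj_mat \<pi>)" using proj by (rule hermitian_projection_conj)
  have rho_formula: "\<rho> = proj_formula (simple_element z \<pi> b) (conj_mat \<pi>)"
    unfolding rho rho_proj_def b_def[symmetric] by (rule projection_onto_image[OF hpb invA])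
  have h\<rho>: "hermitian_projection \<rho>"
    unfolding rho_formula by (rule hermitian_projection_formula[OF hpb invA])
  have im\<rho>: "image_mat \<rho> = (\<lambda>x. simple_element z \<pi> b *v x) ` image_mat (conj_mat \<pi>)"
    unfolding rho_formula by (rule image_proj_formula[OF hpb invA])
  interpret f1: hermitian_frame \<Omega> s1.B' s1.H' s1.\<phi>' E1 X1 by (rule h1)
  interpret s2: dressed_frame \<Omega> s1.B' s1.H' s1.\<phi>' E1 X1 b \<rho>
    by unfold_locales (use b h\<rho> in auto)
  obtain E2 X2 where h2: "hermitian_frame \<Omega> s2.B' s2.H' s2.\<phi>' E2 X2"
    and dr2: "\<And>u. u \<in> \<Omega> \<Longrightarrow> is_dressing (simple_element_ext b \<rho>) (\<lambda>\<mu>. block (E1 u \<mu>) (X1 u \<mu>) 1)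
      (\<lambda>\<mu>. block (E2 u \<mu>) (X2 u \<mu>) 1)"
    and off2: "\<And>u \<mu>. u \<in> \<Omega> \<Longrightarrow> \<mu> \<notin> {b, cnj b} \<Longrightarrow> X2 u \<mu> = simple_element (cnj b) (perp \<rho>) \<mu> *v
          (X1 u \<mu> - ((cnj b - b) / (\<mu> - b)) *s (E1 u \<mu> *v (s2.pt u *v s2.\<eta> u)))"
    using s2.dressed_frame_exists by blast
  interpret f2: hermitian_frame \<Omega> s2.B' s2.H' s2.\<phi>' E2 X2 by (rule h2)
  define F2 where "F2 = (\<lambda>u \<mu>. block (E2 u \<mu>) (X2 u \<mu>) 1)"

  have Fu: "F u = (\<lambda>\<mu>. block (E u \<mu>) (X u \<mu>) 1)" if "u \<in> \<Omega>" for u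
    using blocks[OF that] by (simp add: fun_eq_iff)
  have d1: "is_dressing (simple_element_ext z \<pi>) (F u) (\<lambda>\<mu>. block (E1 u \<mu>) (X1 u \<mu>) 1)"
    and d2: "is_dressing (simple_element_ext b \<rho>) (\<lambda>\<mu>. block (E1 u \<mu>) (X1 u \<mu>) 1) (F2 u)"
    if "u \<in> \<Omega>" for u
    using dr1[OF that] dr2[OF that] by (simp_all add: Fu that F2_def)
  have dress1: "dress (simple_element_ext z \<pi>) (F u) = (\<lambda>\<mu>. block (E1 u \<mu>) (X1 u \<mu>) 1)"
    if "u \<in> \<Omega>" for u using d1[OF that] by (rule is_dressing_imp_dress)
  have f_dress_eq: "f_dress z \<pi> (F u) = F2 u" if "u \<in> \<Omega>" for u
    unfolding f_dress_def dress1[OF that] rho[symmetric] b_def[symmetric]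
    using d2[OF that] by (rule is_dressing_imp_dress)
  have F_plus: "F u \<in> loops_plus" if "u \<in> \<Omega>" for u
    using frame that by (simp add: extended_frame_def frame_with_data_def loops_plus_def)
  have dressable: "f_dressable z \<pi> (F u)" if "u \<in> \<Omega>" for u
    unfolding f_dressable_def dress1[OF that] rho[symmetric] b_def[symmetric]
  proof
    show "dressable (simple_element_ext z \<pi>) (F u)"
      using d1[OF that] F_plus[OF that] by (rule is_dressing_imp_dressable)
    have "(\<lambda>\<mu>. block (E1 u \<mu>) (X1 u \<mu>) 1) \<in> loops_plus"
      using d1[OF that] by (simp add: is_dressing_def)
    with d2[OF that] show "dressable (simple_element_ext b \<rho>) (\<lambda>\<mu>. block (E1 u \<mu>) (X1 u \<mu>) 1)"
      by (rule is_dressing_imp_dressable)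
  qed

  have pt1: "\<pi>t u = s1.pt u" if "u \<in> \<Omega>" for u
    using s1.pt_eq[OF that] by (simp add: pit)
  have et1: "\<eta>1 u = s1.\<eta> u" if "u \<in> \<Omega>" for u
    using s1.\<eta>_eq[OF that] by (simp add: eta1)
  \<comment> \<open>the second projection in terms of the original frame: the factor
    \<open>g\<^bsub>z,\<pi>\<^esub>\<close> in the definition of \<open>\<rho>\<close> cancels against
    the left factor of the once dressed frame\<close>
  have pt2: "\<rho>t u = s2.pt u" if u: "u \<in> \<Omega>" for u
  proof -
    have E1b: "E1 u b = simple_element z \<pi> b ** E u b ** simple_element (cnj z) (s1.pt u) b"
      using off1(1)[OF u] b by simp
    have iE: "E u b ** matrix_inv (E u b) = mat 1" using f0.unitary(1)[OF u] f0.matrix_inv_E[OF u] by simp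
    have "E1 u b ** (simple_element z (s1.pt u) b ** matrix_inv (E u b))
        = simple_element z \<pi> b ** E u b **
          (simple_element (cnj z) (s1.pt u) b ** simple_element z (s1.pt u) b) ** matrix_inv (E u b)"
      unfolding E1b by (simp only: mat_mul_assoc_right)
    also have "\<dots> = simple_element z \<pi> b"
      using simple_element_inverse(2)[OF s1.pt_herm[OF u] b(2,3)] iE by (simp add: mat_mul_assoc_right)
    finally have eq: "E1 u b ** (simple_element z (s1.pt u) b ** matrix_inv (E u b)) = simple_element z \<pi> b" .
    have "matrix_inv (E1 u b) ** E1 u b = mat 1" using f1.unitary(2)[OF u] f1.matrix_inv_E[OF u] by simp
    then have "matrix_inv (E1 u b) ** simple_element z \<pi> b = simple_element z (s1.pt u) b ** matrix_inv (E u b)"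
      unfolding eq[symmetric] by (simp add: matrix_mul_assoc)
    then have "(\<lambda>x. matrix_inv (E1 u b) *v x) ` image_mat \<rho> =
      (\<lambda>x. (simple_element z (s1.pt u) b ** matrix_inv (E u b)) *v x) ` image_mat (conj_mat \<pi>)"
      unfolding im\<rho> image_image by (simp add: matrix_vector_mul_assoc)
    then show ?thesis using s2.pt_eq[OF u] by (simp add: rhot pt1 u b_def)
  qed
  \<comment> \<open>likewise for the vector, by checking that the once dressed frame at \<open>-z\<close> maps it to
    the once dressed translation part\<close>
  have et2: "\<eta>12 u = s2.\<eta> u" if u: "u \<in> \<Omega>" for u
  proof -
    let ?Q = "s1.pt u" and ?c = "(- z - z) / (- z - cnj z)" and ?r = "(cnj z - z) / (cnj z + z)"
    define x where "x = matrix_inv (E u (- z)) *v X u (- z)"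
    define y where "y = ?Q *v s1.\<eta> u"
    have Q: "hermitian_projection ?Q" by (rule s1.pt_herm[OF u])
    have nz: "- z \<notin> {z, cnj z}" using b by auto
    have \<eta>12: "\<eta>12 u = simple_element (cnj z) (perp ?Q) (- z) *v x + ?r *s y"
      by (simp add: eta12 x_def y_def pt1 et1 u mat_vec_assoc_right)
    have Ex: "E u (- z) *v x = X u (- z)"
      unfolding x_def matrix_vector_mul_assoc f0.matrix_inv_E[OF u] f0.unitary(1)[OF u] by simp
    have k: "simple_element (cnj z) P' (- z) = smult_mat ?c (simple_element z (perp P') (- z))" for P' :: "complex^'n^'n"
      using simple_element_perp[of "- z" "cnj z" P'] b by simp
    have kk: "simple_element (cnj z) (perp P') (- z) = smult_mat ?c (simple_element z P' (- z))" for P' :: "complex^'n^'n"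
      using k[of "perp P'"] by (simp add: perp_def)
    have c1: "simple_element (cnj z) ?Q (- z) *v (simple_element (cnj z) (perp ?Q) (- z) *v x) = ?c *s x"
      using simple_element_inverse(2)[OF Q b(4,5)]
      unfolding kk by (simp add: matrix_vector_mul_assoc mat_algebra_ring)
    have c2: "simple_element (cnj z) ?Q (- z) *v y = y"
      using spectral_fix(1)[OF Q, of 1] unfolding y_def
      by (simp add: simple_element_spectral matrix_vector_mul_assoc smult_mat_algebra)
    have rc: "?r = - (?c * ((cnj z - z) / (- z - z)))"
    proof -
      have "cnj z + z \<noteq> 0" "z \<noteq> 0" using z by (auto simp: complex_eq_iff)
      moreover have "- z - cnj z = - (cnj z + z)" "- z - z = - (2 * z)" by simp_all
      ultimately show ?thesis by (simp only: minus_divide_divide) (simp add: divide_simps)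
    qed
    have "E1 u (- z) *v \<eta>12 u = simple_element z \<pi> (- z) *v (E u (- z) *v (?c *s x + ?r *s y))"
      using off1(1)[OF u nz] by (simp only: \<eta>12 mat_vec_assoc_right mat_algebra_ring(11,20) c1 c2)
    also have "\<dots> = simple_element z \<pi> (- z) *v
        (?c *s (X u (- z) - ((cnj z - z) / (- z - z)) *s (E u (- z) *v y)))"
      unfolding rc mat_algebra_ring(11,20) Ex
      by (simp add: vector_ssub_ldistrib vector_smult_assoc mat_algebra_ring vec_eq_iff)
    also have "\<dots> = X1 u (- z)"
      unfolding off1(2)[OF u nz] kk y_def by (simp only: mat_algebra_ring(19,20))
    finally have "matrix_inv (E1 u (- z)) *v X1 u (- z) = (matrix_inv (E1 u (- z)) ** E1 u (- z)) *v \<eta>12 u"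
      by (simp add: mat_vec_assoc_right)
    then show ?thesis
      using f1.unitary(2)[OF u, of "- z"] s2.\<eta>_eq[OF u] by (simp add: b f1.matrix_inv_E[OF u])
  qed

  have reflect_F: "reflect (F u) = F u" if u: "u \<in> \<Omega>" for u
  proof -
    have "conj_mat (B0 x) = B0 x" "cnj_vec (H0 x) = H0 x" for x
      by (simp_all add: B0_def H0_def vec_eq_iff)
    from f0.reflect_frame[OF this u] show ?thesis
      by (simp add: fun_eq_iff reflect_def Fu u conj_mat_block)
  qed
  \<comment> \<open>the reflected frame is another dressing of the same frame by the same loop, hence equal\<close>
  have reflect_F2: "reflect (F2 u) = F2 u" if u: "u \<in> \<Omega>" for u
  proof -
    let ?f = "\<lambda>\<mu>. simple_element_ext b \<rho> \<mu> ** simple_element_ext z \<pi> \<mu>"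
    have d: "is_dressing ?f (F u) (F2 u)" using is_dressing_comp[OF d1[OF u] d2[OF u]] .
    have "reflect ?f \<mu> = ?f \<mu>" if "cmod z < cmod \<mu>" for \<mu>
    proof -
      have m: "\<mu> \<notin> {z, - cnj z}" using that by auto
      have c: "- cnj \<mu> - w = - cnj (\<mu> + cnj w)" for w by simp
      have sc: "cnj ((- cnj \<mu> - cnj b) / (- cnj \<mu> - b) * ((- cnj \<mu> - cnj z) / (- cnj \<mu> - z)))
          = (\<mu> - cnj b) / (\<mu> - b) * ((\<mu> - cnj z) / (\<mu> - z))"
        unfolding c minus_divide_divide by (simp add: b_def mult.commute)
      show ?thesis
        unfolding reflect_def simple_element_ext_def block_mult conj_mat_block block_eq_iff
        using reflect_simple_product[OF proj z rho_formula[unfolded b_def] m] sc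
        by (simp add: b_def mat_algebra_ring vec_eq_iff[of "cnj_vec _"])
    qed
    from is_dressing_cong[OF is_dressing_reflect[OF d] this]
    have "is_dressing ?f (F u) (reflect (F2 u))" by (simp add: reflect_F u)
    then show ?thesis using d by (rule is_dressing_unique)
  qed
  have real2: "conj_mat (E2 u (- cnj \<mu>)) = E2 u \<mu>" "cnj_vec (X2 u (- cnj \<mu>)) = X2 u \<mu>"
    if "u \<in> \<Omega>" for u \<mu>
    using fun_cong[OF reflect_F2[OF that], of \<mu>]
    by (simp_all add: reflect_def F2_def conj_mat_block block_eq_iff)

  define hh where "hh = (\<lambda>u. \<chi> i. Re (s2.H' u $ i))"
  define \<beta>h where "\<beta>h = (\<lambda>u. \<chi> i j. if i = j then 0 else Re (s2.B' u $ i $ j))"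
  interpret r: real_frame \<Omega> s2.B' s2.H' s2.\<phi>' E2 X2 hh \<beta>h
  proof
    fix u i j assume u: "u \<in> \<Omega>"
    show "s2.H' u = cvec (hh u)"
      using f2.real_data(1)[OF real2 u] by (simp add: vec_eq_iff hh_def complex_eq_iff)
    show "s2.B' u $ i $ j = of_real (\<beta>h u $ i $ j)" if "i \<noteq> j"
      using f2.real_data(2)[OF real2 u that] that by (simp add: \<beta>h_def complex_eq_iff)
    show "\<beta>h u $ i $ i = 0" by (simp add: \<beta>h_def)
  qed

  have s_eq: "s1.s = \<i> * (z - cnj z)" "s2.s = \<i> * (z - cnj z)"
    by (simp_all add: s1.s_def s2.s_def b) (simp add: b_def)
  have hh_eq: "cvec (hh u) = cvec (h u) + (\<i> * (z - cnj z)) *s (\<pi>t u *v \<eta>1 u + \<rho>t u *v \<eta>12 u)"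
    if u: "u \<in> \<Omega>" for u
    unfolding r.H_eq[OF u, symmetric] s2.H'_def s1.H'_def pt1[OF u] pt2[OF u] et1[OF u] et2[OF u] s_eq
    by (simp add: H0_def vector_add_ldistrib add.assoc)
  have \<beta>h_eq: "cmat (\<beta>h u) = cmat (\<beta> u) + smult_mat (\<i> * (z - cnj z)) (off_diag (\<pi>t u + \<rho>t u))"
    if u: "u \<in> \<Omega>" for u
  proof -
    have "cmat (\<beta>h u) $ i $ j = cmat (\<beta> u) $ i $ j
        + smult_mat (\<i> * (z - cnj z)) (off_diag (\<pi>t u + \<rho>t u)) $ i $ j" for i j
    proof (cases "i = j")
      case True
      then show ?thesis by (simp add: \<beta>h_def off_diag_def beta rotation_coeff_def)
    next
      case False
      have "complex_of_real (\<beta>h u $ i $ j) = s2.B' u $ i $ j" using r.B_eq[OF u False] by simp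
      also have "\<dots> = of_real (\<beta> u $ i $ j) + \<i> * (z - cnj z) * (\<pi>t u $ i $ j + \<rho>t u $ i $ j)"
        unfolding s2.B'_def s1.B'_def pt1[OF u] pt2[OF u] s_eq by (simp add: B0_def algebra_simps)
      finally show ?thesis using False by (simp add: off_diag_def)
    qed
    then show ?thesis by (simp add: vec_eq_iff)
  qed
  have X2_eq: "X2 u \<mu> =
          (simple_element (- z) (perp \<rho>) \<mu> ** simple_element (cnj z) (perp \<pi>) \<mu>) *v
            (X u \<mu>
             - ((cnj z - z) / (\<mu> - z)) *s ((E u \<mu> ** \<pi>t u) *v \<eta>1 u)
             - ((cnj z - z) / (\<mu> + cnj z)) *s
                 ((E u \<mu> ** simple_element z (perp (\<pi>t u)) \<mu> ** \<rho>t u) *v \<eta>12 u))"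
    if u: "u \<in> \<Omega>" and \<mu>: "\<mu> \<notin> {z, cnj z, - z, - cnj z}" for u \<mu>
  proof -
    let ?Q = "s1.pt u" and ?y = "s2.pt u *v s2.\<eta> u"
    have m: "\<mu> \<noteq> z" "\<mu> \<noteq> cnj z" "\<mu> \<notin> {z, cnj z}" "\<mu> \<notin> {b, cnj b}" using \<mu> b by (auto simp: b_def)
    have 1: "simple_element (cnj z) ?Q \<mu> = smult_mat ((\<mu> - z) / (\<mu> - cnj z)) (simple_element z (perp ?Q) \<mu>)"
      using simple_element_perp[of \<mu> "cnj z" ?Q] m by simp
    have 2: "simple_element (cnj z) (perp \<pi>) \<mu> = smult_mat ((\<mu> - z) / (\<mu> - cnj z)) (simple_element z \<pi> \<mu>)"
      using simple_element_perp[of \<mu> "cnj z" "perp \<pi>"] m by (simp add: perp_def)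
    have "E1 u \<mu> *v ?y = simple_element (cnj z) (perp \<pi>) \<mu> *v (E u \<mu> *v (simple_element z (perp ?Q) \<mu> *v ?y))"
      unfolding off1(1)[OF u m(3)] 1 2 by (simp only: mat_vec_assoc_right mat_algebra_ring(19,20))
    moreover have d: "- z - b = cnj z - z" "\<mu> - b = \<mu> + cnj z" by (simp_all add: b_def)
    ultimately show ?thesis
      unfolding off2[OF u m(4)] off1(2)[OF u m(3)] pt1[OF u] pt2[OF u] et1[OF u] et2[OF u] b(1) d
      by (simp add: mat_vec_assoc_right mat_algebra_ring)
  qed

  have F2_init: "F2 0 \<mu> = mat 1" for \<mu>
    by (simp add: F2_def f2.E_zero f2.X_zero block_one)
  have F2_der: "((\<lambda>w. f_dress z \<pi> (F w) \<mu>) has_derivative (\<lambda>v. F2 u \<mu> ** frame_form (\<beta>h u) (hh u) \<mu> v)) (at u)"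
    if u: "u \<in> \<Omega>" for u \<mu>
  proof -
    have "((\<lambda>w. F2 w \<mu>) has_derivative (\<lambda>v. F2 u \<mu> ** block_conn (s2.B' u) (s2.H' u) \<mu> v)) (at u)"
      unfolding F2_def
      by (rule has_derivative_block_iff[of "\<lambda>x. E2 x \<mu>" "\<lambda>x. X2 x \<mu>", THEN iffD2])
        (use f2.E_der[OF u] f2.X_der[OF u] in blast)
    moreover have "block_conn (s2.B' u) (s2.H' u) \<mu> v = frame_form (\<beta>h u) (hh u) \<mu> v" for v
      unfolding frame_form_block_conn block_conn_def r.conn_eq[OF u] r.H_eq[OF u] ..
    ultimately have "((\<lambda>w. F2 w \<mu>) has_derivative (\<lambda>v. F2 u \<mu> ** frame_form (\<beta>h u) (hh u) \<mu> v)) (at u)"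
      by simp
    then show ?thesis
      by (rule has_derivative_transform_within_open[OF _ \<Omega>(1) u]) (simp add: f_dress_eq)
  qed
  have F2_plus: "F2 u \<in> loops_plus" if "u \<in> \<Omega>" for u
    using d2[OF that] by (simp add: is_dressing_def)
  have data: "frame_with_data \<Omega>' \<beta>' hh (\<lambda>u. f_dress z \<pi> (F u))"
    if sub: "\<Omega>' \<subseteq> \<Omega>" and \<beta>': "\<And>u. u \<in> \<Omega>' \<Longrightarrow> \<beta>' u = \<beta>h u" for \<Omega>' \<beta>'
    unfolding frame_with_data_def
  proof (intro conjI ballI allI)
    fix u \<mu> assume u': "u \<in> \<Omega>'"
    then have u: "u \<in> \<Omega>" using sub by blast
    show "\<exists>E X. f_dress z \<pi> (F u) \<mu> = block E X 1" using f_dress_eq[OF u] by (auto simp: F2_def)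
    show "holomorphic_mat (f_dress z \<pi> (F u)) UNIV" "invertible (f_dress z \<pi> (F u) \<mu>)"
      using F2_plus[OF u] f_dress_eq[OF u] by (simp_all add: loops_plus_def)
    show "((\<lambda>w. f_dress z \<pi> (F w) \<mu>) has_derivative
        (\<lambda>v. f_dress z \<pi> (F u) \<mu> ** frame_form (\<beta>' u) (hh u) \<mu> v)) (at u)"
      using F2_der[OF u] unfolding \<beta>'[OF u'] f_dress_eq[OF u] .
  next
    show "f_dress z \<pi> (F 0) \<mu> = mat 1" for \<mu> using f_dress_eq[OF \<Omega>(2)] F2_init by simp
  qed

  \<comment> \<open>at the base point the translation part vanishes, so the metric coefficients there do not change\<close>
  have hh0: "hh 0 = h 0"
  proof -
    have "cvec (hh 0) = cvec (h 0)"
      unfolding hh_eq[OF \<Omega>(2)] et1[OF \<Omega>(2)] et2[OF \<Omega>(2)] s1.\<eta>_zero s2.\<eta>_zero by simp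
    then show ?thesis by (simp add: vec_eq_iff)
  qed
  have shrink: "\<exists>\<Omega>'. frame_domain \<Omega>' \<and> \<Omega>' \<subseteq> \<Omega> \<and> (\<forall>u\<in>\<Omega>'. \<forall>i. hh u $ i \<noteq> 0)"
  proof -
    have "isCont (\<lambda>u. hh u $ i) u" if "u \<in> \<Omega>" for u i
      using diffk_imp_differentiable[OF r.h_component_smooth[of "Suc 0"] that]
      by (rule differentiable_imp_continuous_within)
    then have "continuous_on \<Omega> (\<lambda>u. hh u $ i)" for i
      by (intro continuous_at_imp_continuous_on) blast
    then have "open (\<Omega> \<inter> (\<lambda>u. hh u $ i) -` (- {0}))" for i
      by (intro continuous_open_preimage \<Omega>(1)) auto
    then have "open (\<Inter>i\<in>UNIV. \<Omega> \<inter> (\<lambda>u. hh u $ i) -` (- {0}))"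
      by (intro open_INT) auto
    moreover have "0 \<in> (\<Inter>i\<in>UNIV. \<Omega> \<inter> (\<lambda>u. hh u $ i) -` (- {0}))"
      using egoroff \<Omega>(2) by (simp add: hh0 flat_egoroff_def)
    ultimately obtain e where e: "e > 0" "ball 0 e \<subseteq> (\<Inter>i\<in>UNIV. \<Omega> \<inter> (\<lambda>u. hh u $ i) -` (- {0}))"
      using openE by blast
    have "frame_domain (ball (0 :: real^'n) e)"
      using e(1) by (simp add: frame_domain_def convex_imp_simply_connected)
    moreover have "ball 0 e \<subseteq> \<Omega> \<and> (\<forall>u\<in>ball 0 e. \<forall>i. hh u $ i \<noteq> 0)" using e(2) by blast
    ultimately show ?thesis by blast
  qed
  have new_metric: "flat_egoroff \<Omega>' hh \<and> (\<forall>u\<in>\<Omega>'. rotation_coeff hh u = \<beta>h u) \<and>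
        extended_frame \<Omega>' hh (\<lambda>u. f_dress z \<pi> (F u))"
    if \<Omega>': "frame_domain \<Omega>' \<and> \<Omega>' \<subseteq> \<Omega> \<and> (\<forall>u\<in>\<Omega>'. \<forall>i. hh u $ i \<noteq> 0)" for \<Omega>'
  proof -
    have "open \<Omega>'" "\<Omega>' \<subseteq> \<Omega>" and nz: "\<And>u i. u \<in> \<Omega>' \<Longrightarrow> hh u $ i \<noteq> 0"
      using \<Omega>' by (auto simp: frame_domain_def)
    have rot: "rotation_coeff hh u = \<beta>h u" if "u \<in> \<Omega>'" for u
      using r.rotation_coeff_eq[of u] nz that \<open>\<Omega>' \<subseteq> \<Omega>\<close> by blast
    show ?thesis
      using r.flat_egoroff[OF \<open>open \<Omega>'\<close> \<open>\<Omega>' \<subseteq> \<Omega>\<close>] nz rot data[OF \<open>\<Omega>' \<subseteq> \<Omega>\<close> rot]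
      by (simp add: extended_frame_def)
  qed
  show ?thesis
  proof (intro conjI exI[of _ E2] exI[of _ X2] exI[of _ hh] exI[of _ \<beta>h])
    show "\<forall>u\<in>\<Omega>. f_dressable z \<pi> (F u)" using dressable by blast
    show "\<forall>u\<in>\<Omega>. \<forall>\<mu>. f_dress z \<pi> (F u) \<mu> = block (E2 u \<mu>) (X2 u \<mu>) 1"
      by (simp add: f_dress_eq F2_def)
    show "frame_with_data \<Omega> \<beta>h hh (\<lambda>u. f_dress z \<pi> (F u))" by (rule data) auto
  qed (use X2_eq hh_eq \<beta>h_eq shrink new_metric in blast)+
qed

end
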